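(* Let $X$ and $Y$ be two rearrangement invariant function spaces with the Fatou property (both over $(0,1)$ or both over $(0,\infty)$). Suppose that the space $Y$ is $1$-DH and that the ideal $M(X,Y)_o$ is non-trivial. Then for every $\lambda\in M(X,Y)$ $$\|M_\lambda\colon X\to Y\|_w=\lim_{n\to\infty}\big\|\lambda^\star\chi_{(0,\frac1n)\cup(n,\infty)}\big\|_{M(X,Y)}.$$
   Context: Let $\Omega=(0,1)$ or $(0,\infty)$ with Lebesgue measure. A Köthe space on $\Omega$ is a Banach space $X$ which is a linear subspace of $L_0(\Omega)$ (a.e.-equivalence classes of real or complex measurable functions integrable over sets of finite measure), such that if $|f|\le|g|$ a.e. with $f$ measurable and $g\in X$, then $f\in X$ and $\|f\|_X\le\|g\|_X$, and such that $\chi_A\in X$ whenever $A$ has finite measure. It is a rearrangement invariant function space if moreover $f$ equi-measurable with $g\in X$ implies $f\in X$ and $\|f\|_X=\|g\|_X$. The Fatou property means that the closed unit ball is closed in $L_0(\Omega)$ for the topology of local convergence in measure. $\lambda^\star$ is the decreasing rearrangement of $\lambda$ (for $\Omega=(0,1)$ the set $(n,\infty)$ plays no role). $M(X,Y)=\{g\in L_0(\Omega): fg\in Y\text{ for all }f\in X\}$ with norm $\|g\|_{M(X,Y)}=\sup_{\|f\|_X\le1}\|fg\|_Y$; $M_\lambda f=\lambda f$. $\|T\colon X\to Y\|_w=\inf\{\|T-W\|_{X\to Y}:W\colon X\to Y\text{ weakly compact}\}$. For a Köthe space $Z$, $Z_o$ is the set of $f\in Z$ such that $\|f_n\|_Z\to0$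 for every sequence $(f_n)$ in $Z$ with $0\le f_n\le|f|$ and $f_n\downarrow0$ pointwise; non-trivial means $\neq\{0\}$. $Y$ is $1$-DH ($1$-disjointly homogeneous) if every normalized sequence of pairwise disjointly supported elements has a subsequence equivalent to the unit vector basis of $\ell_1$. *)

theory Defs
  imports "HOL-Analysis.Analysis"
begin

text \<open>
  Function spaces over a measurable set \<open>\<Omega> \<subseteq> \<real>\<close>, with scalars in a type \<open>'k\<close> of sort
  \<open>{real_normed_field, euclidean_space}\<close>.  Both \<open>real\<close> and \<open>complex\<close> have this sort and, by
  Frobenius' theorem, they are the only such types up to isometric isomorphism.

  Classes of functions modulo a.e. equality are handled through representatives: a space is a set of
  functions together with a norm on representatives, functions that agree almost everywhere
  in \<open>\<Omega>\<close> being regarded as equal.  Values outside \<open>\<Omega>\<close> are irrelevant.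
\<close>

record 'k fun_space =
  elems :: "(real \<Rightarrow> 'k) set"
  nrm :: "(real \<Rightarrow> 'k) \<Rightarrow> real"

definition unit_ball :: "'k fun_space \<Rightarrow> (real \<Rightarrow> 'k) set" where
  "unit_ball X = {f \<in> elems X. nrm X f \<le> 1}"

definition L0 :: "real set \<Rightarrow> (real \<Rightarrow> 'k::{real_normed_field, euclidean_space}) set" where
  "L0 \<Omega> = {f \<in> borel_measurable (lebesgue_on \<Omega>).
     \<forall>A \<in> sets (lebesgue_on \<Omega>). emeasure (lebesgue_on \<Omega>) A < \<infinity>
        \<longrightarrow> set_integrable (lebesgue_on \<Omega>) A f}"


section \<open>Koethe spaces and rearrangement invariant spaces\<close>

definition normed_fun_space ::
    "real set \<Rightarrow> 'k::{real_normed_field, euclidean_space} fun_space \<Rightarrow> bool" where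
  "normed_fun_space \<Omega> X \<longleftrightarrow>
     elems X \<subseteq> L0 \<Omega> \<and>
     (\<lambda>x. 0) \<in> elems X \<and>
     (\<forall>f\<in>elems X. \<forall>g\<in>elems X. (\<lambda>x. f x + g x) \<in> elems X) \<and>
     (\<forall>c. \<forall>f\<in>elems X. (\<lambda>x. c * f x) \<in> elems X) \<and>
     (\<forall>f\<in>elems X. 0 \<le> nrm X f) \<and>
     (\<forall>f\<in>elems X. nrm X f = 0 \<longleftrightarrow> (AE x in lebesgue_on \<Omega>. f x = 0)) \<and>
     (\<forall>f\<in>elems X. \<forall>g\<in>elems X. nrm X (\<lambda>x. f x + g x) \<le> nrm X f + nrm X g) \<and>
     (\<forall>c. \<forall>f\<in>elems X. nrm X (\<lambda>x. c * f x) = norm c * nrm X f)"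

definition complete_fun_space ::
    "'k::{real_normed_field, euclidean_space} fun_space \<Rightarrow> bool" where
  "complete_fun_space X \<longleftrightarrow>
     (\<forall>f :: nat \<Rightarrow> real \<Rightarrow> 'k.
        (\<forall>n. f n \<in> elems X) \<and>
        (\<forall>e>0. \<exists>N. \<forall>m\<ge>N. \<forall>n\<ge>N. nrm X (\<lambda>x. f m x - f n x) < e)
        \<longrightarrow> (\<exists>g\<in>elems X. (\<lambda>n. nrm X (\<lambda>x. f n x - g x)) \<longlonglongrightarrow> 0))"

definition koethe_space ::
    "real set \<Rightarrow> 'k::{real_normed_field, euclidean_space} fun_space \<Rightarrow> bool" where
  "koethe_space \<Omega> X \<longleftrightarrow>
     normed_fun_space \<Omega> X \<and> complete_fun_space X \<and>
     (\<forall>f g. f \<in> borel_measurable (lebesgue_on \<Omega>) \<and> g \<in> elems X \<and>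
            (AE x in lebesgue_on \<Omega>. norm (f x) \<le> norm (g x))
        \<longrightarrow> f \<in> elems X \<and> nrm X f \<le> nrm X g) \<and>
     (\<forall>A\<in>sets (lebesgue_on \<Omega>). emeasure (lebesgue_on \<Omega>) A < \<infinity>
        \<longrightarrow> (\<lambda>x. indicator A x) \<in> elems X)"

definition distr_fun ::
    "real set \<Rightarrow> (real \<Rightarrow> 'k::{real_normed_field, euclidean_space}) \<Rightarrow> real \<Rightarrow> ennreal" where
  "distr_fun \<Omega> f s = emeasure (lebesgue_on \<Omega>) {x\<in>\<Omega>. s < norm (f x)}"

definition equimeasurable ::
    "real set \<Rightarrow> (real \<Rightarrow> 'k::{real_normed_field, euclidean_space}) \<Rightarrow> (real \<Rightarrow> 'k) \<Rightarrow> bool" where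
  "equimeasurable \<Omega> f g \<longleftrightarrow> (\<forall>s\<ge>0. distr_fun \<Omega> f s = distr_fun \<Omega> g s)"

definition ri_space ::
    "real set \<Rightarrow> 'k::{real_normed_field, euclidean_space} fun_space \<Rightarrow> bool" where
  "ri_space \<Omega> X \<longleftrightarrow>
     koethe_space \<Omega> X \<and>
     (\<forall>f g. f \<in> borel_measurable (lebesgue_on \<Omega>) \<and> g \<in> elems X \<and> equimeasurable \<Omega> f g
        \<longrightarrow> f \<in> elems X \<and> nrm X f = nrm X g)"

text \<open>
  If no real \<open>s\<close> qualifies, the rearrangement is \<open>\<infinity>\<close> in the usual convention, and the real
  infimum below is a dummy value.  At \<open>t > 0\<close> this does not occur for multipliers between
  rearrangement invariant spaces: some level set of such a function has finite measure, and the
  measures of its level sets then decrease to \<open>0\<close>.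
\<close>

definition decr_rearr ::
    "real set \<Rightarrow> (real \<Rightarrow> 'k::{real_normed_field, euclidean_space}) \<Rightarrow> real \<Rightarrow> real" where
  "decr_rearr \<Omega> f t = Inf {s. 0 \<le> s \<and> distr_fun \<Omega> f s \<le> ennreal t}"


section \<open>Local convergence in measure and the Fatou property\<close>

definition measure_nbhd ::
    "real set \<Rightarrow> (real \<Rightarrow> 'k::{real_normed_field, euclidean_space}) \<Rightarrow> real set \<Rightarrow> real \<Rightarrow> real
      \<Rightarrow> (real \<Rightarrow> 'k) set" where
  "measure_nbhd \<Omega> f A e d =
     {g \<in> L0 \<Omega>. emeasure (lebesgue_on \<Omega>) {x\<in>A. e < norm (f x - g x)} < ennreal d}"

text \<open>
  The sets \<open>measure_nbhd \<Omega> f A e d\<close> are a base of neighbourhoods of \<open>f\<close>, but need not be open.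
\<close>

definition local_measure_topology ::
    "real set \<Rightarrow> (real \<Rightarrow> 'k::{real_normed_field, euclidean_space}) topology" where
  "local_measure_topology \<Omega> = topology (\<lambda>U. U \<subseteq> L0 \<Omega> \<and>
     (\<forall>f\<in>U. \<exists>A\<in>sets (lebesgue_on \<Omega>). \<exists>e>0. \<exists>d>0.
        emeasure (lebesgue_on \<Omega>) A < \<infinity> \<and> measure_nbhd \<Omega> f A e d \<subseteq> U))"

lemma measure_nbhd_mono:
  fixes f :: "real \<Rightarrow> 'k::{real_normed_field, euclidean_space}"
  assumes f: "f \<in> L0 \<Omega>" and B: "B \<in> sets (lebesgue_on \<Omega>)"
    and "A \<subseteq> B" and "e' \<le> e" and "d' \<le> d"
  shows "measure_nbhd \<Omega> f B e' d' \<subseteq> measure_nbhd \<Omega> f A e d"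
proof
  fix g assume g: "g \<in> measure_nbhd \<Omega> f B e' d'"
  have [measurable]: "f \<in> borel_measurable (lebesgue_on \<Omega>)" "g \<in> borel_measurable (lebesgue_on \<Omega>)"
    using f g by (auto simp: L0_def measure_nbhd_def)
  have "{x \<in> space (lebesgue_on \<Omega>). e' < norm (f x - g x)} \<in> sets (lebesgue_on \<Omega>)"
    by measurable
  hence "B \<inter> {x \<in> space (lebesgue_on \<Omega>). e' < norm (f x - g x)} \<in> sets (lebesgue_on \<Omega>)"
    using B by blast
  moreover have "B \<inter> {x \<in> space (lebesgue_on \<Omega>). e' < norm (f x - g x)}
      = {x\<in>B. e' < norm (f x - g x)}"
    using sets.sets_into_space[OF B] by blast
  ultimately have "emeasure (lebesgue_on \<Omega>) {x\<in>A. e < norm (f x - g x)}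
      \<le> emeasure (lebesgue_on \<Omega>) {x\<in>B. e' < norm (f x - g x)}"
    using assms by (intro emeasure_mono) auto
  also have "\<dots> < ennreal d'"
    using g by (simp add: measure_nbhd_def)
  also have "\<dots> \<le> ennreal d"
    using \<open>d' \<le> d\<close> by (rule ennreal_leI)
  finally show "g \<in> measure_nbhd \<Omega> f A e d"
    using g by (simp add: measure_nbhd_def)
qed

lemma openin_local_measure_topology:
  fixes U :: "(real \<Rightarrow> 'k::{real_normed_field, euclidean_space}) set"
  shows "openin (local_measure_topology \<Omega>) U \<longleftrightarrow> U \<subseteq> L0 \<Omega> \<and>
     (\<forall>f\<in>U. \<exists>A\<in>sets (lebesgue_on \<Omega>). \<exists>e>0. \<exists>d>0.
        emeasure (lebesgue_on \<Omega>) A < \<infinity> \<and> measure_nbhd \<Omega> f A e d \<subseteq> U)"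
proof -
  define P where "P f U \<longleftrightarrow> (\<exists>A\<in>sets (lebesgue_on \<Omega>). \<exists>e>0. \<exists>d>0.
        emeasure (lebesgue_on \<Omega>) A < \<infinity> \<and> measure_nbhd \<Omega> f A e d \<subseteq> U)"
    for f :: "real \<Rightarrow> 'k" and U
  have mono: "P f V" if PU: "P f U" and UV: "U \<subseteq> V" for f U V
  proof -
    obtain A e d where A: "A \<in> sets (lebesgue_on \<Omega>)" "e > 0" "d > 0"
      "emeasure (lebesgue_on \<Omega>) A < \<infinity>" "measure_nbhd \<Omega> f A e d \<subseteq> U"
      using PU unfolding P_def by blast
    show ?thesis
      unfolding P_def using A(1-4) subset_trans[OF A(5) UV] by blast
  qed
  have int: "P f (U \<inter> V)" if f: "f \<in> L0 \<Omega>" and PU: "P f U" and PV: "P f V" for f U V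
  proof -
    obtain A e d where A: "A \<in> sets (lebesgue_on \<Omega>)" "e > 0" "d > 0"
      "emeasure (lebesgue_on \<Omega>) A < \<infinity>" "measure_nbhd \<Omega> f A e d \<subseteq> U"
      using PU unfolding P_def by blast
    obtain B e' d' where B: "B \<in> sets (lebesgue_on \<Omega>)" "e' > 0" "d' > 0"
      "emeasure (lebesgue_on \<Omega>) B < \<infinity>" "measure_nbhd \<Omega> f B e' d' \<subseteq> V"
      using PV unfolding P_def by blast
    have AB: "A \<union> B \<in> sets (lebesgue_on \<Omega>)" using A(1) B(1) by (rule sets.Un)
    have "emeasure (lebesgue_on \<Omega>) (A \<union> B) \<le> emeasure (lebesgue_on \<Omega>) A + emeasure (lebesgue_on \<Omega>) B"
      using A(1) B(1) by (rule emeasure_subadditive)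
    also have "\<dots> < \<infinity>" using A(4) B(4) by simp
    finally have fin: "emeasure (lebesgue_on \<Omega>) (A \<union> B) < \<infinity>" .
    have "measure_nbhd \<Omega> f (A \<union> B) (min e e') (min d d') \<subseteq> measure_nbhd \<Omega> f A e d"
      by (rule measure_nbhd_mono[OF f AB]) auto
    moreover have "measure_nbhd \<Omega> f (A \<union> B) (min e e') (min d d') \<subseteq> measure_nbhd \<Omega> f B e' d'"
      by (rule measure_nbhd_mono[OF f AB]) auto
    ultimately have sub: "measure_nbhd \<Omega> f (A \<union> B) (min e e') (min d d') \<subseteq> U \<inter> V"
      using A(5) B(5) by (meson Int_greatest subset_trans)
    have "min e e' > 0" "min d d' > 0" using A B by auto
    then show ?thesis unfolding P_def using AB fin sub by blast
  qed
  have "istopology (\<lambda>U. U \<subseteq> L0 \<Omega> \<and> (\<forall>f\<in>U. P f U))"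
    unfolding istopology_def
  proof (rule conjI; intro allI impI)
    fix S T :: "(real \<Rightarrow> 'k) set"
    assume S: "S \<subseteq> L0 \<Omega> \<and> (\<forall>f\<in>S. P f S)" and T: "T \<subseteq> L0 \<Omega> \<and> (\<forall>f\<in>T. P f T)"
    have "P f (S \<inter> T)" if "f \<in> S \<inter> T" for f
      using that S T by (intro int) auto
    then show "S \<inter> T \<subseteq> L0 \<Omega> \<and> (\<forall>f\<in>S \<inter> T. P f (S \<inter> T))"
      using S by auto
  next
    fix K :: "(real \<Rightarrow> 'k) set set"
    assume K: "\<forall>S\<in>K. S \<subseteq> L0 \<Omega> \<and> (\<forall>f\<in>S. P f S)"
    have "P f (\<Union>K)" if f: "f \<in> \<Union>K" for f
    proof -
      obtain S where "S \<in> K" "f \<in> S" using f by auto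
      then show ?thesis using K by (intro mono[of f S "\<Union>K"]) auto
    qed
    then show "\<Union>K \<subseteq> L0 \<Omega> \<and> (\<forall>f\<in>\<Union>K. P f (\<Union>K))"
      using K by auto
  qed
  from topology_inverse'[OF this]
  show ?thesis
    unfolding local_measure_topology_def P_def by simp
qed

definition fatou_property ::
    "real set \<Rightarrow> 'k::{real_normed_field, euclidean_space} fun_space \<Rightarrow> bool" where
  "fatou_property \<Omega> X \<longleftrightarrow> closedin (local_measure_topology \<Omega>) (unit_ball X)"


section \<open>Multipliers, order continuous part, disjoint homogeneity\<close>

definition multiplier_space ::
    "real set \<Rightarrow> 'k::{real_normed_field, euclidean_space} fun_space \<Rightarrow> 'k fun_space
      \<Rightarrow> 'k fun_space" where
  "multiplier_space \<Omega> X Y =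
     \<lparr> elems = {g \<in> L0 \<Omega>. \<forall>f\<in>elems X. (\<lambda>x. f x * g x) \<in> elems Y},
       nrm = (\<lambda>g. SUP f\<in>unit_ball X. nrm Y (\<lambda>x. f x * g x)) \<rparr>"

definition oc_part ::
    "real set \<Rightarrow> 'k::{real_normed_field, euclidean_space} fun_space \<Rightarrow> (real \<Rightarrow> 'k) set" where
  "oc_part \<Omega> Z = {f \<in> elems Z. \<forall>h :: nat \<Rightarrow> real \<Rightarrow> real.
     (\<forall>n. (\<lambda>x. of_real (h n x)) \<in> elems Z) \<and>
     (AE x in lebesgue_on \<Omega>. (\<forall>n. 0 \<le> h n x \<and> h n x \<le> norm (f x)) \<and>
         decseq (\<lambda>n. h n x) \<and> (\<lambda>n. h n x) \<longlonglongrightarrow> 0)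
     \<longrightarrow> (\<lambda>n. nrm Z (\<lambda>x. of_real (h n x))) \<longlonglongrightarrow> 0}"

definition equivalent_to_l1_basis ::
    "'k::{real_normed_field, euclidean_space} fun_space \<Rightarrow> (nat \<Rightarrow> real \<Rightarrow> 'k) \<Rightarrow> bool" where
  "equivalent_to_l1_basis Y f \<longleftrightarrow>
     (\<exists>c>0. \<exists>C>0. \<forall>N. \<forall>a :: nat \<Rightarrow> 'k.
        c * (\<Sum>k<N. norm (a k)) \<le> nrm Y (\<lambda>x. \<Sum>k<N. a k * f k x) \<and>
        nrm Y (\<lambda>x. \<Sum>k<N. a k * f k x) \<le> C * (\<Sum>k<N. norm (a k)))"

definition one_DH ::
    "real set \<Rightarrow> 'k::{real_normed_field, euclidean_space} fun_space \<Rightarrow> bool" where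
  "one_DH \<Omega> Y \<longleftrightarrow>
     (\<forall>f :: nat \<Rightarrow> real \<Rightarrow> 'k.
        (\<forall>n. f n \<in> elems Y \<and> nrm Y (f n) = 1) \<and>
        (\<forall>m n. m \<noteq> n \<longrightarrow> (AE x in lebesgue_on \<Omega>. f m x = 0 \<or> f n x = 0))
        \<longrightarrow> (\<exists>r. strict_mono r \<and> equivalent_to_l1_basis Y (\<lambda>k. f (r k))))"


section \<open>Operators and weak compactness\<close>

definition dual_space ::
    "'k::{real_normed_field, euclidean_space} fun_space \<Rightarrow> ((real \<Rightarrow> 'k) \<Rightarrow> 'k) set" where
  "dual_space X = {\<phi>.
     (\<forall>f\<in>elems X. \<forall>g\<in>elems X. \<phi> (\<lambda>x. f x + g x) = \<phi> f + \<phi> g) \<and>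
     (\<forall>c. \<forall>f\<in>elems X. \<phi> (\<lambda>x. c * f x) = c * \<phi> f) \<and>
     (\<exists>C. \<forall>f\<in>elems X. norm (\<phi> f) \<le> C * nrm X f)}"

definition weak_topology ::
    "'k::{real_normed_field, euclidean_space} fun_space \<Rightarrow> (real \<Rightarrow> 'k) topology" where
  "weak_topology X =
     topology_generated_by {{f \<in> elems X. \<phi> f \<in> U} | \<phi> U. \<phi> \<in> dual_space X \<and> open U}"

definition bounded_operator ::
    "real set \<Rightarrow> 'k::{real_normed_field, euclidean_space} fun_space \<Rightarrow> 'k fun_space
      \<Rightarrow> ((real \<Rightarrow> 'k) \<Rightarrow> (real \<Rightarrow> 'k)) \<Rightarrow> bool" where
  "bounded_operator \<Omega> X Y T \<longleftrightarrow>
     (\<forall>f\<in>elems X. T f \<in> elems Y) \<and>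
     (\<forall>f\<in>elems X. \<forall>g\<in>elems X. (AE x in lebesgue_on \<Omega>. f x = g x)
        \<longrightarrow> (AE x in lebesgue_on \<Omega>. T f x = T g x)) \<and>
     (\<forall>f\<in>elems X. \<forall>g\<in>elems X.
        AE x in lebesgue_on \<Omega>. T (\<lambda>x. f x + g x) x = T f x + T g x) \<and>
     (\<forall>c. \<forall>f\<in>elems X. AE x in lebesgue_on \<Omega>. T (\<lambda>x. c * f x) x = c * T f x) \<and>
     (\<exists>C. \<forall>f\<in>elems X. nrm Y (T f) \<le> C * nrm X f)"

definition op_norm ::
    "'k fun_space \<Rightarrow> 'k fun_space \<Rightarrow> ((real \<Rightarrow> 'k) \<Rightarrow> (real \<Rightarrow> 'k)) \<Rightarrow> real" where
  "op_norm X Y T = (SUP f\<in>unit_ball X. nrm Y (T f))"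

definition weakly_compact_operator ::
    "real set \<Rightarrow> 'k::{real_normed_field, euclidean_space} fun_space \<Rightarrow> 'k fun_space
      \<Rightarrow> ((real \<Rightarrow> 'k) \<Rightarrow> (real \<Rightarrow> 'k)) \<Rightarrow> bool" where
  "weakly_compact_operator \<Omega> X Y W \<longleftrightarrow>
     bounded_operator \<Omega> X Y W \<and>
     compactin (weak_topology Y) (weak_topology Y closure_of (W ` unit_ball X))"

definition weak_ess_norm ::
    "real set \<Rightarrow> 'k::{real_normed_field, euclidean_space} fun_space \<Rightarrow> 'k fun_space
      \<Rightarrow> ((real \<Rightarrow> 'k) \<Rightarrow> (real \<Rightarrow> 'k)) \<Rightarrow> real" where
  "weak_ess_norm \<Omega> X Y T =
     Inf {op_norm X Y (\<lambda>f x. T f x - W f x) | W. weakly_compact_operator \<Omega> X Y W}"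

definition mult_op :: "(real \<Rightarrow> 'k::times) \<Rightarrow> (real \<Rightarrow> 'k) \<Rightarrow> (real \<Rightarrow> 'k)" where
  "mult_op l f = (\<lambda>x. l x * f x)"

end

theory Submission
  imports Defs
begin

text \<open>
  Let \<open>M = M(X,Y)\<close>, and call \<open>A\<close> a truncation set if it has finite measure and \<open>\<lambda>\<close> is bounded
  on it.  Both sides of the formula equal the infimum of \<open>\<parallel>\<lambda> \<chi>\<^bsub>\<Omega>-A\<^esub>\<parallel>\<close> in \<open>M\<close> over all truncation sets.

  The norm of \<open>M\<close> is monotone with respect to distribution functions: for functions with finitely
  many values the level sets of the smaller function can be moved disjointly into those of the larger
  one, and the Fatou property of \<open>Y\<close> gives the general case.  Since non-triviality of
  \<open>M\<^sub>o\<close> means that \<open>\<parallel>\<chi>\<^sub>E\<parallel> \<rightarrow> 0\<close> in \<open>M\<close> as \<open>|E| \<rightarrow> 0\<close>, a comparison of distribution functions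
  identifies the infimum with the limit of \<open>\<lambda>\<^sup>\<star> \<chi>\<^bsub>(0,1/n) \<union> (n,\<infinity>)\<^esub>\<close>.

  If \<open>A\<close> is a truncation set, multiplication by \<open>\<lambda> \<chi>\<^sub>A\<close> maps the unit ball of \<open>X\<close> onto a set with
  uniformly absolutely continuous norms in \<open>Y\<close>, which is relatively weakly compact: a limit
  functional on the dual restricts to an absolutely continuous set function, whose density is the weak
  limit.  Conversely, if \<open>\<parallel>\<lambda> \<chi>\<^bsub>\<Omega>-A\<^esub>\<parallel> > r\<close> for every truncation set, there are disjointly
  supported \<open>f\<^sub>n\<close> in the unit ball with \<open>\<parallel>\<lambda> f\<^sub>n\<parallel> > r\<close>, and \<open>W f\<^sub>n\<close> restricted to the support of
  \<open>f\<^sub>n\<close> tends to \<open>0\<close> along a subsequence for weakly compact \<open>W\<close>, because otherwise the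
  1-DH property and the Hahn-Banach theorem would produce a bounded map into \<open>\<ell>\<^sub>1\<close> that contradicts
  Rosenthal's disjointification lemma.
\<close>

section \<open>Koethe spaces\<close>

text \<open>The real \<open>SUP\<close> and \<open>Inf\<close> in the definitions are meaningful
  only on bounded sets. Boundedness comes from completeness: a monotone homogeneous functional on a
  Koethe space is automatically bounded, hence so is multiplication by an element of
  \<open>M\<close>. A functional on \<open>Y\<close> need not be an integral a priori; the order
  continuity at hand is that of indicators of small sets. Densities are therefore sought for bounded
  functions supported in one truncation set, and unbounded functions are reached by cutting at level
  sets whose remainders are uniformly small. On the half line \<lambda> may have levels of infinite
  measure, below which its rearrangement forgets all values. So \<lambda> off a truncation set and
  its rearrangement on (0,1/n) together with (n,\<infinity>) are not equimeasurable; two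
  inequalities between distribution functions replace equality, and infinite levels need separate
  care. No quotient by almost everywhere equality is formed, and functionals are total on
  representatives. This suits a proof of the Hahn-Banach theorem by minimal sublinear functionals on
  the whole space instead of extensions of partial ones.\<close>

locale koethe =
  fixes \<Omega> :: "real set" and X :: "'k::{real_normed_field, euclidean_space} fun_space"
  assumes koethe: "koethe_space \<Omega> X"
begin

abbreviation "L \<equiv> lebesgue_on \<Omega>"

lemma normed: "normed_fun_space \<Omega> X"
  using koethe by (simp add: koethe_space_def)

lemma L0_mem: "f \<in> elems X \<Longrightarrow> f \<in> L0 \<Omega>"
  using normed by (auto simp: normed_fun_space_def)

lemma meas: "f \<in> elems X \<Longrightarrow> f \<in> borel_measurable L"
  using L0_mem by (auto simp: L0_def)

lemma zero_mem: "(\<lambda>x. 0) \<in> elems X"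
  using normed by (simp add: normed_fun_space_def)

lemma add_mem: "f \<in> elems X \<Longrightarrow> g \<in> elems X \<Longrightarrow> (\<lambda>x. f x + g x) \<in> elems X"
  using normed by (simp add: normed_fun_space_def)

lemma scale_mem: "f \<in> elems X \<Longrightarrow> (\<lambda>x. c * f x) \<in> elems X"
  using normed by (simp add: normed_fun_space_def)

lemma diff_mem:
  assumes "f \<in> elems X" "g \<in> elems X"
  shows "(\<lambda>x. f x - g x) \<in> elems X"
  using add_mem[OF assms(1) scale_mem[OF assms(2), of "-1"]] by simp

lemma sum_mem: "(\<And>i. i \<in> I \<Longrightarrow> f i \<in> elems X) \<Longrightarrow> (\<lambda>x. \<Sum>i\<in>I. f i x) \<in> elems X"
  by (induction I rule: infinite_finite_induct) (auto intro: zero_mem add_mem)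

lemma nrm_nonneg: "f \<in> elems X \<Longrightarrow> 0 \<le> nrm X f"
  using normed by (simp add: normed_fun_space_def)

lemma nrm_eq_0_iff: "f \<in> elems X \<Longrightarrow> nrm X f = 0 \<longleftrightarrow> (AE x in L. f x = 0)"
  using normed by (simp add: normed_fun_space_def)

lemma nrm_add: "f \<in> elems X \<Longrightarrow> g \<in> elems X \<Longrightarrow> nrm X (\<lambda>x. f x + g x) \<le> nrm X f + nrm X g"
  using normed by (simp add: normed_fun_space_def)

lemma nrm_scale: "f \<in> elems X \<Longrightarrow> nrm X (\<lambda>x. c * f x) = norm c * nrm X f"
  using normed by (simp add: normed_fun_space_def)

lemma nrm_zero: "nrm X (\<lambda>x. 0) = 0"
  using nrm_scale[OF zero_mem, of 0] by simp

lemma nrm_diff: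
  assumes "f \<in> elems X" "g \<in> elems X"
  shows "nrm X (\<lambda>x. f x - g x) \<le> nrm X f + nrm X g"
  using nrm_add[OF assms(1) scale_mem[OF assms(2), of "-1"]] nrm_scale[OF assms(2), of "-1"] by simp

lemma nrm_sum:
  "(\<And>i. i \<in> I \<Longrightarrow> f i \<in> elems X) \<Longrightarrow> nrm X (\<lambda>x. \<Sum>i\<in>I. f i x) \<le> (\<Sum>i\<in>I. nrm X (f i))"
proof (induction I rule: infinite_finite_induct)
  case (insert i I)
  have "nrm X (\<lambda>x. f i x + (\<Sum>i\<in>I. f i x)) \<le> nrm X (f i) + nrm X (\<lambda>x. \<Sum>i\<in>I. f i x)"
    using insert.prems by (intro nrm_add sum_mem) auto
  then show ?case using insert by force
qed (simp_all add: nrm_zero)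

lemma ideal:
  assumes "f \<in> borel_measurable L" "g \<in> elems X"
    "AE x in L. norm (f x) \<le> norm (g x)"
  shows ideal_mem: "f \<in> elems X" and ideal_le: "nrm X f \<le> nrm X g"
  using koethe assms unfolding koethe_space_def by blast+

lemma indicator_mem:
  "A \<in> sets L \<Longrightarrow> emeasure L A < \<infinity> \<Longrightarrow> (\<lambda>x. indicator A x) \<in> elems X"
  using koethe unfolding koethe_space_def by blast

lemma nrm_cong_norm:
  assumes "f \<in> elems X" "g \<in> elems X" "AE x in L. norm (f x) = norm (g x)"
  shows "nrm X f = nrm X g"
proof (rule antisym)
  show "nrm X f \<le> nrm X g"
    by (rule ideal_le[OF meas[OF assms(1)] assms(2)]) (use assms(3) in auto)
  show "nrm X g \<le> nrm X f"
    by (rule ideal_le[OF meas[OF assms(2)] assms(1)]) (use assms(3) in auto)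
qed

lemma restrict_mem:
  assumes "f \<in> elems X" "E \<in> sets L"
  shows "(\<lambda>x. f x * indicator E x) \<in> elems X"
  by (rule ideal_mem[OF _ assms(1)]) (use meas[OF assms(1)] assms(2) in \<open>auto simp: norm_mult indicator_def\<close>)

lemma restrict_le:
  assumes "f \<in> elems X" "E \<in> sets L"
  shows "nrm X (\<lambda>x. f x * indicator E x) \<le> nrm X f"
  by (rule ideal_le[OF _ assms(1)]) (use meas[OF assms(1)] assms(2) in \<open>auto simp: norm_mult indicator_def\<close>)

lemma set_integrable_mem:
  assumes "f \<in> elems X" "A \<in> sets L" "emeasure L A < \<infinity>"
  shows "set_integrable L A f"
  using L0_mem[OF assms(1)] assms by (auto simp: L0_def)

text \<open>The majorant is the norm limit of the partial sums of the moduli. Norm convergence gives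
  no pointwise information directly, so the domination is extracted from the norm alone.\<close>

lemma dominating_element:
  fixes f :: "nat \<Rightarrow> real \<Rightarrow> 'k"
  assumes f: "\<And>k. f k \<in> elems X" and small: "\<And>k. nrm X (f k) \<le> (1/2) ^ k"
  obtains F where "F \<in> elems X" "\<And>k. AE x in L. norm (f k x) \<le> norm (F x)"
proof -
  define a where "a k x = (of_real (norm (f k x)) :: 'k)" for k x
  have am: "a k \<in> borel_measurable L" for k
    unfolding a_def using meas[OF f] by (auto intro!: borel_measurable_of_real)
  have a: "a k \<in> elems X" for k
    by (rule ideal_mem[OF am f[of k]]) (auto simp: a_def)
  have an: "nrm X (a k) \<le> (1/2)^k" for k
    by (rule order_trans[OF ideal_le[OF am f[of k]] small]) (auto simp: a_def)
  define S where "S n x = (\<Sum>k<n. a k x)" for n x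
  have S: "S n \<in> elems X" for n
    unfolding S_def by (intro sum_mem a)
  have Sle: "nrm X (\<lambda>x. S m x - S n x) \<le> 2 * (1/2)^n" if "n \<le> m" for m n
  proof -
    have "(\<lambda>x. S m x - S n x) = (\<lambda>x. \<Sum>k\<in>{n..<m}. a k x)"
      unfolding S_def using that by (auto simp: sum_diff_nat_ivl lessThan_atLeast0)
    then have "nrm X (\<lambda>x. S m x - S n x) \<le> (\<Sum>k\<in>{n..<m}. nrm X (a k))"
      using nrm_sum[of "{n..<m}" a] a by simp
    also have "\<dots> \<le> (\<Sum>k\<in>{n..<m}. (1/2)^k)" by (intro sum_mono an)
    also have "\<dots> = 2 * (1/2)^n - 2 * (1/2)^m"
      using that by (induction m rule: dec_induct) auto
    also have "\<dots> \<le> 2 * (1/2)^n" by simp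
    finally show ?thesis .
  qed
  have "\<exists>g\<in>elems X. (\<lambda>n. nrm X (\<lambda>x. S n x - g x)) \<longlonglongrightarrow> 0"
  proof -
    have "\<exists>N. \<forall>m\<ge>N. \<forall>n\<ge>N. nrm X (\<lambda>x. S m x - S n x) < e" if "e > 0" for e :: real
    proof -
      have "\<exists>N. (1/2::real)^N < e/2"
        by (rule real_arch_pow_inv) (use that in auto)
      then obtain N where N: "(1/2::real)^N < e/2" by blast
      have "nrm X (\<lambda>x. S m x - S n x) < e" if mn: "m \<ge> N" "n \<ge> N" for m n
      proof -
        have p: "2 * (1/2::real)^k < e" if "k \<ge> N" for k
        proof -
          have "(1/2::real)^k \<le> (1/2)^N" by (rule power_decreasing) (use that in auto)
          then show ?thesis using N by linarith
        qed
        show ?thesis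
        proof (cases "n \<le> m")
          case True
          then show ?thesis using Sle[OF True] p[OF mn(2)] by simp
        next
          case False
          then have "nrm X (\<lambda>x. S n x - S m x) < e" using Sle[of m n] p[OF mn(1)] by simp
          moreover have "nrm X (\<lambda>x. S m x - S n x) = nrm X (\<lambda>x. S n x - S m x)"
            by (intro nrm_cong_norm diff_mem S) (simp add: norm_minus_commute)
          ultimately show ?thesis by simp
        qed
      qed
      then show ?thesis by blast
    qed
    then show ?thesis
      using koethe S unfolding koethe_space_def complete_fun_space_def by blast
  qed
  then obtain g where g: "g \<in> elems X" "(\<lambda>n. nrm X (\<lambda>x. S n x - g x)) \<longlonglongrightarrow> 0" by blast
  have Sreal: "S n x = of_real (\<Sum>k<n. norm (f k x))" for n x
    by (simp add: S_def a_def)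
  have "AE x in L. norm (f k x) \<le> norm (g x)" for k
  proof -
    \<comment> \<open>The positive part of |f k| - |g|. It lies below |S n - g| for every n > k, so
      its norm is 0.\<close>
    define v where "v x = (of_real (max 0 (norm (f k x) - norm (g x))) :: 'k)" for x
    have vm: "v \<in> borel_measurable L"
      unfolding v_def using meas[OF f] meas[OF g(1)] by (auto intro!: borel_measurable_of_real)
    have le: "norm (v x) \<le> norm (S n x - g x)" if "n \<ge> Suc k" for n x
    proof -
      have "norm (f k x) \<le> (\<Sum>k<n. norm (f k x))"
        using that by (intro member_le_sum) auto
      also have "\<dots> = norm (S n x)" unfolding Sreal by (simp del: of_real_sum add: sum_nonneg)
      finally have "norm (f k x) - norm (g x) \<le> norm (S n x - g x)"
        using norm_triangle_ineq2[of "S n x" "g x"] by linarith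
      then show ?thesis by (simp add: v_def)
    qed
    have v: "v \<in> elems X" "nrm X v \<le> nrm X (\<lambda>x. S n x - g x)" if "n \<ge> Suc k" for n
      using ideal[OF vm diff_mem[OF S[of n] g(1)]] le[OF that] by auto
    have "nrm X v \<le> 0"
      by (rule LIMSEQ_le_const[OF g(2)]) (use v in blast)
    then have "AE x in L. v x = 0"
      using nrm_nonneg nrm_eq_0_iff v by (metis antisym order_refl)
    then show ?thesis by (auto simp: v_def max_def split: if_splits)
  qed
  then show ?thesis using that g(1) by blast
qed

text \<open>Otherwise there are \<open>f k\<close> with \<open>q (f k)\<close> above
  \<open>4^k\<close> times the norm. Scaled to norm \<open>2^-k\<close> they have a common majorant
  \<open>F\<close>, and monotonicity forces \<open>q F > 2^k\<close> for every \<open>k\<close>.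
  This automatic continuity is applied to integration over a set of finite measure and to
  multiplication operators.\<close>

lemma monotone_homogeneous_bounded:
  fixes q :: "(real \<Rightarrow> 'k) \<Rightarrow> real"
  assumes mono: "\<And>f g. f \<in> elems X \<Longrightarrow> g \<in> elems X \<Longrightarrow>
      (AE x in L. norm (f x) \<le> norm (g x)) \<Longrightarrow> q f \<le> q g"
    and hom: "\<And>c f. f \<in> elems X \<Longrightarrow> q (\<lambda>x. c * f x) = norm c * q f"
  obtains C where "0 \<le> C" "\<And>f. f \<in> elems X \<Longrightarrow> q f \<le> C * nrm X f"
proof -
  have "\<exists>C\<ge>0. \<forall>f\<in>elems X. q f \<le> C * nrm X f"
  proof (rule ccontr)
    assume "\<not> ?thesis"
    then have "\<exists>f\<in>elems X. q f > 4^k * nrm X f" for k :: nat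
      by (meson not_le zero_le_numeral zero_le_power)
    then obtain f where f: "\<And>k. f k \<in> elems X" and fq: "\<And>k::nat. q (f k) > 4^k * nrm X (f k)"
      by metis
    have pos: "nrm X (f k) > 0" for k
    proof (rule ccontr)
      assume "\<not> ?thesis"
      then have 0: "nrm X (f k) = 0" using nrm_nonneg[OF f[of k]] by simp
      have "q (f k) \<le> q (\<lambda>x. 0 * f k x)"
        using 0 nrm_eq_0_iff[OF f[of k]] by (intro mono scale_mem f) auto
      also have "\<dots> = 0" using hom[OF f, of 0 k] by simp
      finally show False using fq[of k] 0 by simp
    qed
    define c :: "nat \<Rightarrow> 'k" where "c k = of_real ((1/2)^k / nrm X (f k))" for k
    have cn: "norm (c k) = (1/2)^k / nrm X (f k)" for k
      using pos[of k] by (simp add: c_def norm_power norm_divide)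
    obtain F where F: "F \<in> elems X" "\<And>k. AE x in L. norm (c k * f k x) \<le> norm (F x)"
    proof (rule dominating_element[of "\<lambda>k x. c k * f k x"])
      show "(\<lambda>x. c k * f k x) \<in> elems X" for k by (intro scale_mem f)
      show "nrm X (\<lambda>x. c k * f k x) \<le> (1/2)^k" for k
        using pos[of k] by (simp add: nrm_scale[OF f] cn)
    qed blast
    have "2^k < q F" for k
    proof -
      have "(2::real)^k = (1/2)^k * 4^k" by (simp flip: power_mult_distrib)
      also have "\<dots> = norm (c k) * (4^k * nrm X (f k))" using pos[of k] by (simp add: cn)
      also have "\<dots> < norm (c k) * q (f k)"
        using fq[of k] pos[of k] by (intro mult_strict_left_mono) (auto simp: cn)
      also have "\<dots> = q (\<lambda>x. c k * f k x)" by (simp add: hom[OF f])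
      also have "\<dots> \<le> q F" by (intro mono scale_mem f F)
      finally show ?thesis .
    qed
    moreover obtain k where "q F < 2^k" using real_arch_pow[of 2 "q F"] by auto
    ultimately show False by (meson less_asym)
  qed
  then show ?thesis using that by blast
qed

text \<open>Continuity of the inclusion into L1(A); the inclusion as such is built into
  \<open>L0\<close>.\<close>

lemma integral_le_nrm:
  assumes A: "A \<in> sets L" "emeasure L A < \<infinity>"
  obtains C where "0 \<le> C" "\<And>f. f \<in> elems X \<Longrightarrow> (LINT x:A|L. norm (f x)) \<le> C * nrm X f"
proof (rule monotone_homogeneous_bounded[of "\<lambda>f. LINT x:A|L. norm (f x)"])
  fix f g assume f: "f \<in> elems X" and g: "g \<in> elems X" and le: "AE x in L. norm (f x) \<le> norm (g x)"
  have "set_integrable L A (\<lambda>x. norm (f x))" if "f \<in> elems X" for f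
    using set_integrable_norm[OF set_integrable_mem[OF that A]] .
  then show "(LINT x:A|L. norm (f x)) \<le> (LINT x:A|L. norm (g x))"
    unfolding set_lebesgue_integral_def set_integrable_def using f g le
    by (intro integral_mono_AE) (auto simp: indicator_def)
next
  show "(LINT x:A|L. norm (c * f x)) = norm c * (LINT x:A|L. norm (f x))" for c :: 'k and f
    by (simp add: norm_mult)
qed (use that in blast)

end

section \<open>Local convergence in measure and almost everywhere limits of bounded
  sequences\<close>

lemma topspace_local_measure_topology:
  "topspace (local_measure_topology \<Omega> :: (real \<Rightarrow> 'k::{real_normed_field, euclidean_space}) topology) = L0 \<Omega>"
proof
  have "openin (local_measure_topology \<Omega>) (L0 \<Omega> :: (real \<Rightarrow> 'k) set)"
    unfolding openin_local_measure_topology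
    by (auto intro!: bexI[of _ "{}"] exI[of _ 1] simp: measure_nbhd_def)
  then show "(L0 \<Omega> :: (real \<Rightarrow> 'k) set) \<subseteq> topspace (local_measure_topology \<Omega>)"
    by (rule openin_subset)
  show "topspace (local_measure_topology \<Omega>) \<subseteq> (L0 \<Omega> :: (real \<Rightarrow> 'k) set)"
    using openin_topspace[of "local_measure_topology \<Omega> :: (real \<Rightarrow> 'k) topology"]
    unfolding openin_local_measure_topology by blast
qed

text \<open>The points of \<open>A\<close> at which some term from index \<open>k\<close> on is
  still off by more than \<open>e\<close> form sets decreasing to a null set. Since \<open>A\<close>
  has finite measure, their measures tend to 0.\<close>

lemma tendsto_AE_imp_eventually_measure_nbhd:
  fixes u :: "nat \<Rightarrow> real \<Rightarrow> 'k::{real_normed_field, euclidean_space}"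
  assumes u: "\<And>k. u k \<in> L0 \<Omega>" and v: "v \<in> L0 \<Omega>"
    and lim: "AE x in lebesgue_on \<Omega>. (\<lambda>k. u k x) \<longlonglongrightarrow> v x"
    and A: "A \<in> sets (lebesgue_on \<Omega>)" "emeasure (lebesgue_on \<Omega>) A < \<infinity>" and "0 < e" "0 < d"
  shows "\<forall>\<^sub>F k in sequentially. u k \<in> measure_nbhd \<Omega> v A e d"
proof -
  have [measurable]: "v \<in> borel_measurable (lebesgue_on \<Omega>)" "u k \<in> borel_measurable (lebesgue_on \<Omega>)" for k
    using u v by (auto simp: L0_def)
  have [measurable]: "A \<in> sets (lebesgue_on \<Omega>)" by fact
  define B where "B k = {x\<in>space (lebesgue_on \<Omega>). x \<in> A \<and> (\<exists>j\<ge>k. e < norm (v x - u j x))}" for k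
  have Bm [measurable]: "B k \<in> sets (lebesgue_on \<Omega>)" for k
    unfolding B_def by measurable
  have "(\<lambda>k. emeasure (lebesgue_on \<Omega>) (B k)) \<longlonglongrightarrow> emeasure (lebesgue_on \<Omega>) (\<Inter>k. B k)"
  proof (rule Lim_emeasure_decseq)
    show "decseq B" by (auto simp: decseq_def B_def) (meson order_trans)
    have "emeasure (lebesgue_on \<Omega>) (B k) \<le> emeasure (lebesgue_on \<Omega>) A" for k
      by (intro emeasure_mono A) (auto simp: B_def)
    then show "emeasure (lebesgue_on \<Omega>) (B k) \<noteq> \<infinity>" for k
      using A(2) by (metis infinity_ennreal_def linorder_not_less top.extremum top.not_eq_extremum order.strict_trans1)
  qed (use Bm in auto)
  note lim_B = this
  have "AE x in lebesgue_on \<Omega>. x \<notin> (\<Inter>k. B k)"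
    using lim
  proof eventually_elim
    case (elim x)
    then have "\<forall>\<^sub>F k in sequentially. norm (v x - u k x) < e"
      using \<open>0 < e\<close> by (auto dest!: tendstoD[where e = e] simp: dist_norm norm_minus_commute)
    then obtain k where "\<And>j. j \<ge> k \<Longrightarrow> norm (v x - u j x) < e"
      by (auto simp: eventually_sequentially)
    then have "x \<notin> B k" by (force simp: B_def)
    then show ?case by blast
  qed
  moreover have INT_B: "(\<Inter>k. B k) \<in> sets (lebesgue_on \<Omega>)" by measurable
  ultimately have "emeasure (lebesgue_on \<Omega>) (\<Inter>k. B k) = 0"
    using AE_iff_null_sets[of "\<Inter>k. B k" "lebesgue_on \<Omega>"] Bm by (metis null_setsD1 INT_B)
  with lim_B have "(\<lambda>k. emeasure (lebesgue_on \<Omega>) (B k)) \<longlonglongrightarrow> 0" by simp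
  then have "\<forall>\<^sub>F k in sequentially. emeasure (lebesgue_on \<Omega>) (B k) < ennreal d"
    using \<open>0 < d\<close> by (intro order_tendstoD) auto
  then show ?thesis
  proof eventually_elim
    case (elim k)
    have "emeasure (lebesgue_on \<Omega>) {x\<in>A. e < norm (v x - u k x)} \<le> emeasure (lebesgue_on \<Omega>) (B k)"
      using sets.sets_into_space[OF A(1)] by (intro emeasure_mono Bm) (auto simp: B_def)
    then show ?case using elim u by (auto simp: measure_nbhd_def)
  qed
qed

locale fatou_koethe = koethe \<Omega> X
  for \<Omega> and X :: "'k::{real_normed_field, euclidean_space} fun_space" +
  assumes fatou: "fatou_property \<Omega> X"
begin

text \<open>The sequential form of the Fatou property, through which all later arguments use it.
  Closedness is relative to \<open>L0\<close>, so the limit must first be shown to be integrable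
  over sets of finite measure; this follows from Fatou's lemma for integrals together with
  \<open>integral_le_nrm\<close>.\<close>

lemma fatou_limit:
  fixes f :: "nat \<Rightarrow> real \<Rightarrow> 'k"
  assumes f: "\<And>k. f k \<in> elems X" and fC: "\<And>k. nrm X (f k) \<le> C"
    and g: "g \<in> borel_measurable L"
    and lim: "AE x in L. (\<lambda>k. f k x) \<longlonglongrightarrow> g x"
  shows fatou_limit_mem: "g \<in> elems X" and fatou_limit_le: "nrm X g \<le> C"
proof -
  have C0: "0 \<le> C" using nrm_nonneg[OF f] fC order_trans by blast
  have fm [measurable]: "f k \<in> borel_measurable L" for k using meas[OF f] .
  note g [measurable]
  have gL0: "g \<in> L0 \<Omega>"
    unfolding L0_def
  proof (intro CollectI conjI ballI impI g)
    fix A assume A [measurable]: "A \<in> sets L" and fin: "emeasure L A < \<infinity>"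
    obtain D where D: "0 \<le> D" "\<And>f. f \<in> elems X \<Longrightarrow> (LINT x:A|L. norm (f x)) \<le> D * nrm X f"
      using integral_le_nrm[OF A fin] by blast
    have 1: "(\<integral>\<^sup>+x. ennreal (indicator A x * norm (f k x)) \<partial>L) \<le> ennreal (D * C)" for k
    proof -
      have "integrable L (\<lambda>x. indicator A x * norm (f k x))"
        using set_integrable_norm[OF set_integrable_mem[OF f A fin]] by (simp add: set_integrable_def)
      then have "(\<integral>\<^sup>+x. ennreal (indicator A x * norm (f k x)) \<partial>L)
          = ennreal (LINT x:A|L. norm (f k x))"
        unfolding set_lebesgue_integral_def by (subst nn_integral_eq_integral) (auto simp: indicator_def)
      also have "\<dots> \<le> ennreal (D * C)"
        using D(2)[OF f[of k]] mult_left_mono[OF fC[of k] D(1)] by (intro ennreal_leI) linarith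
      finally show ?thesis .
    qed
    have "(\<integral>\<^sup>+x. ennreal (indicator A x * norm (g x)) \<partial>L)
        = (\<integral>\<^sup>+x. liminf (\<lambda>k. ennreal (indicator A x * norm (f k x))) \<partial>L)"
    proof (rule nn_integral_cong_AE)
      show "AE x in L. ennreal (indicator A x * norm (g x)) = liminf (\<lambda>k. ennreal (indicator A x * norm (f k x)))"
        using lim
      proof eventually_elim
        case (elim x)
        then have "(\<lambda>k. ennreal (indicator A x * norm (f k x))) \<longlonglongrightarrow> ennreal (indicator A x * norm (g x))"
          by (intro tendsto_intros tendsto_ennrealI)
        from lim_imp_Liminf[OF _ this] show ?case by simp
      qed
    qed
    also have "\<dots> \<le> liminf (\<lambda>k. \<integral>\<^sup>+x. ennreal (indicator A x * norm (f k x)) \<partial>L)"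
      by (intro nn_integral_liminf) measurable
    also have "\<dots> \<le> ennreal (D * C)"
      using 1 by (intro Liminf_le) (auto intro: always_eventually)
    finally have "(\<integral>\<^sup>+x. ennreal (indicator A x * norm (g x)) \<partial>L) < \<infinity>"
      by (rule order.strict_trans1) simp
    then show "set_integrable L A g"
      unfolding set_integrable_def by (intro integrableI_bounded) auto
  qed
  \<comment> \<open>Any \<open>C'\<close> above \<open>C\<close> is positive, so scaling into the
    unit ball works even when \<open>C = 0\<close>.\<close>
  have *: "g \<in> elems X \<and> nrm X g \<le> C'" if C': "C < C'" for C'
  proof -
    define c :: 'k where "c = of_real (1 / C')"
    have C'0: "0 < C'" using C' C0 by simp
    have cn: "norm c = 1 / C'" using C'0 by (simp add: c_def norm_divide)
    have c0: "c \<noteq> 0" using cn C'0 by force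
    have ub: "(\<lambda>x. c * f k x) \<in> unit_ball X" for k
      using fC[of k] C' C'0 scale_mem[OF f] by (simp add: unit_ball_def nrm_scale[OF f] cn)
    have cL0: "(\<lambda>x. c * g x) \<in> L0 \<Omega>"
      using gL0 unfolding L0_def by auto
    have "(\<lambda>x. c * g x) \<in> unit_ball X"
    proof (rule ccontr)
      assume "\<not> ?thesis"
      then have "(\<lambda>x. c * g x) \<in> topspace (local_measure_topology \<Omega>) - unit_ball X"
        using cL0 by (simp add: topspace_local_measure_topology)
      moreover have "openin (local_measure_topology \<Omega>) (topspace (local_measure_topology \<Omega>) - unit_ball X)"
        using fatou by (simp add: fatou_property_def closedin_def)
      ultimately obtain A e d where A: "A \<in> sets L" "emeasure L A < \<infinity>"
        and ed: "0 < e" "0 < d" and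
        sub: "measure_nbhd \<Omega> (\<lambda>x. c * g x) A e d \<subseteq> topspace (local_measure_topology \<Omega>) - unit_ball X"
        unfolding openin_local_measure_topology by blast
      have "\<forall>\<^sub>F k in sequentially. (\<lambda>x. c * f k x) \<in> measure_nbhd \<Omega> (\<lambda>x. c * g x) A e d"
      proof (rule tendsto_AE_imp_eventually_measure_nbhd[OF _ cL0 _ A ed])
        show "(\<lambda>x. c * f k x) \<in> L0 \<Omega>" for k by (intro L0_mem scale_mem f)
        show "AE x in L. (\<lambda>k. c * f k x) \<longlonglongrightarrow> c * g x"
          using lim by eventually_elim (intro tendsto_intros)
      qed
      then obtain k where "(\<lambda>x. c * f k x) \<in> measure_nbhd \<Omega> (\<lambda>x. c * g x) A e d"
        by (auto simp: eventually_sequentially)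
      then show False using sub ub[of k] by blast
    qed
    then have cg: "(\<lambda>x. c * g x) \<in> elems X" "nrm X (\<lambda>x. c * g x) \<le> 1"
      by (auto simp: unit_ball_def)
    have gX: "g \<in> elems X" using scale_mem[OF cg(1), of "inverse c"] c0 by (simp flip: mult.assoc)
    then show ?thesis using cg(2) C'0 by (simp add: nrm_scale cn field_simps)
  qed
  show "g \<in> elems X" using *[of "C+1"] by simp
  show "nrm X g \<le> C" by (rule field_le_epsilon) (use * in force)
qed

end

section \<open>Domination of distribution functions\<close>

text \<open>The measure of the section by [-r, r] is 2-Lipschitz in r \<ge> 0, so the intermediate
  value theorem applies. The inequality is strict because bounded sections may exhaust
  \<open>S\<close> only in the limit. Sections with different radii are nested, which
  \<open>indicator_small_M\<close> exploits.\<close>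

lemma exists_interval_section_of_measure:
  fixes S :: "real set"
  assumes S: "S \<in> sets lebesgue" and t: "0 \<le> t" "ennreal t < emeasure lebesgue S"
  shows "\<exists>r. emeasure lebesgue (S \<inter> {-r..r}) = ennreal t"
proof -
  define f where "f r = measure lebesgue (S \<inter> {-r..r})" for r
  have fin: "emeasure lebesgue (S \<inter> {-r..r}) < \<infinity>" for r
  proof -
    have "emeasure lebesgue (S \<inter> {-r..r}) \<le> emeasure lebesgue {-r..r}"
      by (intro emeasure_mono) auto
    also have "\<dots> < \<infinity>" by (cases "-r \<le> r") auto
    finally show ?thesis .
  qed
  have ef: "emeasure lebesgue (S \<inter> {-r..r}) = ennreal (f r)" for r
    unfolding f_def using fin[of r] by (intro emeasure_eq_ennreal_measure) auto
  have lip: "\<bar>f r - f r'\<bar> \<le> 2 * \<bar>r - r'\<bar>" if "0 \<le> r" "r \<le> r'" for r r'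
  proof -
    have "emeasure lebesgue (S \<inter> {-r'..r'}) \<le> emeasure lebesgue ((S \<inter> {-r..r}) \<union> ({-r'..-r} \<union> {r..r'}))"
      using that S by (intro emeasure_mono) (auto intro!: sets.Un sets.Int)
    also have "\<dots> \<le> emeasure lebesgue (S \<inter> {-r..r}) + emeasure lebesgue ({-r'..-r} \<union> {r..r'})"
      using S by (intro emeasure_subadditive) (auto intro!: sets.Un sets.Int)
    also have "\<dots> \<le> emeasure lebesgue (S \<inter> {-r..r}) + (emeasure lebesgue {-r'..-r} + emeasure lebesgue {r..r'})"
      by (intro add_left_mono emeasure_subadditive) auto
    also have "\<dots> = ennreal (f r + 2 * (r' - r))"
      using that by (simp add: ef f_def flip: ennreal_plus)
    finally have "f r' \<le> f r + 2 * (r' - r)"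
      using that unfolding ef by (subst (asm) ennreal_le_iff) (simp_all add: f_def)
    moreover have "f r \<le> f r'"
    proof -
      have "emeasure lebesgue (S \<inter> {-r..r}) \<le> emeasure lebesgue (S \<inter> {-r'..r'})"
        using that S by (intro emeasure_mono) auto
      then show ?thesis unfolding ef by (simp add: f_def)
    qed
    ultimately show ?thesis using that by auto
  qed
  have cont: "continuous_on {0..n} f" for n
  proof -
    have "2-lipschitz_on {0..n} f"
    proof (rule lipschitz_onI)
      show "dist (f x) (f y) \<le> 2 * dist x y" if "x \<in> {0..n}" "y \<in> {0..n}" for x y
        using lip[of x y] lip[of y x] that by (cases "x \<le> y") (auto simp: dist_real_def abs_minus_commute)
    qed simp
    then show ?thesis by (rule lipschitz_on_continuous_on)
  qed
  have "(\<lambda>n. emeasure lebesgue (S \<inter> {- real n..real n})) \<longlonglongrightarrow> emeasure lebesgue (\<Union>n. S \<inter> {- real n..real n})"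
    using S by (intro Lim_emeasure_incseq) (auto simp: incseq_def)
  moreover have "(\<Union>n. S \<inter> {- real n..real n}) = S"
  proof -
    have "\<exists>n. -real n \<le> x \<and> x \<le> real n" for x :: real
    proof -
      obtain n where "\<bar>x\<bar> \<le> real n" using real_arch_simple by blast
      then show ?thesis by (intro exI[of _ n]) auto
    qed
    then show ?thesis by auto
  qed
  ultimately have "\<forall>\<^sub>F n in sequentially. ennreal t < emeasure lebesgue (S \<inter> {- real n..real n})"
    using t(2) order_tendstoD(1) by metis
  then obtain n where "ennreal t < emeasure lebesgue (S \<inter> {- real n..real n})"
    by (auto simp: eventually_sequentially)
  then have tn: "t \<le> f (real n)" using t(1) by (simp add: ef ennreal_less_iff)
  have "f 0 \<le> t"
  proof -
    have "emeasure lebesgue (S \<inter> {0}) \<le> emeasure lebesgue {0::real}" by (intro emeasure_mono) auto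
    then show ?thesis using t(1) by (simp add: f_def measure_def)
  qed
  then obtain r where "f r = t" using IVT'[of f 0 t "real n"] tn cont by auto
  then show ?thesis using ef by auto
qed

text \<open>If \<open>t\<close> is the full measure, no bounded section need attain it, and
  \<open>S\<close> itself is the witness.\<close>

lemma exists_subset_of_measure:
  fixes \<Omega> :: "real set"
  assumes \<Omega>: "\<Omega> \<in> sets lebesgue" and S: "S \<in> sets (lebesgue_on \<Omega>)"
    and t: "0 \<le> t" "ennreal t \<le> emeasure (lebesgue_on \<Omega>) S"
  shows "\<exists>F\<in>sets (lebesgue_on \<Omega>). F \<subseteq> S \<and> emeasure (lebesgue_on \<Omega>) F = ennreal t"
proof (cases "ennreal t = emeasure (lebesgue_on \<Omega>) S")
  case True
  then show ?thesis using S by auto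
next
  case False
  have S': "S \<subseteq> \<Omega>" "S \<in> sets lebesgue" using S \<Omega> by (auto simp: sets_restrict_space_iff)
  have e: "emeasure (lebesgue_on \<Omega>) F = emeasure lebesgue F" if "F \<subseteq> S" for F
    using that S'(1) \<Omega> by (intro emeasure_restrict_space) auto
  obtain r where "emeasure lebesgue (S \<inter> {-r..r}) = ennreal t"
    using exists_interval_section_of_measure[OF S'(2) t(1)] False t(2) e[of S] by force
  then show ?thesis
    using S' \<Omega> e[of "S \<inter> {-r..r}"] by (intro bexI[of _ "S \<inter> {-r..r}"]) (auto simp: sets_restrict_space_iff)
qed

text \<open>A marriage problem for nested sets: it is enough to compare the total demand at or above
  each level with the measure of the set at that level. The induction takes indices in order of
  decreasing \<open>b\<close>, so each newcomer may choose from a set containing all earlier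
  ones.\<close>

lemma disjoint_packing:
  fixes \<Omega> :: "real set" and b e :: "'i \<Rightarrow> real"
  assumes \<Omega>: "\<Omega> \<in> sets lebesgue" and I: "finite I"
    and S: "\<And>s. S s \<in> sets (lebesgue_on \<Omega>)" and mono: "\<And>s t. s \<le> t \<Longrightarrow> S t \<subseteq> S s"
    and e: "\<And>i. 0 \<le> e i"
    and le: "\<And>i. i \<in> I \<Longrightarrow> ennreal (\<Sum>j\<in>{j\<in>I. b i \<le> b j}. e j) \<le> emeasure (lebesgue_on \<Omega>) (S (b i))"
  shows "\<exists>F. disjoint_family_on F I \<and> (\<forall>i\<in>I. F i \<in> sets (lebesgue_on \<Omega>) \<and> F i \<subseteq> S (b i)
           \<and> emeasure (lebesgue_on \<Omega>) (F i) = ennreal (e i))"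
  using I le
proof (induction I rule: finite_ranking_induct[where f = "\<lambda>i. - b i"])
  case empty
  then show ?case by (simp add: disjoint_family_on_def)
next
  case (insert x I)
  show ?case
  proof (cases "x \<in> I")
    \<comment> \<open>The ranking induction does not exclude that \<open>x\<close> is already
      present.\<close>
    case True
    then show ?thesis using insert by (simp add: insert_absorb)
  next
    case False
    have "\<exists>F. disjoint_family_on F I \<and> (\<forall>i\<in>I. F i \<in> sets (lebesgue_on \<Omega>) \<and> F i \<subseteq> S (b i)
           \<and> emeasure (lebesgue_on \<Omega>) (F i) = ennreal (e i))"
    proof (rule insert.IH)
      fix i assume i: "i \<in> I"
      have "(\<Sum>j\<in>{j\<in>I. b i \<le> b j}. e j) \<le> (\<Sum>j\<in>{j\<in>insert x I. b i \<le> b j}. e j)"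
        using insert.hyps e by (intro sum_mono2) auto
      then show "ennreal (\<Sum>j\<in>{j\<in>I. b i \<le> b j}. e j) \<le> emeasure (lebesgue_on \<Omega>) (S (b i))"
        using insert.prems[of i] i by (meson ennreal_leI insertI2 order_trans)
    qed
    then obtain F where F: "disjoint_family_on F I" "\<And>i. i \<in> I \<Longrightarrow> F i \<in> sets (lebesgue_on \<Omega>)"
      "\<And>i. i \<in> I \<Longrightarrow> F i \<subseteq> S (b i)" "\<And>i. i \<in> I \<Longrightarrow> emeasure (lebesgue_on \<Omega>) (F i) = ennreal (e i)"
      by blast
    define U where "U = (\<Union>i\<in>I. F i)"
    have U: "U \<in> sets (lebesgue_on \<Omega>)" unfolding U_def using F(2) insert.hyps by (intro sets.finite_UN) auto
    have eU: "emeasure (lebesgue_on \<Omega>) U = ennreal (\<Sum>i\<in>I. e i)"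
    proof -
      have "emeasure (lebesgue_on \<Omega>) U = (\<Sum>i\<in>I. emeasure (lebesgue_on \<Omega>) (F i))"
        unfolding U_def using F insert.hyps by (intro sum_emeasure[symmetric]) auto
      also have "\<dots> = (\<Sum>i\<in>I. ennreal (e i))" using F(4) by simp
      finally show ?thesis using e by simp
    qed
    \<comment> \<open>\<open>x\<close> has the smallest level, so the hypothesis at \<open>x\<close>
      accounts for the demand of the whole of \<open>insert x I\<close>, including what the sets
      \<open>F i\<close> already occupy.\<close>
    have "{j \<in> insert x I. b x \<le> b j} = insert x I"
      using insert.hyps by auto
    then have "ennreal (\<Sum>j\<in>insert x I. e j) \<le> emeasure (lebesgue_on \<Omega>) (S (b x))"
      using insert.prems[of x] by simp
    also have "\<dots> \<le> emeasure (lebesgue_on \<Omega>) ((S (b x) - U) \<union> U)"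
      using S U by (intro emeasure_mono) auto
    also have "\<dots> \<le> emeasure (lebesgue_on \<Omega>) (S (b x) - U) + emeasure (lebesgue_on \<Omega>) U"
      using S U by (intro emeasure_subadditive) auto
    finally have "ennreal (sum e I) + ennreal (e x) \<le> ennreal (sum e I) + emeasure (lebesgue_on \<Omega>) (S (b x) - U)"
      using False insert.hyps e by (simp add: eU sum_nonneg add.commute)
    then have "ennreal (e x) \<le> emeasure (lebesgue_on \<Omega>) (S (b x) - U)"
      by (simp add: ennreal_add_left_cancel_le)
    then obtain G where G: "G \<in> sets (lebesgue_on \<Omega>)" "G \<subseteq> S (b x) - U" "emeasure (lebesgue_on \<Omega>) G = ennreal (e x)"
      using exists_subset_of_measure[OF \<Omega>, of "S (b x) - U" "e x"] S U e by auto
    have "disjoint_family_on (F(x := G)) (insert x I)"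
    proof -
      have "F m \<inter> F n = {}" if "m \<in> I" "n \<in> I" "m \<noteq> n" for m n
        using F(1) that by (simp add: disjoint_family_on_def)
      moreover have "G \<inter> F i = {}" if "i \<in> I" for i
        using G(2) that by (auto simp: U_def)
      ultimately show ?thesis
        using False by (simp add: disjoint_family_on_def Int_commute)
    qed
    moreover have "\<forall>i\<in>insert x I. (F(x := G)) i \<in> sets (lebesgue_on \<Omega>) \<and> (F(x := G)) i \<subseteq> S (b i)
           \<and> emeasure (lebesgue_on \<Omega>) ((F(x := G)) i) = ennreal (e i)"
      using F G by auto
    ultimately show ?thesis by blast
  qed
qed

lemma sum_indicator_disjoint:
  fixes c :: "'i \<Rightarrow> 'k::semiring_1"
  assumes "finite I" "disjoint_family_on F I" "i \<in> I" "x \<in> F i"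
  shows "(\<Sum>j\<in>I. c j * indicator (F j) x) = c i"
proof -
  have "(\<Sum>j\<in>I. c j * indicator (F j) x) = (\<Sum>j\<in>I. if j = i then c i else 0)"
    using assms by (intro sum.cong) (auto simp: disjoint_family_on_def indicator_def)
  then show ?thesis using assms by simp
qed

text \<open>The distribution function of a step function sees the coefficients and the measures of
  the pieces, not their position.\<close>

lemma equimeasurable_step:
  fixes c :: "'i \<Rightarrow> 'k::{real_normed_field, euclidean_space}"
  assumes I: "finite I"
    and E: "disjoint_family_on E I" "\<And>i. i \<in> I \<Longrightarrow> E i \<in> sets (lebesgue_on \<Omega>)"
    and F: "disjoint_family_on F I" "\<And>i. i \<in> I \<Longrightarrow> F i \<in> sets (lebesgue_on \<Omega>)"
    and eq: "\<And>i. i \<in> I \<Longrightarrow> emeasure (lebesgue_on \<Omega>) (E i) = emeasure (lebesgue_on \<Omega>) (F i)"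
  shows "equimeasurable \<Omega> (\<lambda>x. \<Sum>i\<in>I. c i * indicator (E i) x) (\<lambda>x. \<Sum>i\<in>I. c i * indicator (F i) x)"
proof -
  have *: "distr_fun \<Omega> (\<lambda>x. \<Sum>i\<in>I. c i * indicator (G i) x) s
      = (\<Sum>i\<in>{i\<in>I. s < norm (c i)}. emeasure (lebesgue_on \<Omega>) (G i))"
    if G: "disjoint_family_on G I" "\<And>i. i \<in> I \<Longrightarrow> G i \<in> sets (lebesgue_on \<Omega>)" and s: "0 \<le> s" for G s
  proof -
    have sub: "G i \<subseteq> \<Omega>" if "i \<in> I" for i
      using sets.sets_into_space[OF G(2)[OF that]] by simp
    have "{x\<in>\<Omega>. s < norm (\<Sum>i\<in>I. c i * indicator (G i) x)} = (\<Union>i\<in>{i\<in>I. s < norm (c i)}. G i)"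
    proof (intro set_eqI iffI)
      fix x assume x: "x \<in> {x\<in>\<Omega>. s < norm (\<Sum>i\<in>I. c i * indicator (G i) x)}"
      have "\<exists>i\<in>I. x \<in> G i"
      proof (rule ccontr)
        assume "\<not> ?thesis"
        then have "(\<Sum>i\<in>I. c i * indicator (G i) x) = 0" by (intro sum.neutral) auto
        then show False using x s by simp
      qed
      then obtain i where "i \<in> I" "x \<in> G i" by blast
      then show "x \<in> (\<Union>i\<in>{i\<in>I. s < norm (c i)}. G i)"
        using x sum_indicator_disjoint[OF I G(1), of i x c] by auto
    next
      fix x assume "x \<in> (\<Union>i\<in>{i\<in>I. s < norm (c i)}. G i)"
      then show "x \<in> {x\<in>\<Omega>. s < norm (\<Sum>i\<in>I. c i * indicator (G i) x)}"
        using sum_indicator_disjoint[OF I G(1), of _ x c] sub by auto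
    qed
    then show ?thesis
      unfolding distr_fun_def using I G
      by (subst sum_emeasure) (auto simp: disjoint_family_on_def)
  qed
  have "(\<Sum>i\<in>{i\<in>I. s < norm (c i)}. emeasure (lebesgue_on \<Omega>) (E i))
      = (\<Sum>i\<in>{i\<in>I. s < norm (c i)}. emeasure (lebesgue_on \<Omega>) (F i))" for s
    using eq by (intro sum.cong) auto
  then show ?thesis
    unfolding equimeasurable_def using *[OF E] *[OF F] by simp
qed

text \<open>A dyadic approximation strictly below \<open>t\<close>, so that a level set of an approximant lies in
  the corresponding strict superlevel set of the function.\<close>

definition dyadic :: "nat \<Rightarrow> real \<Rightarrow> real" where
  "dyadic n t = (if t \<le> real n then max 0 (real_of_int (\<lceil>2^n * t\<rceil> - 1) / 2^n) else 0)"

lemma dyadic_nonneg: "0 \<le> dyadic n t"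
  by (simp add: dyadic_def)

lemma dyadic_less: "0 < dyadic n t \<Longrightarrow> dyadic n t < t"
proof -
  assume "0 < dyadic n t"
  then have "dyadic n t = real_of_int (\<lceil>2^n * t\<rceil> - 1) / 2^n"
    by (auto simp: dyadic_def max_def split: if_splits)
  also have "\<dots> < t"
  proof -
    have "real_of_int (\<lceil>2^n * t\<rceil> - 1) < 2^n * t" by linarith
    then show ?thesis by (simp add: divide_less_eq mult.commute)
  qed
  finally show ?thesis .
qed

lemma dyadic_le: "0 \<le> t \<Longrightarrow> dyadic n t \<le> t"
  using dyadic_less[of n t] dyadic_nonneg[of n t] by linarith

lemma dyadic_tendsto:
  assumes "0 \<le> t"
  shows "(\<lambda>n. dyadic n t) \<longlonglongrightarrow> t"
proof (rule tendsto_sandwich)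
  obtain N where N: "t \<le> real N" using real_arch_simple by blast
  have "t - (1/2)^n \<le> dyadic n t" if "n \<ge> N" for n
  proof -
    have "t \<le> real n" using N that by linarith
    moreover have "t - (1/2)^n \<le> real_of_int (\<lceil>2^n * t\<rceil> - 1) / 2^n"
    proof -
      have "2^n * t - 1 \<le> real_of_int (\<lceil>2^n * t\<rceil> - 1)" by linarith
      then have "(2^n * t - 1) / 2^n \<le> real_of_int (\<lceil>2^n * t\<rceil> - 1) / 2^n"
        by (intro divide_right_mono) auto
      then show ?thesis by (simp add: diff_divide_distrib power_divide)
    qed
    ultimately show ?thesis unfolding dyadic_def by simp
  qed
  then show "\<forall>\<^sub>F n in sequentially. t - (1/2)^n \<le> dyadic n t"
    unfolding eventually_sequentially by blast
  have "(\<lambda>n. t - (1/2)^n) \<longlonglongrightarrow> t - 0"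
    by (intro tendsto_intros LIMSEQ_power_zero) auto
  then show "(\<lambda>n. t - (1/2)^n) \<longlonglongrightarrow> t" by simp
qed (use dyadic_le[OF assms] in auto)

text \<open>The purpose of the cut at \<open>n\<close> in \<open>dyadic\<close>: with finitely many
  values, composing it with a function gives a step function.\<close>

lemma finite_range_dyadic: "finite (dyadic n ` {0..})"
proof (rule finite_subset)
  show "dyadic n ` {0..} \<subseteq> insert 0 ((\<lambda>k. real_of_int (k - 1) / 2^n) ` {0..2^n * int n})"
  proof
    fix y assume "y \<in> dyadic n ` {0..}"
    then obtain t where t: "0 \<le> t" "y = dyadic n t" by auto
    show "y \<in> insert 0 ((\<lambda>k. real_of_int (k - 1) / 2^n) ` {0..2^n * int n})"
    proof (cases "t \<le> real n")
      case True
      have "\<lceil>2^n * t\<rceil> \<le> 2^n * int n"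
        using True by (simp add: ceiling_le_iff)
      moreover have "0 \<le> \<lceil>2^n * t\<rceil>" using t(1) by (metis ceiling_mono ceiling_zero mult_nonneg_nonneg zero_le_numeral zero_le_power)
      ultimately show ?thesis using True t(2) by (auto simp: dyadic_def max_def)
    qed (use t in \<open>simp add: dyadic_def\<close>)
  qed
qed simp

lemma dyadic_measurable [measurable]: "dyadic n \<in> borel_measurable borel"
  unfolding dyadic_def by measurable

section \<open>The multiplier space and monotonicity of its norm in the distribution
  function\<close>

locale multipliers = X: koethe \<Omega> X + Y: fatou_koethe \<Omega> Y
  for \<Omega> and X Y :: "'k::{real_normed_field, euclidean_space} fun_space" +
  assumes \<Omega>: "\<Omega> \<in> sets lebesgue" and riX: "ri_space \<Omega> X" and riY: "ri_space \<Omega> Y"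
begin

abbreviation "L \<equiv> lebesgue_on \<Omega>"

abbreviation "M \<equiv> multiplier_space \<Omega> X Y"

lemma elems_M: "g \<in> elems M \<longleftrightarrow> g \<in> L0 \<Omega> \<and> (\<forall>f\<in>elems X. (\<lambda>x. f x * g x) \<in> elems Y)"
  by (simp add: multiplier_space_def)

lemma mult_mem: "g \<in> elems M \<Longrightarrow> f \<in> elems X \<Longrightarrow> (\<lambda>x. f x * g x) \<in> elems Y"
  by (simp add: elems_M)

lemma meas_M: "g \<in> elems M \<Longrightarrow> g \<in> borel_measurable L"
  by (simp add: elems_M L0_def)

text \<open>Integrability over a set \<open>A\<close> of finite measure is automatic, because the
  indicator of \<open>A\<close> lies in \<open>X\<close> and its product with \<open>g\<close> lies
  in \<open>Y\<close>.\<close>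

lemma memI_M:
  assumes g: "g \<in> borel_measurable L" and "\<And>f. f \<in> elems X \<Longrightarrow> (\<lambda>x. f x * g x) \<in> elems Y"
  shows "g \<in> elems M"
proof -
  have "set_integrable L A g"
    if A: "A \<in> sets L" "emeasure L A < \<infinity>" for A
  proof -
    have "set_integrable L A (\<lambda>x. indicator A x * g x)"
      by (intro Y.set_integrable_mem assms X.indicator_mem A)
    then show ?thesis unfolding set_integrable_def
      by (rule Bochner_Integration.integrable_cong[THEN iffD1, rotated -1]) (auto simp: indicator_def)
  qed
  then show ?thesis using assms by (simp add: elems_M L0_def)
qed

lemma zero_unit_ball: "(\<lambda>x. 0) \<in> unit_ball X"
  using X.zero_mem X.nrm_zero by (simp add: unit_ball_def)

text \<open>Guarantees that the supremum defining \<open>nrm M\<close> is taken over a bounded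
  set.\<close>

lemma bounded_M:
  assumes g: "g \<in> elems M"
  obtains C where "0 \<le> C" "\<And>f. f \<in> elems X \<Longrightarrow> nrm Y (\<lambda>x. f x * g x) \<le> C * nrm X f"
proof (rule X.monotone_homogeneous_bounded[of "\<lambda>f. nrm Y (\<lambda>x. f x * g x)"])
  fix f h assume fh: "f \<in> elems X" "h \<in> elems X" and le: "AE x in L. norm (f x) \<le> norm (h x)"
  show "nrm Y (\<lambda>x. f x * g x) \<le> nrm Y (\<lambda>x. h x * g x)"
    by (rule Y.ideal_le[OF Y.meas])
      (use fh le g in \<open>auto intro!: mult_mem mult_right_mono simp: norm_mult elim!: eventually_mono\<close>)
next
  fix c :: 'k and f assume f: "f \<in> elems X"
  have "nrm Y (\<lambda>x. c * (f x * g x)) = norm c * nrm Y (\<lambda>x. f x * g x)"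
    by (intro Y.nrm_scale mult_mem g f)
  then show "nrm Y (\<lambda>x. c * f x * g x) = norm c * nrm Y (\<lambda>x. f x * g x)" by (simp add: mult.assoc)
qed (use that in blast)

lemma nrm_M: "nrm M g = (SUP f\<in>unit_ball X. nrm Y (\<lambda>x. f x * g x))"
  by (simp add: multiplier_space_def)

lemma bdd_above_M:
  assumes g: "g \<in> elems M"
  shows "bdd_above ((\<lambda>f. nrm Y (\<lambda>x. f x * g x)) ` unit_ball X)"
proof -
  obtain C where C: "0 \<le> C" "\<And>f. f \<in> elems X \<Longrightarrow> nrm Y (\<lambda>x. f x * g x) \<le> C * nrm X f"
    using bounded_M[OF g] by blast
  have "nrm Y (\<lambda>x. f x * g x) \<le> C" if "f \<in> unit_ball X" for f
    using C(2)[of f] mult_left_mono[OF _ C(1), of "nrm X f" 1] that by (force simp: unit_ball_def)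
  then show ?thesis by (intro bdd_aboveI2)
qed

lemma nrm_mult_unit_ball: "g \<in> elems M \<Longrightarrow> f \<in> unit_ball X \<Longrightarrow> nrm Y (\<lambda>x. f x * g x) \<le> nrm M g"
  unfolding nrm_M by (intro cSUP_upper bdd_above_M)

lemma nrm_M_nonneg: "g \<in> elems M \<Longrightarrow> 0 \<le> nrm M g"
  using nrm_mult_unit_ball[OF _ zero_unit_ball] Y.nrm_zero by simp

lemma nrm_M_least: "(\<And>f. f \<in> unit_ball X \<Longrightarrow> nrm Y (\<lambda>x. f x * g x) \<le> C) \<Longrightarrow> nrm M g \<le> C"
  unfolding nrm_M using zero_unit_ball by (intro cSUP_least) auto

lemma nrm_mult_le:
  assumes g: "g \<in> elems M" and f: "f \<in> elems X"
  shows "nrm Y (\<lambda>x. f x * g x) \<le> nrm M g * nrm X f"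
proof (cases "nrm X f = 0")
  case True
  then have "AE x in L. f x = 0" using X.nrm_eq_0_iff[OF f] by simp
  then have "nrm Y (\<lambda>x. f x * g x) = 0"
    by (subst Y.nrm_eq_0_iff[OF mult_mem[OF g f]]) (auto elim!: eventually_mono)
  then show ?thesis using True by simp
next
  case False
  then have pos: "0 < nrm X f" using X.nrm_nonneg[OF f] by simp
  define c :: 'k where "c = of_real (1 / nrm X f)"
  have c: "norm c = 1 / nrm X f" using pos by (simp add: c_def norm_divide)
  have "(\<lambda>x. c * f x) \<in> unit_ball X"
    using pos by (simp add: unit_ball_def X.scale_mem[OF f] X.nrm_scale[OF f] c)
  from nrm_mult_unit_ball[OF g this]
  have "nrm Y (\<lambda>x. c * (f x * g x)) \<le> nrm M g" by (simp add: mult.assoc)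
  then show ?thesis using pos by (simp add: Y.nrm_scale[OF mult_mem[OF g f]] c field_simps)
qed

lemma ideal_M:
  assumes g: "g \<in> borel_measurable L" and h: "h \<in> elems M"
    and le: "AE x in L. norm (g x) \<le> norm (h x)"
  shows ideal_mem_M: "g \<in> elems M" and ideal_le_M: "nrm M g \<le> nrm M h"
proof -
  have *: "(\<lambda>x. f x * g x) \<in> elems Y \<and> nrm Y (\<lambda>x. f x * g x) \<le> nrm Y (\<lambda>x. f x * h x)" if f: "f \<in> elems X" for f
  proof -
    have "AE x in L. norm (f x * g x) \<le> norm (f x * h x)"
      using le by eventually_elim (simp add: norm_mult mult_left_mono)
    moreover have "(\<lambda>x. f x * g x) \<in> borel_measurable L"
      using g X.meas[OF f] by measurable
    ultimately show ?thesis using Y.ideal[OF _ mult_mem[OF h f]] by blast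
  qed
  then show "g \<in> elems M" by (intro memI_M g) blast
  show "nrm M g \<le> nrm M h"
  proof (rule nrm_M_least)
    fix f assume f: "f \<in> unit_ball X"
    then show "nrm Y (\<lambda>x. f x * g x) \<le> nrm M h"
      using *[of f] nrm_mult_unit_ball[OF h f] by (force simp: unit_ball_def)
  qed
qed

lemma add_M:
  assumes "g \<in> elems M" "h \<in> elems M"
  shows add_mem_M: "(\<lambda>x. g x + h x) \<in> elems M" and nrm_add_M: "nrm M (\<lambda>x. g x + h x) \<le> nrm M g + nrm M h"
proof -
  have 1: "(\<lambda>x. f x * (g x + h x)) \<in> elems Y" if "f \<in> elems X" for f
    using Y.add_mem[OF mult_mem[OF assms(1) that] mult_mem[OF assms(2) that]] by (simp add: distrib_left)
  then show "(\<lambda>x. g x + h x) \<in> elems M"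
    using assms[THEN meas_M] by (intro memI_M) auto
  show "nrm M (\<lambda>x. g x + h x) \<le> nrm M g + nrm M h"
  proof (rule nrm_M_least)
    fix f assume f: "f \<in> unit_ball X"
    then have fX: "f \<in> elems X" by (simp add: unit_ball_def)
    have "nrm Y (\<lambda>x. f x * (g x + h x)) \<le> nrm Y (\<lambda>x. f x * g x) + nrm Y (\<lambda>x. f x * h x)"
      using Y.nrm_add[OF mult_mem[OF assms(1) fX] mult_mem[OF assms(2) fX]] by (simp add: distrib_left)
    also have "\<dots> \<le> nrm M g + nrm M h"
      by (intro add_mono nrm_mult_unit_ball assms f)
    finally show "nrm Y (\<lambda>x. f x * (g x + h x)) \<le> nrm M g + nrm M h" .
  qed
qed

lemma scale_M:
  assumes "g \<in> elems M"
  shows scale_mem_M: "(\<lambda>x. c * g x) \<in> elems M" and nrm_scale_M: "nrm M (\<lambda>x. c * g x) \<le> norm c * nrm M g"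
proof -
  have eq: "(\<lambda>x. f x * (c * g x)) = (\<lambda>x. c * (f x * g x))" for f by (simp add: mult_ac)
  show "(\<lambda>x. c * g x) \<in> elems M"
    using meas_M[OF assms] Y.scale_mem[OF mult_mem[OF assms]] by (intro memI_M) (auto simp: eq)
  show "nrm M (\<lambda>x. c * g x) \<le> norm c * nrm M g"
    using nrm_mult_unit_ball[OF assms]
    by (intro nrm_M_least) (auto simp: eq Y.nrm_scale[OF mult_mem[OF assms]] unit_ball_def mult_left_mono)
qed

lemma level_set_sets:
  "f \<in> borel_measurable L \<Longrightarrow> {x\<in>\<Omega>. s < norm (f x :: 'k)} \<in> sets L"
  using measurable_sets[of "\<lambda>x. norm (f x)" L borel "{s<..}"]
  by (simp add: vimage_def Int_def conj_commute)

text \<open>The pieces \<open>E i\<close>, on which |m| exceeds \<open>b i\<close>, are moved to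
  disjoint \<open>F i\<close> of the same measure inside the set where |l| exceeds
  \<open>b i\<close>. Rearrangement invariance of \<open>X\<close> carries the step function below
  |f| over to the \<open>F i\<close>, where the multiplier \<open>l\<close> acts; rearrangement
  invariance of \<open>Y\<close> carries the result back.\<close>

lemma step_multiplier:
  fixes l m f :: "real \<Rightarrow> 'k" and I :: "'i set"
  assumes l: "l \<in> elems M" and m: "m \<in> borel_measurable L"
    and le: "\<And>s. 0 \<le> s \<Longrightarrow> distr_fun \<Omega> m s \<le> distr_fun \<Omega> l s"
    and f: "f \<in> elems X" and I: "finite I" and b: "\<And>i. i \<in> I \<Longrightarrow> 0 \<le> b i"
    and E: "disjoint_family_on E I" "\<And>i. i \<in> I \<Longrightarrow> E i \<in> sets L"
      "\<And>i. i \<in> I \<Longrightarrow> emeasure L (E i) < \<infinity>"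
    and Em: "\<And>i x. i \<in> I \<Longrightarrow> x \<in> E i \<Longrightarrow> b i < norm (m x)"
    and Ef: "\<And>i x. i \<in> I \<Longrightarrow> x \<in> E i \<Longrightarrow> norm (c i :: 'k) \<le> norm (f x)"
  shows "(\<lambda>x. \<Sum>i\<in>I. c i * of_real (b i) * indicator (E i) x) \<in> elems Y" (is ?mem)
    and "nrm Y (\<lambda>x. \<Sum>i\<in>I. c i * of_real (b i) * indicator (E i) x) \<le> nrm M l * nrm X f" (is ?le)
proof -
  define e where "e i = measure L (E i)" for i
  have Ee: "emeasure L (E i) = ennreal (e i)" if "i \<in> I" for i
    using E(3)[OF that] unfolding e_def by (intro emeasure_eq_ennreal_measure) auto
  have sub: "E i \<subseteq> \<Omega>" if "i \<in> I" for i
    using sets.sets_into_space[OF E(2)[OF that]] by simp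
  have lm: "l \<in> borel_measurable L" by (rule meas_M[OF l])
  \<comment> \<open>All pieces with level at least \<open>b i\<close> are disjoint parts of the set
    where |m| exceeds \<open>b i\<close>, so domination of the distribution functions at
    \<open>b i\<close> is the packing condition.\<close>
  have "\<exists>F. disjoint_family_on F I \<and> (\<forall>i\<in>I. F i \<in> sets L \<and> F i \<subseteq> {x\<in>\<Omega>. b i < norm (l x)}
           \<and> emeasure L (F i) = ennreal (e i))"
  proof (rule disjoint_packing[OF \<Omega> I, where S = "\<lambda>s. {x\<in>\<Omega>. s < norm (l x)}"])
    fix i assume i: "i \<in> I"
    have "ennreal (\<Sum>j\<in>{j\<in>I. b i \<le> b j}. e j) = (\<Sum>j\<in>{j\<in>I. b i \<le> b j}. emeasure L (E j))"
      by (simp add: Ee e_def)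
    also have "\<dots> = emeasure L (\<Union>j\<in>{j\<in>I. b i \<le> b j}. E j)"
      using E I by (intro sum_emeasure) (auto simp: disjoint_family_on_def)
    also have "\<dots> \<le> distr_fun \<Omega> m (b i)"
      unfolding distr_fun_def
    proof (rule emeasure_mono)
      show "(\<Union>j\<in>{j\<in>I. b i \<le> b j}. E j) \<subseteq> {x\<in>\<Omega>. b i < norm (m x)}"
        using Em sub by fastforce
    qed (rule level_set_sets[OF m])
    also have "\<dots> \<le> distr_fun \<Omega> l (b i)" by (rule le[OF b[OF i]])
    finally show "ennreal (\<Sum>j\<in>{j\<in>I. b i \<le> b j}. e j) \<le> emeasure L {x\<in>\<Omega>. b i < norm (l x)}"
      by (simp add: distr_fun_def)
  qed (auto intro: level_set_sets lm simp: e_def)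
  then obtain F where F: "disjoint_family_on F I" "\<And>i. i \<in> I \<Longrightarrow> F i \<in> sets L"
    and Fl: "\<And>i. i \<in> I \<Longrightarrow> F i \<subseteq> {x\<in>\<Omega>. b i < norm (l x)}"
    and Fe: "\<And>i. i \<in> I \<Longrightarrow> emeasure L (F i) = ennreal (e i)" by blast
  \<comment> \<open>\<open>p\<close> and its transplant \<open>g\<close> belong to \<open>X\<close>,
    \<open>r\<close> and its transplant \<open>h\<close> to \<open>Y\<close>. The chain is:
    \<open>r\<close> is equimeasurable with \<open>h\<close>, |h| \<le> |g l|, \<open>g\<close> is
    equimeasurable with \<open>p\<close>, and |p| \<le> |f|.\<close>
  define p where "p x = (\<Sum>i\<in>I. c i * indicator (E i) x)" for x
  define g where "g x = (\<Sum>i\<in>I. c i * indicator (F i) x)" for x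
  define r where "r x = (\<Sum>i\<in>I. c i * of_real (b i) * indicator (E i) x)" for x
  define h where "h x = (\<Sum>i\<in>I. c i * of_real (b i) * indicator (F i) x)" for x
  have step_meas: "(\<lambda>x. \<Sum>i\<in>I. d i * indicator (G i) x) \<in> borel_measurable L"
    if "\<And>i. i \<in> I \<Longrightarrow> G i \<in> sets L" for G and d :: "'i \<Rightarrow> 'k"
    using that by (intro borel_measurable_sum borel_measurable_times borel_measurable_const borel_measurable_indicator)
  have pm: "p \<in> borel_measurable L" unfolding p_def by (rule step_meas) (rule E(2))
  have gm: "g \<in> borel_measurable L" unfolding g_def by (rule step_meas) (rule F(2))
  have rm: "r \<in> borel_measurable L" unfolding r_def by (rule step_meas) (rule E(2))
  have hm: "h \<in> borel_measurable L" unfolding h_def by (rule step_meas) (rule F(2))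
  have EF: "emeasure L (F i) = emeasure L (E i)" if "i \<in> I" for i
    using Fe Ee that by simp
  have gp: "equimeasurable \<Omega> g p"
    unfolding g_def p_def by (intro equimeasurable_step I F E EF)
  have rh: "equimeasurable \<Omega> r h"
    unfolding r_def h_def by (intro equimeasurable_step I F E EF[symmetric])
  have outside: "(\<Sum>i\<in>I. d i * indicator (G i) x) = 0" if "\<not> (\<exists>i\<in>I. x \<in> G i)" for d :: "'i \<Rightarrow> 'k" and G x
    using that by (intro sum.neutral) auto
  have "norm (p x) \<le> norm (f x)" for x
  proof (cases "\<exists>i\<in>I. x \<in> E i")
    case True
    then obtain i where i: "i \<in> I" "x \<in> E i" by blast
    then show ?thesis using sum_indicator_disjoint[OF I E(1) i, of c] Ef[OF i] by (simp add: p_def)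
  qed (simp add: outside p_def)
  then have p: "p \<in> elems X" "nrm X p \<le> nrm X f"
    using X.ideal[OF pm f] by auto
  have g: "g \<in> elems X" "nrm X g = nrm X p"
    using riX gp gm p(1) unfolding ri_space_def by blast+
  have "norm (h x) \<le> norm (g x * l x)" for x
  proof (cases "\<exists>i\<in>I. x \<in> F i")
    case True
    then obtain i where i: "i \<in> I" "x \<in> F i" by blast
    have "norm (h x) = norm (c i) * b i"
      using sum_indicator_disjoint[OF I F(1) i, of "\<lambda>i. c i * of_real (b i)"] b[OF i(1)]
      by (simp add: h_def norm_mult)
    also have "\<dots> \<le> norm (c i) * norm (l x)"
      using Fl[OF i(1)] i by (intro mult_left_mono) auto
    also have "\<dots> = norm (g x * l x)"
      using sum_indicator_disjoint[OF I F(1) i, of c] by (simp add: g_def norm_mult)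
    finally show ?thesis .
  qed (simp add: outside h_def)
  then have h: "h \<in> elems Y" "nrm Y h \<le> nrm Y (\<lambda>x. g x * l x)"
    using Y.ideal[OF hm mult_mem[OF l g(1)]] by auto
  have r: "r \<in> elems Y" "nrm Y r = nrm Y h"
    using riY rh rm h(1) unfolding ri_space_def by blast+
  have "nrm Y r \<le> nrm M l * nrm X g"
    using r h nrm_mult_le[OF l g(1)] by simp
  also have "\<dots> \<le> nrm M l * nrm X f"
    using g p by (intro mult_left_mono nrm_M_nonneg l) simp
  finally show ?le unfolding r_def .
  show ?mem using r(1) unfolding r_def .
qed

text \<open>On growing windows the product of the dyadic approximants of |f| and |m| is a step
  function of the kind \<open>step_multiplier\<close> handles. The bound obtained does not depend on
  the approximation, and the Fatou property of \<open>Y\<close> passes it to |f| |m|.\<close>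

theorem distribution_domination:
  assumes l: "l \<in> elems M" and m: "m \<in> borel_measurable L"
    and le: "\<And>s. 0 \<le> s \<Longrightarrow> distr_fun \<Omega> m s \<le> distr_fun \<Omega> l s"
  shows dominated_mem: "m \<in> elems M" and dominated_le: "nrm M m \<le> nrm M l"
proof -
  have *: "(\<lambda>x. f x * m x) \<in> elems Y \<and> nrm Y (\<lambda>x. f x * m x) \<le> nrm M l * nrm X f" if f: "f \<in> elems X" for f
  proof -
    have [measurable]: "f \<in> borel_measurable L" "m \<in> borel_measurable L"
      using X.meas[OF f] m by auto
    define p where "p n x = dyadic n (norm (f x))" for n x
    define q where "q n x = dyadic n (norm (m x))" for n x
    \<comment> \<open>Only cells on which both approximants are positive contribute to the product.
      The window [-n, n] in \<open>E\<close> keeps their measures finite.\<close>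
    define I where "I n = {(c, b). c \<in> dyadic n ` {0..} \<and> b \<in> dyadic n ` {0..} \<and> 0 < c \<and> 0 < b}" for n
    define E where "E n = (\<lambda>(c, b). {x\<in>\<Omega>. p n x = c \<and> q n x = b \<and> x \<in> {- real n..real n}})" for n
    define r where "r n x = (\<Sum>i\<in>I n. (of_real (fst i) :: 'k) * of_real (snd i) * indicator (E n i) x)" for n x
    have fin: "finite (I n)" for n
      by (rule finite_subset[OF _ finite_cartesian_product[OF finite_range_dyadic finite_range_dyadic]])
        (auto simp: I_def)
    have disj: "disjoint_family_on (E n) (I n)" for n
      by (auto simp: disjoint_family_on_def E_def)
    have pm: "p n \<in> borel_measurable L" and qm: "q n \<in> borel_measurable L" for n
      unfolding p_def q_def by measurable
    have Em: "E n i \<in> sets L" for n i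
    proof -
      note pm [measurable] qm [measurable]
      have "(\<lambda>x. x) \<in> borel_measurable L" by (intro measurable_restrict_space1 measurable_completion) simp
      then have "{x \<in> space L. p n x = fst i \<and> q n x = snd i \<and> x \<in> {- real n..real n}} \<in> sets L"
        by measurable
      then show ?thesis by (simp add: E_def case_prod_beta)
    qed
    have Efin: "emeasure L (E n i) < \<infinity>" for n i
    proof -
      have "E n i \<subseteq> \<Omega>" by (auto simp: E_def case_prod_beta)
      then have "emeasure L (E n i) = emeasure lebesgue (E n i)"
        using \<Omega> by (intro emeasure_restrict_space) auto
      also have "\<dots> \<le> emeasure lebesgue {- real n..real n}"
        by (intro emeasure_mono sets_completionI_sets) (auto simp: E_def case_prod_beta)
      also have "\<dots> < \<infinity>" by simp
      finally show ?thesis .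
    qed
    have step: "r n \<in> elems Y \<and> nrm Y (r n) \<le> nrm M l * nrm X f" for n
    proof -
      have 1: "0 \<le> snd i" if "i \<in> I n" for i using that by (auto simp: I_def)
      have 2: "snd i < norm (m x)" if "i \<in> I n" "x \<in> E n i" for i x
        using that dyadic_less[of n "norm (m x)"] by (auto simp: I_def E_def q_def)
      have 3: "norm (of_real (fst i) :: 'k) \<le> norm (f x)" if "i \<in> I n" "x \<in> E n i" for i x
        using that dyadic_le[of "norm (f x)" n] by (auto simp: I_def E_def p_def)
      note st = step_multiplier[where b = snd and c = "\<lambda>i. of_real (fst i)" and E = "E n" and I = "I n",
          OF l m _ f fin _ disj Em Efin]
      show ?thesis
        unfolding r_def by (rule conjI; rule st; use le 1 2 3 in blast)
    qed
    have rpq: "r n x = of_real (p n x * q n x)" if "x \<in> \<Omega>" "x \<in> {- real n..real n}" for n x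
    proof (cases "0 < p n x \<and> 0 < q n x")
      case True
      then have "(p n x, q n x) \<in> I n" "x \<in> E n (p n x, q n x)"
        using that by (auto simp: I_def E_def p_def q_def)
      from sum_indicator_disjoint[OF fin disj this, of "\<lambda>i. of_real (fst i) * of_real (snd i)"]
      show ?thesis by (simp add: r_def)
    next
      case False
      then have 0: "p n x = 0 \<or> q n x = 0"
        using dyadic_nonneg by (metis p_def q_def less_eq_real_def)
      then have "r n x = 0" unfolding r_def
        by (intro sum.neutral) (auto simp: I_def E_def indicator_def)
      then show ?thesis using 0 by auto
    qed
    have lim: "(\<lambda>n. r n x) \<longlonglongrightarrow> of_real (norm (f x) * norm (m x))" if x: "x \<in> \<Omega>" for x
    proof (rule Lim_transform_eventually)
      show "(\<lambda>n. of_real (p n x * q n x) :: 'k) \<longlonglongrightarrow> of_real (norm (f x) * norm (m x))"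
        unfolding p_def q_def by (intro tendsto_of_real tendsto_mult dyadic_tendsto) auto
      obtain N where "\<bar>x\<bar> \<le> real N" using real_arch_simple by blast
      then have "of_real (p n x * q n x) = r n x" if "n \<ge> N" for n
        using that x by (subst rpq) auto
      then show "\<forall>\<^sub>F n in sequentially. of_real (p n x * q n x) = r n x"
        unfolding eventually_sequentially by blast
    qed
    \<comment> \<open>The approximants carry no phase, so the limit is the product of the moduli;
      the ideal property then yields \<open>f m\<close> itself.\<close>
    have prod: "(\<lambda>x. of_real (norm (f x) * norm (m x)) :: 'k) \<in> elems Y"
      "nrm Y (\<lambda>x. of_real (norm (f x) * norm (m x)) :: 'k) \<le> nrm M l * nrm X f"
    proof -
      have 1: "(\<lambda>x. of_real (norm (f x) * norm (m x)) :: 'k) \<in> borel_measurable L"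
        by measurable
      have 2: "AE x in L. (\<lambda>n. r n x) \<longlonglongrightarrow> of_real (norm (f x) * norm (m x))"
        using lim by (intro AE_I2) simp
      show "(\<lambda>x. of_real (norm (f x) * norm (m x)) :: 'k) \<in> elems Y"
        "nrm Y (\<lambda>x. of_real (norm (f x) * norm (m x)) :: 'k) \<le> nrm M l * nrm X f"
        using Y.fatou_limit[OF step[THEN conjunct1] step[THEN conjunct2] 1 2] .
    qed
    have "(\<lambda>x. f x * m x) \<in> borel_measurable L" by measurable
    from Y.ideal[OF this prod(1)] prod(2) show ?thesis by (auto simp: norm_mult)
  qed
  then show "m \<in> elems M" by (intro memI_M m) blast
  show "nrm M m \<le> nrm M l"
  proof (rule nrm_M_least)
    fix f assume "f \<in> unit_ball X"
    then show "nrm Y (\<lambda>x. f x * m x) \<le> nrm M l"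
      using *[of f] mult_left_mono[OF _ nrm_M_nonneg[OF l], of "nrm X f" 1] by (force simp: unit_ball_def)
  qed
qed

end

lemma borel_measurable_of_real_compose:
  "f \<in> borel_measurable N \<Longrightarrow> (\<lambda>x. of_real (f x) :: 'k::{real_normed_field, euclidean_space}) \<in> borel_measurable N"
  by measurable

section \<open>Smallness of indicators in the multiplier space\<close>

context multipliers begin

lemma distr_fun_indicator:
  assumes "E \<in> sets L" "0 \<le> s"
  shows "distr_fun \<Omega> (\<lambda>x. indicator E x :: 'k) s = (if s < 1 then emeasure L E else 0)"
proof -
  have "{x\<in>\<Omega>. s < norm (indicator E x :: 'k)} = (if s < 1 then E else {})"
    using assms sets.sets_into_space[OF assms(1)] by (auto simp: indicator_def split: if_splits)
  then show ?thesis by (simp add: distr_fun_def)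
qed

text \<open>A non-zero order continuous \<open>g\<close> exceeds some a > 0 in modulus on a set of
  positive measure. Nested subsets \<open>H k\<close> of that set, with measures tending to 0, give
  functions \<open>a\<close> times the indicator of \<open>H k\<close> that decrease to 0 below |g|,
  so their norms tend to 0. Monotonicity in the distribution function transfers this from
  \<open>H k\<close> to every set of no larger measure.\<close>

lemma indicator_small_M:
  assumes nontriv: "\<exists>g \<in> oc_part \<Omega> M. \<not> (AE x in L. g x = 0)" and "0 < \<epsilon>"
  obtains \<delta> where "0 < \<delta>" "\<And>E. E \<in> sets L \<Longrightarrow> emeasure L E \<le> ennreal \<delta> \<Longrightarrow>
    (\<lambda>x. indicator E x) \<in> elems M \<and> nrm M (\<lambda>x. indicator E x) < \<epsilon>"
proof -
  obtain g where g: "g \<in> oc_part \<Omega> M" "\<not> (AE x in L. g x = 0)" using nontriv by blast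
  have gM: "g \<in> elems M" using g(1) by (simp add: oc_part_def)
  define G where "G n = {x\<in>\<Omega>. 1 / real (Suc n) < norm (g x)}" for n
  have Gm: "G n \<in> sets L" for n
    unfolding G_def by (intro level_set_sets meas_M gM)
  have "\<exists>n. emeasure L (G n) \<noteq> 0"
  proof (rule ccontr)
    assume "\<not> ?thesis"
    then have "AE x in L. \<forall>n. x \<notin> G n"
      using Gm by (subst AE_all_countable) (auto intro!: AE_not_in)
    then have "AE x in L. g x = 0"
    proof (rule AE_mp, intro AE_I2 impI)
      fix x assume x: "x \<in> space L" "\<forall>n. x \<notin> G n"
      show "g x = 0"
      proof (rule ccontr)
        assume "g x \<noteq> 0"
        then obtain n where "inverse (real (Suc n)) < norm (g x)"
          using reals_Archimedean[of "norm (g x)"] by auto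
        then show False using x by (auto simp: G_def inverse_eq_divide)
      qed
    qed
    then show False using g(2) by blast
  qed
  then obtain n where n: "emeasure L (G n) \<noteq> 0" by blast
  define a where "a = 1 / real (Suc n)"
  have a0: "0 < a" by (simp add: a_def)
  have Gs: "G n \<subseteq> \<Omega>" "G n \<in> sets lebesgue"
    using Gm[of n] \<Omega> by (auto simp: sets_restrict_space_iff)
  have eG: "emeasure L F = emeasure lebesgue F" if "F \<subseteq> G n" for F
    using that Gs \<Omega> by (intro emeasure_restrict_space) auto
  \<comment> \<open>\<open>G n\<close> may have infinite measure, so a positive finite amount below
    its measure is fixed first.\<close>
  obtain z where z: "0 < z" "z < emeasure lebesgue (G n)"
    using n eG[of "G n"] dense[of 0 "emeasure lebesgue (G n)"] by (auto simp: zero_less_iff_neq_zero)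
  define t where "t = enn2real z"
  have zt: "z = ennreal t" using z(2) unfolding t_def by (metis ennreal_enn2real order.strict_trans2 top_greatest)
  have t0: "0 < t" using z(1) zt by simp
  have "\<exists>r. emeasure lebesgue (G n \<inter> {-r..r}) = ennreal (t / 2^k)" for k :: nat
  proof (rule exists_interval_section_of_measure[OF Gs(2)])
    have "t / 2^k \<le> t" using t0 by (simp add: field_simps)
    then show "ennreal (t / 2^k) < emeasure lebesgue (G n)"
      using z(2) unfolding zt by (metis ennreal_leI order.strict_trans1)
  qed (use t0 in simp)
  then obtain r where r: "\<And>k::nat. emeasure lebesgue (G n \<inter> {-r k..r k}) = ennreal (t / 2^k)" by metis
  define H where "H k = G n \<inter> {-r k..r k}" for k
  have Hm: "H k \<in> sets L" for k
    using Gs \<Omega> by (auto simp: H_def sets_restrict_space_iff)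
  have eH: "emeasure L (H k) = ennreal (t / 2^k)" for k
    using r[of k] by (subst eG) (auto simp: H_def)
  have aH: "x \<in> H k \<Longrightarrow> a < norm (g x)" for x k
    by (simp add: H_def G_def a_def)
  \<comment> \<open>All \<open>H k\<close> are symmetric sections of the same set, so the smaller
    measure forces the smaller radius.\<close>
  have decH: "H (Suc k) \<subseteq> H k" for k
  proof -
    have "r (Suc k) \<le> r k"
    proof (rule ccontr)
      assume "\<not> ?thesis"
      then have "emeasure lebesgue (G n \<inter> {-r k..r k}) \<le> emeasure lebesgue (G n \<inter> {-r (Suc k)..r (Suc k)})"
        using Gs by (intro emeasure_mono) auto
      then show False using t0 by (simp add: r field_simps)
    qed
    then show ?thesis by (auto simp: H_def)
  qed
  have "(\<lambda>k. nrm M (\<lambda>x. of_real (a * indicator (H k) x))) \<longlonglongrightarrow> 0"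
  proof -
    have hM: "(\<lambda>x. of_real (a * indicator (H k) x) :: 'k) \<in> elems M" for k
    proof (rule ideal_mem_M[OF _ gM])
      show "(\<lambda>x. of_real (a * indicator (H k) x) :: 'k) \<in> borel_measurable L"
        using Hm by (intro borel_measurable_of_real_compose) auto
      show "AE x in L. norm (of_real (a * indicator (H k) x) :: 'k) \<le> norm (g x)"
        using a0 aH[of _ k] by (intro AE_I2) (auto simp: indicator_def less_imp_le)
    qed
    have hAE: "AE x in L. (\<forall>k. 0 \<le> a * indicator (H k) x \<and> a * indicator (H k) x \<le> norm (g x))
        \<and> decseq (\<lambda>k. a * indicator (H k) x) \<and> (\<lambda>k. a * indicator (H k) x) \<longlonglongrightarrow> 0"
    proof -
      have Im: "(\<Inter>k. H k) \<in> sets L" using Hm by auto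
      have "emeasure L (\<Inter>k. H k) \<le> ennreal (t / 2^k)" for k
        unfolding eH[symmetric] by (intro emeasure_mono Hm) auto
      moreover have "(\<lambda>k. ennreal (t / 2^k)) \<longlonglongrightarrow> ennreal 0"
        by (intro tendsto_ennrealI LIMSEQ_divide_realpow_zero) auto
      ultimately have "emeasure L (\<Inter>k. H k) \<le> 0"
        by (intro LIMSEQ_le_const) auto
      then have "AE x in L. x \<notin> (\<Inter>k. H k)"
        using Im by (intro AE_not_in) auto
      then show ?thesis
      proof (rule AE_mp, intro AE_I2 impI)
        fix x assume x: "x \<in> space L" "x \<notin> (\<Inter>k. H k)"
        then obtain k where k: "x \<notin> H k" by blast
        have dec: "decseq H" using decH by (simp add: decseq_SucI)
        have "x \<notin> H j" if "j \<ge> k" for j using dec k that by (auto simp: decseq_def)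
        then have "\<forall>\<^sub>F j in sequentially. a * indicator (H j) x = 0"
          by (auto simp: eventually_sequentially indicator_def)
        then have "(\<lambda>j. a * indicator (H j) x) \<longlonglongrightarrow> 0" by (rule tendsto_eventually)
        moreover have "decseq (\<lambda>j. a * indicator (H j) x)"
          using dec a0 by (auto simp: decseq_def indicator_def)
        moreover have "0 \<le> a * indicator (H j) x \<and> a * indicator (H j) x \<le> norm (g x)" for j
          using a0 aH[of x j] by (auto simp: indicator_def)
        ultimately show "(\<forall>k. 0 \<le> a * indicator (H k) x \<and> a * indicator (H k) x \<le> norm (g x))
          \<and> decseq (\<lambda>k. a * indicator (H k) x) \<and> (\<lambda>k. a * indicator (H k) x) \<longlonglongrightarrow> 0" by blast
      qed
    qed
    have oc: "(\<lambda>n. nrm M (\<lambda>x. of_real (h n x))) \<longlonglongrightarrow> 0"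
      if "\<forall>n. (\<lambda>x. of_real (h n x)) \<in> elems M"
        "AE x in L. (\<forall>n. 0 \<le> h n x \<and> h n x \<le> norm (g x)) \<and> decseq (\<lambda>n. h n x) \<and> (\<lambda>n. h n x) \<longlonglongrightarrow> 0"
      for h :: "nat \<Rightarrow> real \<Rightarrow> real"
      using g(1) that unfolding oc_part_def by blast
    show ?thesis by (rule oc[of "\<lambda>k x. a * indicator (H k) x", OF _ hAE]) (use hM in blast)
  qed
  then have "\<forall>\<^sub>F k in sequentially. nrm M (\<lambda>x. of_real (a * indicator (H k) x)) < a * \<epsilon>"
    using a0 \<open>0 < \<epsilon>\<close> by (intro order_tendstoD) auto
  then obtain k where k: "nrm M (\<lambda>x. of_real (a * indicator (H k) x)) < a * \<epsilon>"
    by (auto simp: eventually_sequentially)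
  have HM: "(\<lambda>x. indicator (H k) x :: 'k) \<in> elems M"
  proof (rule ideal_mem_M[OF _ scale_mem_M[OF gM, of "of_real (1 / a)"]])
    show "AE x in L. norm (indicator (H k) x :: 'k) \<le> norm (of_real (1 / a) * g x)"
      using a0 aH[of _ k] by (intro AE_I2)
        (auto simp: indicator_def norm_mult field_simps norm_divide less_imp_le)
  qed (use Hm in auto)
  have aHM: "(\<lambda>x. of_real (a * indicator (H k) x) :: 'k) = (\<lambda>x. of_real a * indicator (H k) x)"
    by (auto simp: indicator_def)
  have "nrm M (\<lambda>x. indicator (H k) x :: 'k) = nrm M (\<lambda>x. of_real (1 / a) * (of_real a * indicator (H k) x))"
    using a0 by (simp flip: mult.assoc)
  also have "\<dots> \<le> (1 / a) * nrm M (\<lambda>x. of_real a * indicator (H k) x)"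
    using nrm_scale_M[OF scale_mem_M[OF HM, of "of_real a"], of "of_real (1/a)"] a0 by (simp add: norm_divide)
  also have "\<dots> < \<epsilon>" using k a0 unfolding aHM by (simp add: field_simps)
  finally have small: "nrm M (\<lambda>x. indicator (H k) x :: 'k) < \<epsilon>" .
  show ?thesis
  proof (rule that[of "t / 2^k"])
    fix E assume E: "E \<in> sets L" "emeasure L E \<le> ennreal (t / 2^k)"
    have le: "distr_fun \<Omega> (\<lambda>x. indicator E x :: 'k) s \<le> distr_fun \<Omega> (\<lambda>x. indicator (H k) x :: 'k) s" if "0 \<le> s" for s
      using E Hm[of k] that by (simp add: distr_fun_indicator eH)
    have Em: "(\<lambda>x. indicator E x :: 'k) \<in> borel_measurable L" using E by auto
    show "(\<lambda>x. indicator E x) \<in> elems M \<and> nrm M (\<lambda>x. indicator E x) < \<epsilon>"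
      using distribution_domination[OF HM Em le] small by auto
  qed (use t0 in simp)
qed

end

section \<open>The decreasing rearrangement\<close>

locale half_line_or_unit_interval =
  fixes \<Omega> :: "real set" and l :: "real \<Rightarrow> 'k::{real_normed_field, euclidean_space}"
  assumes \<Omega>_cases: "\<Omega> = {0<..<1} \<or> \<Omega> = {0<..}" and l: "l \<in> L0 \<Omega>"
begin

abbreviation "d \<equiv> distr_fun \<Omega> l"
abbreviation "ls \<equiv> decr_rearr \<Omega> l"

lemma \<Omega>_sets: "\<Omega> \<in> sets lebesgue"
  using \<Omega>_cases by auto

lemma \<Omega>_pos: "x \<in> \<Omega> \<Longrightarrow> 0 < x"
  using \<Omega>_cases by auto

lemma lm: "l \<in> borel_measurable (lebesgue_on \<Omega>)"
  using l by (simp add: L0_def)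

lemma level: "{x\<in>\<Omega>. s < norm (l x)} \<in> sets (lebesgue_on \<Omega>)"
  using measurable_sets[of "\<lambda>x. norm (l x)" "lebesgue_on \<Omega>" borel "{s<..}"] lm
  by (simp add: vimage_def Int_def conj_commute)

lemma d_antimono: "s \<le> t \<Longrightarrow> d t \<le> d s"
  unfolding distr_fun_def by (intro emeasure_mono level) auto

lemma emeasure_on: "F \<subseteq> \<Omega> \<Longrightarrow> emeasure (lebesgue_on \<Omega>) F = emeasure lebesgue F"
  using \<Omega>_sets by (intro emeasure_restrict_space) auto

text \<open>Otherwise there are sets of measure \<open>t / 2^n\<close> on which |l| exceeds
  \<open>4^n\<close>. Their union has finite measure, but the integral of |l| over it is at least
  \<open>t * 2^n\<close> for every \<open>n\<close>, contrary to
  \<open>l \<in> L0 \<Omega>\<close>.\<close>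

lemma exists_small_level:
  assumes "0 < t"
  shows "\<exists>s\<ge>0. d s \<le> ennreal t"
proof (rule ccontr)
  assume "\<not> ?thesis"
  then have big: "ennreal t < d s" if "0 \<le> s" for s using that by (meson not_le)
  have "\<exists>B\<in>sets (lebesgue_on \<Omega>). B \<subseteq> {x\<in>\<Omega>. 4^n < norm (l x)} \<and> emeasure (lebesgue_on \<Omega>) B = ennreal (t / 2^n)" for n :: nat
  proof (rule exists_subset_of_measure[OF \<Omega>_sets level])
    have "ennreal (t / 2^n) \<le> ennreal t" using assms by (intro ennreal_leI) (simp add: field_simps)
    then show "ennreal (t / 2^n) \<le> emeasure (lebesgue_on \<Omega>) {x\<in>\<Omega>. 4^n < norm (l x)}"
      using big[of "4^n"] by (simp add: distr_fun_def)
  qed (use assms in simp)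
  then obtain B where B: "\<And>n. B n \<in> sets (lebesgue_on \<Omega>)" "\<And>n::nat. B n \<subseteq> {x\<in>\<Omega>. 4^n < norm (l x)}"
    "\<And>n. emeasure (lebesgue_on \<Omega>) (B n) = ennreal (t / 2^n)" by metis
  define U where "U = (\<Union>n. B n)"
  have Um: "U \<in> sets (lebesgue_on \<Omega>)" unfolding U_def using B(1) by auto
  have summ: "summable (\<lambda>n. t / 2^n)"
    using summable_mult[OF summable_geometric[of "1/2::real"], of t] by (simp add: power_divide)
  have "emeasure (lebesgue_on \<Omega>) U \<le> (\<Sum>n. emeasure (lebesgue_on \<Omega>) (B n))"
    unfolding U_def using B(1) by (intro emeasure_subadditive_countably) auto
  also have "\<dots> = (\<Sum>n. ennreal (t / 2^n))" by (simp add: B(3))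
  also have "\<dots> = ennreal (\<Sum>n. t / 2^n)" using assms summ by (intro suminf_ennreal2) auto
  also have "\<dots> < \<infinity>" by simp
  finally have "set_integrable (lebesgue_on \<Omega>) U l" using l Um by (simp add: L0_def)
  then have int: "integrable (lebesgue_on \<Omega>) (\<lambda>x. indicator U x * norm (l x))"
    using set_integrable_norm[of "lebesgue_on \<Omega>" U l] by (simp add: set_integrable_def)
  have "t * 2^n \<le> (LINT x|lebesgue_on \<Omega>. indicator U x * norm (l x))" for n
  proof -
    have "(LINT x|lebesgue_on \<Omega>. 4^n * indicator (B n) x) \<le> (LINT x|lebesgue_on \<Omega>. indicator U x * norm (l x))"
    proof (rule integral_mono[OF _ int])
      show "integrable (lebesgue_on \<Omega>) (\<lambda>x. 4^n * indicator (B n) x :: real)"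
        using B(1,3)[of n] by (intro integrable_mult_right) auto
      show "4^n * indicator (B n) x \<le> indicator U x * norm (l x)" for x
        using B(2)[of n] by (auto simp: U_def indicator_def)
    qed
    moreover have "(LINT x|lebesgue_on \<Omega>. 4^n * indicator (B n) x) = t * 2^n"
    proof -
      have "measure (lebesgue_on \<Omega>) (B n) = t / 2^n" using B(3)[of n] assms by (simp add: measure_def)
      moreover have "(4::real)^n = 2^n * 2^n" by (simp flip: power_mult_distrib)
      moreover have "B n \<subseteq> \<Omega>" using B(2) by blast
      ultimately show ?thesis by (simp add: Int_absorb2)
    qed
    ultimately show ?thesis by simp
  qed
  moreover obtain n where "(LINT x|lebesgue_on \<Omega>. indicator U x * norm (l x)) / t < 2^n"
    using real_arch_pow[of 2] by auto
  ultimately show False using assms by (simp add: field_simps) (meson not_le)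
qed

text \<open>Level sets are defined by a strict inequality, so they increase to the set at
  \<open>s\<close> when the level decreases to \<open>s\<close>. Right continuity is what makes the
  infimum in \<open>decr_rearr\<close> attained.\<close>

lemma d_right_continuous:
  assumes "\<And>s'. s < s' \<Longrightarrow> d s' \<le> c"
  shows "d s \<le> c"
proof -
  have "(\<lambda>k. emeasure (lebesgue_on \<Omega>) {x\<in>\<Omega>. s + 1 / real (Suc k) < norm (l x)})
      \<longlonglongrightarrow> emeasure (lebesgue_on \<Omega>) (\<Union>k. {x\<in>\<Omega>. s + 1 / real (Suc k) < norm (l x)})"
  proof (rule Lim_emeasure_incseq)
    show "incseq (\<lambda>k. {x \<in> \<Omega>. s + 1 / real (Suc k) < norm (l x)})"
    proof (rule incseq_SucI, clarify)
      fix k x assume "s + 1 / real (Suc k) < norm (l x)"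
      moreover have "1 / real (Suc (Suc k)) \<le> 1 / real (Suc k)" by (simp add: frac_le)
      ultimately show "s + 1 / real (Suc (Suc k)) < norm (l x)" by linarith
    qed
  qed (use level in auto)
  moreover have "(\<Union>k. {x\<in>\<Omega>. s + 1 / real (Suc k) < norm (l x)}) = {x\<in>\<Omega>. s < norm (l x)}"
  proof (intro set_eqI iffI)
    fix x assume "x \<in> (\<Union>k. {x\<in>\<Omega>. s + 1 / real (Suc k) < norm (l x)})"
    then obtain k where "x \<in> \<Omega>" "s + 1 / real (Suc k) < norm (l x)" by blast
    moreover have "0 < 1 / real (Suc k)" by simp
    ultimately have "s < norm (l x)" by linarith
    with \<open>x \<in> \<Omega>\<close> show "x \<in> {x\<in>\<Omega>. s < norm (l x)}" by simp
  next
    fix x assume x: "x \<in> {x\<in>\<Omega>. s < norm (l x)}"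
    then obtain k where "inverse (real (Suc k)) < norm (l x) - s"
      using reals_Archimedean[of "norm (l x) - s"] by auto
    then show "x \<in> (\<Union>k. {x\<in>\<Omega>. s + 1 / real (Suc k) < norm (l x)})"
      using x by (auto simp: inverse_eq_divide intro!: exI[of _ k])
  qed
  ultimately have "(\<lambda>k. d (s + 1 / real (Suc k))) \<longlonglongrightarrow> d s"
    by (simp add: distr_fun_def)
  then show ?thesis by (rule LIMSEQ_le_const2) (use assms in auto)
qed

lemma rearr_set_nonempty: "0 < x \<Longrightarrow> {s. 0 \<le> s \<and> d s \<le> ennreal x} \<noteq> {}"
  using exists_small_level by auto

lemma rearr_nonneg: "0 < x \<Longrightarrow> 0 \<le> ls x"
  unfolding decr_rearr_def by (intro cInf_greatest rearr_set_nonempty) auto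

text \<open>A Galois connection: through it every question about \<open>ls\<close> becomes one about
  \<open>d\<close>.\<close>

lemma rearr_le_iff:
  assumes "0 < x" "0 \<le> s"
  shows "ls x \<le> s \<longleftrightarrow> d s \<le> ennreal x"
proof
  assume "d s \<le> ennreal x"
  then show "ls x \<le> s" unfolding decr_rearr_def using assms by (intro cInf_lower bdd_belowI[of _ 0]) auto
next
  assume le: "ls x \<le> s"
  show "d s \<le> ennreal x"
  proof (rule d_right_continuous)
    fix s' assume "s < s'"
    then have "Inf {s. 0 \<le> s \<and> d s \<le> ennreal x} < s'" using le by (simp add: decr_rearr_def)
    then obtain r where "0 \<le> r" "d r \<le> ennreal x" "r < s'"
      using cInf_lessD[OF rearr_set_nonempty[OF assms(1)]] by blast
    then show "d s' \<le> ennreal x" using d_antimono[of r s'] by simp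
  qed
qed

lemma less_rearr_iff: "0 < x \<Longrightarrow> 0 \<le> s \<Longrightarrow> s < ls x \<longleftrightarrow> ennreal x < d s"
  using rearr_le_iff[of x s] by (auto simp flip: not_le)

lemma id_measurable: "(\<lambda>x. x) \<in> borel_measurable (lebesgue_on \<Omega>)"
  by (intro measurable_restrict_space1 measurable_completion) simp

lemma rearr_measurable: "ls \<in> borel_measurable (lebesgue_on \<Omega>)"
proof (subst borel_measurable_iff_greater, intro allI)
  fix a
  note id_measurable [measurable]
  show "{w \<in> space (lebesgue_on \<Omega>). a < ls w} \<in> sets (lebesgue_on \<Omega>)"
  proof (cases "0 \<le> a")
    case True
    have "{w \<in> space (lebesgue_on \<Omega>). a < ls w} = {w \<in> space (lebesgue_on \<Omega>). ennreal w < d a}"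
      using less_rearr_iff[OF \<Omega>_pos True] by auto
    also have "\<dots> \<in> sets (lebesgue_on \<Omega>)" by measurable
    finally show ?thesis .
  next
    case False
    then have "{w \<in> space (lebesgue_on \<Omega>). a < ls w} = space (lebesgue_on \<Omega>)"
      using rearr_nonneg[OF \<Omega>_pos] by force
    then show ?thesis by simp
  qed
qed

lemma d_le_\<Omega>: "d s \<le> emeasure (lebesgue_on \<Omega>) \<Omega>"
  unfolding distr_fun_def using \<Omega>_sets by (intro emeasure_mono) (auto simp: sets_restrict_space_iff)

lemma d_finite_unit: "\<Omega> = {0<..<1} \<Longrightarrow> d s \<le> 1"
  using d_le_\<Omega>[of s] emeasure_on[of \<Omega>] by simp

lemma segment_subset: "d s = ennreal r \<Longrightarrow> 0 \<le> r \<Longrightarrow> {0<..<r} \<subseteq> \<Omega>"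
  using \<Omega>_cases d_finite_unit[of s] by auto

text \<open>By \<open>less_rearr_iff\<close> this set is where \<open>ls\<close> exceeds
  \<open>s\<close>, if \<open>s\<close> is non-negative; so \<open>ls\<close> and \<open>l\<close>
  have the same distribution function. For finite \<open>d s\<close> it is an initial segment, which
  fits into (0,1) because \<open>d s \<le> 1\<close> there.\<close>

lemma emeasure_rearr_level: "emeasure (lebesgue_on \<Omega>) {x\<in>\<Omega>. ennreal x < d s} = d s"
proof (cases "d s")
  case (real r)
  have "{x\<in>\<Omega>. ennreal x < d s} = {0<..<r}"
    using segment_subset[OF real(2,1)] \<Omega>_pos real by (auto simp: ennreal_less_iff less_imp_le)
  then show ?thesis using segment_subset[OF real(2,1)] real by (simp add: emeasure_on)
next
  case top
  then have "{x\<in>\<Omega>. ennreal x < d s} = \<Omega>" by simp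
  then show ?thesis using d_le_\<Omega>[of s] top by (simp add: top_unique)
qed

text \<open>Division by zero makes \<open>D 0\<close> the whole half line. The estimates below start
  at 2, where 1/n < 1 < n.\<close>

abbreviation D :: "nat \<Rightarrow> real set" where "D n \<equiv> {0<..<1 / real n} \<union> {real n<..}"
abbreviation "lsD n \<equiv> \<lambda>x. of_real (ls x * indicator (D n) x) :: 'k"

lemma distr_restricted_rearr:
  assumes "0 \<le> s"
  shows "distr_fun \<Omega> (\<lambda>x. of_real (ls x * indicator B x) :: 'k) s
    = emeasure (lebesgue_on \<Omega>) {x\<in>\<Omega>. x \<in> B \<and> ennreal x < d s}"
proof -
  have "s < norm (of_real (ls x * indicator B x) :: 'k) \<longleftrightarrow> x \<in> B \<and> ennreal x < d s" if "x \<in> \<Omega>" for x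
    using less_rearr_iff[OF \<Omega>_pos[OF that] assms] rearr_nonneg[OF \<Omega>_pos[OF that]] assms
    by (auto simp: indicator_def)
  then show ?thesis unfolding distr_fun_def by (metis (mono_tags, lifting) Collect_cong)
qed

lemma restricted_rearr_measurable:
  "B \<in> sets borel \<Longrightarrow> (\<lambda>x. of_real (ls x * indicator B x) :: 'k) \<in> borel_measurable (lebesgue_on \<Omega>)"
  by (intro borel_measurable_of_real_compose borel_measurable_times rearr_measurable
      measurable_compose[OF id_measurable borel_measurable_indicator]) auto

lemma rearr_level_set_measurable:
  "B \<in> sets borel \<Longrightarrow> {x\<in>\<Omega>. x \<in> B \<and> ennreal x < c} \<in> sets (lebesgue_on \<Omega>)"
proof -
  note id_measurable [measurable]
  assume [measurable]: "B \<in> sets borel"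
  have "{x\<in>space (lebesgue_on \<Omega>). x \<in> B \<and> ennreal x < c} \<in> sets (lebesgue_on \<Omega>)" by measurable
  then show ?thesis by simp
qed

lemma distr_restricted_le:
  assumes "B \<in> sets borel" "0 \<le> s"
  shows "distr_fun \<Omega> (\<lambda>x. of_real (ls x * indicator B x) :: 'k) s \<le> d s"
proof -
  have "emeasure (lebesgue_on \<Omega>) {x\<in>\<Omega>. x \<in> B \<and> ennreal x < d s} \<le> emeasure (lebesgue_on \<Omega>) {x\<in>\<Omega>. ennreal x < d s}"
    using rearr_level_set_measurable[of UNIV] by (intro emeasure_mono) auto
  then show ?thesis by (simp only: distr_restricted_rearr[OF assms(2)] emeasure_rearr_level)
qed

text \<open>\<open>A\<close> is the band where |l| lies between a lower cut \<open>b\<close> and the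
  upper cut \<open>B = ls (1 / n)\<close>. Outside it remain the values above \<open>B\<close>, on a
  set of measure at most 1/n, and the values up to \<open>b\<close>. The two intervals of
  \<open>D n\<close> absorb these two remainders.\<close>

lemma truncation_exists:
  assumes n: "2 \<le> n"
  shows "\<exists>A\<in>sets (lebesgue_on \<Omega>). emeasure (lebesgue_on \<Omega>) A < \<infinity> \<and> (\<exists>B. \<forall>x\<in>A. norm (l x) \<le> B) \<and>
    (\<forall>s\<ge>0. distr_fun \<Omega> (\<lambda>x. l x * indicator (\<Omega> - A) x) s \<le> distr_fun \<Omega> (lsD n) s)"
proof -
  have n0: "0 < 1 / real n" "1 / real n < 1" using n by auto
  \<comment> \<open>By \<open>distr_restricted_rearr\<close>, \<open>R (d s)\<close> is the
    distribution function of \<open>lsD n\<close> at \<open>s\<close>.\<close>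
  define R where "R c = emeasure (lebesgue_on \<Omega>) {x\<in>\<Omega>. x \<in> D n \<and> ennreal x < c}" for c
  have Rm: "{x\<in>\<Omega>. x \<in> D n \<and> ennreal x < c} \<in> sets (lebesgue_on \<Omega>)" for c
    by (intro rearr_level_set_measurable) auto
  \<comment> \<open>Only the interval of \<open>D n\<close> next to 0 is counted; 1/n < 1 keeps it
    inside \<Omega> in both cases.\<close>
  have R1: "min c (ennreal (1 / real n)) \<le> R c" for c
  proof -
    obtain r where r: "min c (ennreal (1 / real n)) = ennreal r" "0 \<le> r"
    proof (cases "min c (ennreal (1 / real n))")
      case top
      then have "top \<le> ennreal (1 / real n)" by (metis min.cobounded2)
      then show ?thesis by (simp add: top_unique)
    qed (use that in auto)
    have r1: "r \<le> 1 / real n" "ennreal r \<le> c"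
      using r n0 by (metis ennreal_le_iff less_imp_le min.cobounded2) (metis r(1) min.cobounded1)
    have sub: "{0<..<r} \<subseteq> {x\<in>\<Omega>. x \<in> D n \<and> ennreal x < c}"
    proof
      fix x assume x: "x \<in> {0<..<r}"
      then have "ennreal x < ennreal r" by (simp add: ennreal_less_iff)
      moreover have "x < 1 / real n" using x r1(1) by auto
      moreover from this have "x < 1" using n0(2) by linarith
      ultimately show "x \<in> {x\<in>\<Omega>. x \<in> D n \<and> ennreal x < c}"
        using x r1(2) \<Omega>_cases by auto
    qed
    then have "emeasure (lebesgue_on \<Omega>) {0<..<r} \<le> R c" unfolding R_def by (intro emeasure_mono Rm)
    moreover have "emeasure (lebesgue_on \<Omega>) {0<..<r} = ennreal r"
      using sub r(2) by (subst emeasure_on) auto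
    ultimately show ?thesis using r by simp
  qed
  \<comment> \<open>Since 1/n < n, the two intervals are disjoint and their lengths add up.\<close>
  have R2: "ennreal (1 / real n + (r - real n)) \<le> R (ennreal r)" if "\<Omega> = {0<..}" "real n \<le> r" for r
  proof -
    have sub: "{0<..<1 / real n} \<union> {real n<..<r} \<subseteq> {x\<in>\<Omega>. x \<in> D n \<and> ennreal x < ennreal r}"
    proof
      fix x assume x: "x \<in> {0<..<1 / real n} \<union> {real n<..<r}"
      have n1: "1 \<le> real n" using n by simp
      have "0 < x \<and> x < r"
        using x
      proof
        assume "x \<in> {0<..<1 / real n}"
        then have "0 < x" "x < 1 / real n" by auto
        then show ?thesis using n0(2) n1 that(2) by linarith
      qed (use n1 in auto)
      then have "0 < x" "x < r" by auto
      then show "x \<in> {x\<in>\<Omega>. x \<in> D n \<and> ennreal x < ennreal r}"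
        using x that by (auto simp: ennreal_less_iff)
    qed
    have "ennreal (1 / real n + (r - real n)) = emeasure lebesgue {0<..<1 / real n} + emeasure lebesgue {real n<..<r}"
      using that n0 by (simp flip: ennreal_plus)
    also have "\<dots> = emeasure lebesgue ({0<..<1 / real n} \<union> {real n<..<r})"
    proof (rule plus_emeasure)
      have "1 / real n < real n" using n0 n by linarith
      then show "{0<..<1 / real n} \<inter> {real n<..<r} = {}" by auto
    qed auto
    also have "\<dots> = emeasure (lebesgue_on \<Omega>) ({0<..<1 / real n} \<union> {real n<..<r})"
      using sub by (subst emeasure_on) auto
    also have "\<dots> \<le> R (ennreal r)" unfolding R_def by (intro emeasure_mono Rm sub)
    finally show ?thesis .
  qed
  have R3: "R top = top" if "\<Omega> = {0<..}"
  proof -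
    have "ennreal r \<le> R top" for r
    proof -
      have "ennreal r \<le> ennreal (1 / real n + (\<bar>r\<bar> + real n - real n))"
        using n0(1) by (intro ennreal_leI) linarith
      also have "\<dots> \<le> R (ennreal (\<bar>r\<bar> + real n))" using that by (rule R2) simp
      also have "\<dots> \<le> R top" unfolding R_def using top.not_eq_extremum by (intro emeasure_mono Rm) (auto simp: less_top)
      finally show ?thesis .
    qed
    note above = this
    show ?thesis
    proof (cases "R top")
      case (real q)
      then have "ennreal (q + 1) \<le> ennreal q" using above[of "q + 1"] by simp
      then have False using real(1) by (subst (asm) ennreal_le_iff) auto
      then show ?thesis ..
    qed
  qed
  define B where "B = ls (1 / real n)"
  \<comment> \<open>The lower cut must satisfy \<open>d s = \<infinity>\<close> or \<open>n \<le> d b\<close> for all \<open>s < b\<close>; \<open>ls n\<close> alone fails when \<open>ls\<close> is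
    constant around \<open>n\<close>.\<close>
  define b where "b = (if \<exists>b\<ge>0. ennreal (real n) \<le> d b \<and> d b < top
      then SOME b. 0 \<le> b \<and> ennreal (real n) \<le> d b \<and> d b < top else ls (real n))"
  have nb: "0 < real n" using n by simp
  have B0: "0 \<le> B" unfolding B_def by (intro rearr_nonneg n0)
  have dB: "d B \<le> ennreal (1 / real n)"
    using rearr_le_iff[OF n0(1) B0] by (simp add: B_def)
  \<comment> \<open>If no level has a finite measure of at least \<open>n\<close>, then every
    \<open>s\<close> below \<open>ls n\<close> satisfies \<open>d s > n\<close> and hence
    \<open>d s = \<infinity>\<close>, so the last clause is vacuous. Finiteness of
    \<open>d b\<close> gives \<open>A\<close> finite measure.\<close>
  have b: "0 \<le> b" "d b < top" "\<And>s. 0 \<le> s \<Longrightarrow> s < b \<Longrightarrow> d s < top \<Longrightarrow> ennreal (real n) \<le> d b"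
  proof -
    have "0 \<le> b \<and> d b < top \<and> (\<forall>s\<ge>0. s < b \<longrightarrow> d s < top \<longrightarrow> ennreal (real n) \<le> d b)"
    proof (cases "\<exists>b\<ge>0. ennreal (real n) \<le> d b \<and> d b < top")
      case True
      then show ?thesis unfolding b_def using someI_ex[of "\<lambda>b. 0 \<le> b \<and> ennreal (real n) \<le> d b \<and> d b < top"] by auto
    next
      case False
      have beq: "b = ls (real n)" unfolding b_def by (rule if_not_P[OF False])
      have b0: "0 \<le> b" using rearr_nonneg[OF nb] by (simp add: beq)
      have "d b \<le> ennreal (real n)"
        using rearr_le_iff[OF nb b0] by (simp add: beq)
      moreover have "ennreal (real n) < d s" if "0 \<le> s" "s < b" for s
        using that less_rearr_iff[OF nb that(1)] by (simp add: beq)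
      ultimately show ?thesis using False b0
        by (metis ennreal_less_top less_imp_le order.strict_trans1)
    qed
    then show "0 \<le> b" "d b < top" "\<And>s. 0 \<le> s \<Longrightarrow> s < b \<Longrightarrow> d s < top \<Longrightarrow> ennreal (real n) \<le> d b"
      by auto
  qed
  define A where "A = {x\<in>\<Omega>. b < norm (l x)} - {x\<in>\<Omega>. B < norm (l x)}"
  have Am: "A \<in> sets (lebesgue_on \<Omega>)" unfolding A_def by (intro sets.Diff level)
  have "emeasure (lebesgue_on \<Omega>) A \<le> d b"
    unfolding distr_fun_def A_def by (intro emeasure_mono level) auto
  then have Afin: "emeasure (lebesgue_on \<Omega>) A < \<infinity>"
    using b(2) by (simp add: order.strict_trans1)
  have Abd: "\<forall>x\<in>A. norm (l x) \<le> B" by (auto simp: A_def)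
  have "distr_fun \<Omega> (\<lambda>x. l x * indicator (\<Omega> - A) x) s \<le> distr_fun \<Omega> (lsD n) s" if s: "0 \<le> s" for s
  proof -
    define d' where "d' = distr_fun \<Omega> (\<lambda>x. l x * indicator (\<Omega> - A) x) s"
    have sub: "{x\<in>\<Omega>. s < norm (l x * indicator (\<Omega> - A) x)}
        \<subseteq> {x\<in>\<Omega>. B < norm (l x)} \<union> ({x\<in>\<Omega>. s < norm (l x)} - {x\<in>\<Omega>. b < norm (l x)})"
      using s by (auto simp: A_def indicator_def split: if_splits)
    have "{x\<in>\<Omega>. s < norm (l x * indicator (\<Omega> - A) x)} \<subseteq> {x\<in>\<Omega>. s < norm (l x)}"
      using s by (auto simp: indicator_def split: if_splits)
    then have d'd: "d' \<le> d s" unfolding d'_def distr_fun_def by (intro emeasure_mono level)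
    have d'B: "d' \<le> d B" if "b \<le> s"
    proof -
      have "{x\<in>\<Omega>. s < norm (l x * indicator (\<Omega> - A) x)} \<subseteq> {x\<in>\<Omega>. B < norm (l x)}"
        using sub that by auto
      then show ?thesis unfolding d'_def distr_fun_def by (intro emeasure_mono level)
    qed
    \<comment> \<open>From level \<open>b\<close> upwards only the values above \<open>B\<close>
      survive the removal of \<open>A\<close>. Below \<open>b\<close> the values between
      \<open>s\<close> and \<open>b\<close> survive as well; their measure \<open>d s - d b\<close>
      is at most \<open>d s - n\<close>, which the interval (n, d s) covers.\<close>
    have "d' \<le> R (d s)"
    proof (cases "b \<le> s")
      case True
      then have "d' \<le> min (d s) (ennreal (1 / real n))" using d'd d'B dB by auto
      then show ?thesis using R1 order_trans by blast
    next
      case False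
      show ?thesis
      proof (cases "d s = top")
        case True
        then have "\<Omega> = {0<..}" using \<Omega>_cases d_finite_unit[of s] by (auto simp: top_unique)
        then show ?thesis using R3 True by simp
      next
        case fin: False
        then have nb': "ennreal (real n) \<le> d b" using b(3)[of s] s False by (simp add: less_top)
        obtain r where r: "d s = ennreal r" "0 \<le> r" using fin by (cases "d s") auto
        obtain rb where rb: "d b = ennreal rb" "0 \<le> rb" using b(2) by (cases "d b") auto
        have rbr: "rb \<le> r" using d_antimono[of s b] False r rb by simp
        have nrb: "real n \<le> rb" using nb' rb by simp
        \<comment> \<open>On the unit interval \<open>d b \<le> 1 < n\<close>, against
          \<open>n \<le> d b\<close>.\<close>
        have \<Omega>: "\<Omega> = {0<..}"
        proof (rule ccontr)
          assume "\<not> ?thesis"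
          then have "ennreal rb \<le> ennreal 1" using \<Omega>_cases d_finite_unit[of b] rb by simp
          then have "rb \<le> 1" by (subst (asm) ennreal_le_iff) auto
          then show False using nrb n by simp
        qed
        have "d' \<le> emeasure (lebesgue_on \<Omega>) ({x\<in>\<Omega>. B < norm (l x)} \<union> ({x\<in>\<Omega>. s < norm (l x)} - {x\<in>\<Omega>. b < norm (l x)}))"
          unfolding d'_def distr_fun_def by (intro emeasure_mono sub sets.Un sets.Diff level)
        also have "\<dots> \<le> d B + emeasure (lebesgue_on \<Omega>) ({x\<in>\<Omega>. s < norm (l x)} - {x\<in>\<Omega>. b < norm (l x)})"
          unfolding distr_fun_def by (intro emeasure_subadditive sets.Diff level)
        also have "emeasure (lebesgue_on \<Omega>) ({x\<in>\<Omega>. s < norm (l x)} - {x\<in>\<Omega>. b < norm (l x)}) = d s - d b"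
          unfolding distr_fun_def using b(2) False s
          by (intro emeasure_Diff level) (auto simp: distr_fun_def)
        also have "d B + (d s - d b) \<le> ennreal (1 / real n) + ennreal (r - rb)"
          using dB r rb by (intro add_mono) (simp_all add: ennreal_minus)
        also have "\<dots> \<le> ennreal (1 / real n + (r - real n))"
          using n0 nrb rbr by (simp flip: ennreal_plus)
        also have "\<dots> \<le> R (d s)" unfolding r(1) by (rule R2[OF \<Omega>]) (use nrb rbr in simp)
        finally show ?thesis .
      qed
    qed
    also have "R (d s) = distr_fun \<Omega> (lsD n) s" unfolding R_def by (rule distr_restricted_rearr[OF s, symmetric])
    finally show ?thesis unfolding d'_def .
  qed
  then show ?thesis using Am Afin Abd by blast
qed

text \<open>The opposite comparison, for an arbitrary truncation set \<open>A\<close>. Removing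
  \<open>A\<close> leaves the distribution function unchanged at levels from \<open>B\<close> on and
  lowers it by at most \<alpha> below. Accordingly, near 0 only the part where \<open>ls\<close>
  exceeds \<open>B\<close> is kept, and the far part starts beyond \<alpha> + 1.\<close>

lemma rearr_tail_dominated:
  assumes A: "A \<in> sets (lebesgue_on \<Omega>)" "emeasure (lebesgue_on \<Omega>) A = ennreal \<alpha>" "0 \<le> \<alpha>"
    and B: "\<And>x. x \<in> A \<Longrightarrow> norm (l x) \<le> B" "0 \<le> B" and m: "2 \<le> m" "\<alpha> + 1 \<le> real m" and s: "0 \<le> s"
  shows "distr_fun \<Omega> (\<lambda>x. of_real (ls x * indicator ({x. ennreal x < d B \<and> x < 1 / real m} \<union> {real m<..}) x) :: 'k) s
    \<le> distr_fun \<Omega> (\<lambda>x. l x * indicator (\<Omega> - A) x) s"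
proof -
  define C where "C = {x. ennreal x < d B \<and> x < 1 / real m} \<union> {real m<..}"
  define d' where "d' s = distr_fun \<Omega> (\<lambda>x. l x * indicator (\<Omega> - A) x) s" for s
  have lev': "{x\<in>\<Omega>. s < norm (l x * indicator (\<Omega> - A) x)} = {x\<in>\<Omega>. s < norm (l x)} - A" if "0 \<le> s" for s
    using that by (auto simp: indicator_def split: if_splits)
  have d': "d' s = emeasure (lebesgue_on \<Omega>) ({x\<in>\<Omega>. s < norm (l x)} - A)" if "0 \<le> s" for s
    unfolding d'_def distr_fun_def lev'[OF that] ..
  have d'_anti: "d' t \<le> d' s" if "0 \<le> s" "s \<le> t" for s t
    using that by (simp add: d') (intro emeasure_mono sets.Diff level A, auto)
  have d_le: "d s \<le> d' s + ennreal \<alpha>" if "0 \<le> s" for s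
  proof -
    have "d s \<le> emeasure (lebesgue_on \<Omega>) (({x\<in>\<Omega>. s < norm (l x)} - A) \<union> A)"
      unfolding distr_fun_def by (intro emeasure_mono sets.Un sets.Diff level A) auto
    also have "\<dots> \<le> d' s + ennreal \<alpha>"
      unfolding d'[OF that] A(2)[symmetric] by (intro emeasure_subadditive sets.Diff level A)
    finally show ?thesis .
  qed
  have d_eq: "d' s = d s" if "B \<le> s" for s
  proof -
    have "{x\<in>\<Omega>. s < norm (l x)} - A = {x\<in>\<Omega>. s < norm (l x)}" using B that by fastforce
    then show ?thesis using d'[of s] B(2) that by (simp add: distr_fun_def)
  qed
  have C: "C \<in> sets borel" unfolding C_def by measurable
  have L: "distr_fun \<Omega> (\<lambda>x. of_real (ls x * indicator C x) :: 'k) s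
      = emeasure (lebesgue_on \<Omega>) {x\<in>\<Omega>. x \<in> C \<and> ennreal x < d s}" by (rule distr_restricted_rearr[OF s])
  have "distr_fun \<Omega> (\<lambda>x. of_real (ls x * indicator C x) :: 'k) s \<le> d' s"
  proof (cases "B \<le> s")
    case True
    then show ?thesis using distr_restricted_le[OF C s] d_eq by simp
  next
    case sB: False
    show ?thesis
    proof (cases "d s \<le> ennreal (real m)")
      \<comment> \<open>The level set of \<open>ls\<close> ends before \<open>m\<close>, so only the
        points with \<open>ls\<close> above \<open>B\<close> remain, and their number is unaffected
        by the removal of \<open>A\<close>.\<close>
      case True
      have "{x\<in>\<Omega>. x \<in> C \<and> ennreal x < d s} \<subseteq> {x\<in>\<Omega>. ennreal x < d B}"
      proof
        fix x assume x: "x \<in> {x\<in>\<Omega>. x \<in> C \<and> ennreal x < d s}"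
        then have "ennreal x < ennreal (real m)" using True by (metis (mono_tags) mem_Collect_eq order.strict_trans2)
        then have "\<not> real m < x" using x \<Omega>_pos[of x] by (simp add: ennreal_less_iff)
        then show "x \<in> {x\<in>\<Omega>. ennreal x < d B}" using x by (auto simp: C_def)
      qed
      then have "emeasure (lebesgue_on \<Omega>) {x\<in>\<Omega>. x \<in> C \<and> ennreal x < d s} \<le> d B"
        using rearr_level_set_measurable[of UNIV "d B"] emeasure_rearr_level[of B]
        by (metis (no_types, lifting) Collect_cong UNIV_I emeasure_mono space_borel sets.top)
      also have "\<dots> = d' B" using d_eq by simp
      also have "\<dots> \<le> d' s" using d'_anti[of s B] s sB by simp
      finally show ?thesis unfolding L .
    next
      case dm: False
      show ?thesis
      proof (cases "d s")
        case top
        then have "d' s = top" using d_le[OF s] by (simp add: top_unique)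
        then show ?thesis by simp
      next
        case (real r)
        have rm: "real m < r" using dm real by (simp add: not_le ennreal_less_iff)
        have m0: "0 < 1 / real m" "1 / real m \<le> 1" using m by auto
        have "{x\<in>\<Omega>. x \<in> C \<and> ennreal x < d s} \<subseteq> {0<..<1 / real m} \<union> {real m<..<r}"
          using \<Omega>_pos real by (auto simp: C_def ennreal_less_iff less_imp_le)
        then have "emeasure (lebesgue_on \<Omega>) {x\<in>\<Omega>. x \<in> C \<and> ennreal x < d s}
            \<le> emeasure lebesgue ({0<..<1 / real m} \<union> {real m<..<r})"
          by (subst emeasure_on, blast) (rule emeasure_mono, auto)
        also have "\<dots> \<le> emeasure lebesgue {0<..<1 / real m} + emeasure lebesgue {real m<..<r}"
          by (intro emeasure_subadditive) auto
        also have "\<dots> = ennreal (1 / real m + (r - real m))"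
          using rm m0 by (simp flip: ennreal_plus)
        \<comment> \<open>\<open>m \<ge> \<alpha> + 1\<close> pays both for the measure \<alpha>
          lost with \<open>A\<close> and for the interval (0, 1/m), whose length is at most
          1.\<close>
        also have "\<dots> \<le> ennreal (r - \<alpha>)" using m m0 by (intro ennreal_leI) linarith
        also have "\<dots> = d s - ennreal \<alpha>" using real A(3) by (simp add: ennreal_minus)
        also have "\<dots> \<le> d' s" using d_le[OF s] by (simp add: ennreal_minus_le_iff add.commute)
        finally show ?thesis unfolding L .
      qed
    qed
  qed
  then show ?thesis unfolding C_def d'_def .
qed

end

section \<open>The Hahn-Banach theorem\<close>

context koethe begin

definition sublinear :: "((real \<Rightarrow> 'k) \<Rightarrow> real) \<Rightarrow> bool" where
  "sublinear q \<longleftrightarrow> (\<forall>f\<in>elems X. \<forall>g\<in>elems X. q (\<lambda>x. f x + g x) \<le> q f + q g) \<and>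
     (\<forall>f\<in>elems X. \<forall>t\<ge>0. q (\<lambda>x. of_real t * f x) = t * q f)"

lemma sublinear_add: "sublinear q \<Longrightarrow> f \<in> elems X \<Longrightarrow> g \<in> elems X \<Longrightarrow> q (\<lambda>x. f x + g x) \<le> q f + q g"
  by (simp add: sublinear_def)

lemma sublinear_scale: "sublinear q \<Longrightarrow> f \<in> elems X \<Longrightarrow> 0 \<le> t \<Longrightarrow> q (\<lambda>x. of_real t * f x) = t * q f"
  by (simp add: sublinear_def)

lemma sublinear_zero: "sublinear q \<Longrightarrow> q (\<lambda>x. 0) = 0"
  using sublinear_scale[OF _ zero_mem, of q 0] by simp

lemma uminus_mem: "f \<in> elems X \<Longrightarrow> (\<lambda>x. - f x) \<in> elems X"
  using scale_mem[of f "-1"] by simp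

lemma sublinear_uminus: "sublinear q \<Longrightarrow> f \<in> elems X \<Longrightarrow> - q (\<lambda>x. - f x) \<le> q f"
  using sublinear_add[OF _ _ uminus_mem, of q f f] sublinear_zero[of q] by simp

text \<open>The reverse inequality for \<open>t\<close> is the same inequality for
  \<open>1 / t\<close>. One direction is what infima deliver.\<close>

lemma sublinearI:
  assumes add: "\<And>f g. f \<in> elems X \<Longrightarrow> g \<in> elems X \<Longrightarrow> q (\<lambda>x. f x + g x) \<le> q f + q g"
    and zero: "q (\<lambda>x. 0) = 0"
    and scale: "\<And>f t. f \<in> elems X \<Longrightarrow> 0 < t \<Longrightarrow> t * q f \<le> q (\<lambda>x. of_real t * f x)"
  shows "sublinear q"
  unfolding sublinear_def
proof (intro conjI ballI allI impI add)
  fix f :: "real \<Rightarrow> 'k" and t :: real assume f: "f \<in> elems X" and t: "0 \<le> t"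
  show "q (\<lambda>x. of_real t * f x) = t * q f"
  proof (cases "t = 0")
    case False
    then have t0: "0 < t" using t by simp
    have "(1 / t) * q (\<lambda>x. of_real t * f x) \<le> q (\<lambda>x. of_real (1 / t) * (of_real t * f x))"
      using t0 by (intro scale scale_mem f) simp
    also have "(\<lambda>x. of_real (1 / t) * (of_real t * f x)) = f"
      using t0 by (simp flip: mult.assoc of_real_mult)
    finally have "q (\<lambda>x. of_real t * f x) \<le> t * q f" using t0 by (simp add: field_simps)
    then show ?thesis using scale[OF f t0] by simp
  qed (simp add: zero)
qed

text \<open>Zorn's lemma for sublinear functionals below \<open>p\<close>. A chain is bounded below
  by its pointwise infimum, which is finite because every member satisfies
  \<open>- p (- f) \<le> q f\<close>.\<close>

lemma exists_minimal_sublinear: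
  assumes p: "sublinear p"
  obtains m where "sublinear m" "\<And>f. f \<in> elems X \<Longrightarrow> m f \<le> p f"
    "\<And>q. sublinear q \<Longrightarrow> (\<And>f. f \<in> elems X \<Longrightarrow> q f \<le> m f) \<Longrightarrow> (\<And>f. f \<in> elems X \<Longrightarrow> q f = m f)"
proof -
  \<comment> \<open>Fixing the value 0 outside \<open>elems X\<close> makes pointwise infima exist
    there too and confines minimality to \<open>elems X\<close>; \<open>cut\<close> enforces this
    normalisation.\<close>
  define A where "A = {q. sublinear q \<and> (\<forall>f\<in>elems X. q f \<le> p f) \<and> (\<forall>f. f \<notin> elems X \<longrightarrow> q f = 0)}"
  define P where "P q r \<longleftrightarrow> (\<forall>f. r f \<le> q f)" for q r :: "(real \<Rightarrow> 'k) \<Rightarrow> real"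
  define cut where "cut q f = (if f \<in> elems X then q f else 0)" for q :: "(real \<Rightarrow> 'k) \<Rightarrow> real" and f
  have cut: "sublinear (cut q)" if "sublinear q" for q
    using that add_mem scale_mem unfolding sublinear_def cut_def by simp
  have "\<exists>m\<in>A. \<forall>a\<in>A. P m a \<longrightarrow> a = m"
  proof (rule predicate_Zorn)
    show "partial_order_on A (relation_of P A)"
      by (rule partial_order_on_relation_ofI) (auto simp: P_def fun_eq_iff intro: order_trans antisym)
  next
    fix C assume "C \<in> Chains (relation_of P A)"
    then have CA: "C \<subseteq> A" and comp: "\<And>q r. q \<in> C \<Longrightarrow> r \<in> C \<Longrightarrow> P q r \<or> P r q"
      by (auto simp: Chains_def relation_of_def)
    show "\<exists>u\<in>A. \<forall>a\<in>C. P a u"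
    proof (cases "C = {}")
      case True
      have "cut p \<in> A" using cut[OF p] by (simp add: A_def cut_def)
      then show ?thesis using True by blast
    next
      case False
      define u where "u f = (INF q\<in>C. q f)" for f
      have sub: "sublinear q" if "q \<in> C" for q using CA that by (auto simp: A_def)
      have off: "q f = 0" if "q \<in> C" "f \<notin> elems X" for q f using CA that by (auto simp: A_def)
      have qp: "q f \<le> p f" if "q \<in> C" "f \<in> elems X" for q f using CA that by (auto simp: A_def)
      have bdd: "bdd_below ((\<lambda>q. q f) ` C)" for f
      proof (cases "f \<in> elems X")
        case True
        have "- p (\<lambda>x. - f x) \<le> q f" if "q \<in> C" for q
          using sublinear_uminus[OF sub[OF that] True] qp[OF that uminus_mem[OF True]] by simp
        then show ?thesis by (intro bdd_belowI2)
      next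
        case outside: False
        show ?thesis
        proof (rule bdd_belowI2[of _ 0])
          show "0 \<le> q f" if "q \<in> C" for q using off[OF that outside] by linarith
        qed
      qed
      have u_le: "u f \<le> q f" if "q \<in> C" for q f
        unfolding u_def by (intro cINF_lower bdd that)
      have u_greatest: "c \<le> u f" if "\<And>q. q \<in> C \<Longrightarrow> c \<le> q f" for c f
        unfolding u_def using False that by (intro cINF_greatest)
      have "sublinear u"
      proof (rule sublinearI)
        fix f g assume f: "f \<in> elems X" and g: "g \<in> elems X"
        \<comment> \<open>Of two comparable members the smaller one serves for both terms.\<close>
        have two: "u (\<lambda>x. f x + g x) \<le> q f + r g" if qr: "q \<in> C" "r \<in> C" for q r
        proof -
          obtain w where w: "w \<in> C" "w f \<le> q f" "w g \<le> r g"
            using comp[OF qr] qr unfolding P_def by blast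
          then show ?thesis
            using u_le[OF w(1), of "\<lambda>x. f x + g x"] sublinear_add[OF sub[OF w(1)] f g] by linarith
        qed
        have "u (\<lambda>x. f x + g x) - q f \<le> u g" if "q \<in> C" for q
        proof (rule u_greatest)
          show "u (\<lambda>x. f x + g x) - q f \<le> r g" if "r \<in> C" for r
            using two[OF \<open>q \<in> C\<close> that] by linarith
        qed
        then have "u (\<lambda>x. f x + g x) - u g \<le> u f"
          by (intro u_greatest) (simp add: algebra_simps)
        then show "u (\<lambda>x. f x + g x) \<le> u f + u g" by simp
      next
        have "(INF q\<in>C. q (\<lambda>x. 0)) = (INF q\<in>C. 0)" by (intro INF_cong refl sublinear_zero sub)
        then show "u (\<lambda>x. 0) = 0" using False by (simp add: u_def)
      next
        fix f :: "real \<Rightarrow> 'k" and t :: real assume f: "f \<in> elems X" and t: "0 < t"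
        show "t * u f \<le> u (\<lambda>x. of_real t * f x)"
          using t u_le by (intro u_greatest) (simp add: sublinear_scale[OF sub f] mult_left_mono)
      qed
      moreover have "u f = 0" if "f \<notin> elems X" for f
      proof -
        have "(INF q\<in>C. q f) = (INF q\<in>C. 0)" by (intro INF_cong refl off that)
        then show ?thesis using False by (simp add: u_def)
      qed
      moreover have "u f \<le> p f" if "f \<in> elems X" for f
        using False u_le qp[OF _ that] by (meson all_not_in_conv order_trans)
      ultimately have "u \<in> A" by (simp add: A_def)
      moreover have "P q u" if "q \<in> C" for q using u_le that by (simp add: P_def)
      ultimately show ?thesis by blast
    qed
  qed
  then obtain m where m: "m \<in> A" "\<And>a. a \<in> A \<Longrightarrow> P m a \<Longrightarrow> a = m" by blast
  show ?thesis
  proof (rule that)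
    show "sublinear m" "\<And>f. f \<in> elems X \<Longrightarrow> m f \<le> p f" using m(1) by (auto simp: A_def)
    fix q f assume q: "sublinear q" "\<And>f. f \<in> elems X \<Longrightarrow> q f \<le> m f" and f: "f \<in> elems X"
    have "cut q \<in> A" using cut[OF q(1)] q(2) m(1) by (force simp: A_def cut_def)
    moreover have "P m (cut q)" using q(2) m(1) by (auto simp: P_def cut_def A_def)
    ultimately have "cut q = m" by (rule m(2))
    then show "q f = m f" using f by (metis cut_def)
  qed
qed

text \<open>A minimal sublinear functional is linear. Subadditivity is given, so superadditivity is
  the point; negative scalars then follow from additivity.\<close>

lemma hahn_banach_real:
  assumes p: "sublinear p"
  obtains \<theta> where "\<And>f g. f \<in> elems X \<Longrightarrow> g \<in> elems X \<Longrightarrow> \<theta> (\<lambda>x. f x + g x) = \<theta> f + \<theta> g"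
    "\<And>f t. f \<in> elems X \<Longrightarrow> \<theta> (\<lambda>x. of_real t * f x) = t * \<theta> f"
    "\<And>f. f \<in> elems X \<Longrightarrow> \<theta> f \<le> p f"
proof -
  obtain m where m: "sublinear m" "\<And>f. f \<in> elems X \<Longrightarrow> m f \<le> p f"
    and minimal: "\<And>q f. sublinear q \<Longrightarrow> (\<And>f. f \<in> elems X \<Longrightarrow> q f \<le> m f) \<Longrightarrow> f \<in> elems X \<Longrightarrow> q f = m f"
    by (rule exists_minimal_sublinear[OF p]) blast
  have super: "m y + m v \<le> m (\<lambda>x. y x + v x)" if v: "v \<in> elems X" and y: "y \<in> elems X" for y v
  proof -
    \<comment> \<open>\<open>q\<close> is sublinear and at most \<open>m\<close> (take t = 0), so it
      equals \<open>m\<close> by minimality; t = 1 then reads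
      \<open>m y \<le> m (y + v) - m v\<close>.\<close>
    define q where "q y = (INF t\<in>{0..}. m (\<lambda>x. y x + of_real t * v x) - t * m v)" for y
    have mem: "(\<lambda>x. y x + of_real t * v x) \<in> elems X" if "y \<in> elems X" for y and t :: real
      by (intro add_mem scale_mem that v)
    have lower: "- m (\<lambda>x. - y x) \<le> m (\<lambda>x. y x + of_real t * v x) - t * m v"
      if y: "y \<in> elems X" and t: "0 \<le> t" for y t
    proof -
      have "m (\<lambda>x. (y x + of_real t * v x) + - y x) \<le> m (\<lambda>x. y x + of_real t * v x) + m (\<lambda>x. - y x)"
        by (intro sublinear_add m(1) mem uminus_mem y)
      then show ?thesis using sublinear_scale[OF m(1) v t] by simp
    qed
    have bdd: "bdd_below ((\<lambda>t. m (\<lambda>x. y x + of_real t * v x) - t * m v) ` {0..})" if "y \<in> elems X" for y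
      using lower[OF that] by (intro bdd_belowI2[of _ "- m (\<lambda>x. - y x)"]) auto
    have q_le: "q y \<le> m (\<lambda>x. y x + of_real t * v x) - t * m v" if "y \<in> elems X" "0 \<le> t" for y t
      unfolding q_def using that by (intro cINF_lower bdd) auto
    have q_greatest: "c \<le> q y" if "\<And>t. 0 \<le> t \<Longrightarrow> c \<le> m (\<lambda>x. y x + of_real t * v x) - t * m v" for c y
      unfolding q_def using that by (intro cINF_greatest) auto
    have "sublinear q"
    proof (rule sublinearI)
      fix f g assume f: "f \<in> elems X" and g: "g \<in> elems X"
      have two: "q (\<lambda>x. f x + g x) \<le> (m (\<lambda>x. f x + of_real s * v x) - s * m v) + (m (\<lambda>x. g x + of_real t * v x) - t * m v)"
        if "0 \<le> s" "0 \<le> t" for s t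
      proof -
        have "q (\<lambda>x. f x + g x) \<le> m (\<lambda>x. (f x + g x) + of_real (s + t) * v x) - (s + t) * m v"
          using that by (intro q_le add_mem f g) simp
        also have "(\<lambda>x. (f x + g x) + of_real (s + t) * v x)
            = (\<lambda>x. (f x + of_real s * v x) + (g x + of_real t * v x))"
          by (simp add: algebra_simps)
        also have "m (\<lambda>x. (f x + of_real s * v x) + (g x + of_real t * v x))
            \<le> m (\<lambda>x. f x + of_real s * v x) + m (\<lambda>x. g x + of_real t * v x)"
          by (intro sublinear_add m(1) mem f g)
        finally show ?thesis by (simp add: algebra_simps)
      qed
      have "q (\<lambda>x. f x + g x) - (m (\<lambda>x. f x + of_real s * v x) - s * m v) \<le> q g" if "0 \<le> s" for s
      proof (rule q_greatest)
        fix t :: real assume "0 \<le> t"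
        from two[OF that this] show "q (\<lambda>x. f x + g x) - (m (\<lambda>x. f x + of_real s * v x) - s * m v)
            \<le> m (\<lambda>x. g x + of_real t * v x) - t * m v" by linarith
      qed
      then have "q (\<lambda>x. f x + g x) - q g \<le> q f"
        by (intro q_greatest) (simp add: algebra_simps)
      then show "q (\<lambda>x. f x + g x) \<le> q f + q g" by simp
    next
      have "(\<lambda>t. m (\<lambda>x. 0 + of_real t * v x) - t * m v) ` {0..} = {0}"
        using sublinear_scale[OF m(1) v] by auto
      then show "q (\<lambda>x. 0) = 0" by (simp add: q_def)
    next
      fix f :: "real \<Rightarrow> 'k" and a :: real assume f: "f \<in> elems X" and a: "0 < a"
      show "a * q f \<le> q (\<lambda>x. of_real a * f x)"
      proof (rule q_greatest)
        fix t :: real assume t: "0 \<le> t"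
        have "(\<lambda>x. of_real a * f x + of_real t * v x) = (\<lambda>x. of_real a * (f x + of_real (t / a) * v x))"
          using a by (simp add: distrib_left flip: mult.assoc)
        then have "m (\<lambda>x. of_real a * f x + of_real t * v x) - t * m v
            = a * (m (\<lambda>x. f x + of_real (t / a) * v x) - (t / a) * m v)"
          using sublinear_scale[OF m(1) mem[OF f], of a "t / a"] a by (simp add: right_diff_distrib)
        then show "a * q f \<le> m (\<lambda>x. of_real a * f x + of_real t * v x) - t * m v"
          using q_le[OF f, of "t / a"] a t by simp
      qed
    qed
    moreover have "q f \<le> m f" if "f \<in> elems X" for f using q_le[OF that, of 0] by simp
    ultimately have "q y = m y" by (intro minimal y)
    then show ?thesis using q_le[OF y, of 1] by simp
  qed
  have add: "m (\<lambda>x. f x + g x) = m f + m g" if "f \<in> elems X" "g \<in> elems X" for f g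
    using super[OF that(2,1)] sublinear_add[OF m(1) that] by simp
  have neg: "m (\<lambda>x. - f x) = - m f" if "f \<in> elems X" for f
    using add[OF that uminus_mem[OF that]] sublinear_zero[OF m(1)] by simp
  have "m (\<lambda>x. of_real t * f x) = t * m f" if f: "f \<in> elems X" for f t
  proof (cases "0 \<le> t")
    case True
    then show ?thesis by (rule sublinear_scale[OF m(1) f])
  next
    case False
    have "m (\<lambda>x. of_real (- t) * f x) = - t * m f"
      using False by (intro sublinear_scale[OF m(1) f]) simp
    then show ?thesis using neg[OF scale_mem[OF f, of "of_real (- t)"]] by simp
  qed
  then show ?thesis using that add m(2) by blast
qed

text \<open>The form \<open>(c, d) \<mapsto> (c * d) \<bullet> 1\<close> is nondegenerate because \<open>'k\<close> is a field; hence every real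
  functional is \<open>\<phi> f \<bullet> 1\<close> for a unique \<open>'k\<close>-linear \<open>\<phi>\<close>.\<close>

lemma exists_dual_of_real_functional:
  assumes add: "\<And>f g. f \<in> elems X \<Longrightarrow> g \<in> elems X \<Longrightarrow> \<theta> (\<lambda>x. f x + g x) = \<theta> f + \<theta> g"
    and scale: "\<And>f t. f \<in> elems X \<Longrightarrow> \<theta> (\<lambda>x. of_real t * f x) = t * \<theta> f"
    and le: "\<And>f. f \<in> elems X \<Longrightarrow> \<theta> f \<le> C * nrm X f"
  obtains \<phi> where "\<phi> \<in> dual_space X" "\<And>f. f \<in> elems X \<Longrightarrow> norm (\<phi> f) \<le> C * nrm X f"
    "\<And>f. f \<in> elems X \<Longrightarrow> \<phi> f \<bullet> 1 = \<theta> f"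
proof -
  have one: "(1::'k) \<bullet> 1 = 1" by (simp flip: power2_norm_eq_inner)
  have nondeg: "d = 0" if "\<And>c. (c * d) \<bullet> 1 = (0::real)" for d :: 'k
  proof (rule ccontr)
    assume "d \<noteq> 0"
    then show False using that[of "inverse d"] one by simp
  qed
  have lin: "linear (\<lambda>c::'k. (c * d) \<bullet> 1)" for d
    by (rule linearI) (simp_all add: distrib_right inner_add_left)
  \<comment> \<open>\<open>R d\<close> is the vector representing the real functional
    \<open>c \<mapsto> (c * d) \<bullet> 1\<close>. Nondegeneracy makes \<open>R\<close> injective,
    hence surjective in finite dimension, so every real functional on the scalars has this
    form.\<close>
  define R where "R d = (\<Sum>b\<in>Basis. ((b * d) \<bullet> 1) *\<^sub>R b)" for d :: 'k
  have R_inner: "R d \<bullet> b = (b * d) \<bullet> 1" if "b \<in> Basis" for d b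
    using that by (simp add: R_def inner_sum_left_Basis)
  have linR: "linear R"
    by (rule linearI) (simp_all add: R_def distrib_left inner_add_left scaleR_left_distrib sum.distrib scaleR_sum_right)
  have "inj R"
  proof (subst linear_injective_0[OF linR], intro allI impI)
    fix d assume "R d = 0"
    then have "(b * d) \<bullet> 1 = 0" if "b \<in> Basis" for b using R_inner[OF that, of d] by simp
    then have "(\<lambda>c. (c * d) \<bullet> 1) = (\<lambda>c. 0)"
      by (intro linear_eq_stdbasis lin) (auto intro: linearI)
    then show "d = 0" by (intro nondeg) meson
  qed
  then have "surj R" using linear_injective_imp_surjective[OF linR] by simp
  have "\<exists>d. \<forall>c. (c * d) \<bullet> 1 = \<theta> (\<lambda>x. c * f x)" if f: "f \<in> elems X" for f
  proof -
    obtain d where d: "R d = (\<Sum>b\<in>Basis. \<theta> (\<lambda>x. b * f x) *\<^sub>R b)"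
      using \<open>surj R\<close> by (metis surjD)
    have "(b * d) \<bullet> 1 = \<theta> (\<lambda>x. b * f x)" if "b \<in> Basis" for b
      using R_inner[OF that, of d] that by (simp add: d inner_sum_left_Basis)
    moreover have "linear (\<lambda>c. \<theta> (\<lambda>x. c * f x))"
    proof (rule linearI)
      show "\<theta> (\<lambda>x. (a + b) * f x) = \<theta> (\<lambda>x. a * f x) + \<theta> (\<lambda>x. b * f x)" for a b
        using add[OF scale_mem[OF f] scale_mem[OF f], of a b] by (simp add: distrib_right)
      show "\<theta> (\<lambda>x. (r *\<^sub>R b) * f x) = r *\<^sub>R \<theta> (\<lambda>x. b * f x)" for r b
        using scale[OF scale_mem[OF f], of r b] by (simp add: scaleR_conv_of_real mult.assoc)
    qed
    ultimately have "(\<lambda>c. (c * d) \<bullet> 1) = (\<lambda>c. \<theta> (\<lambda>x. c * f x))"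
      by (intro linear_eq_stdbasis lin)
    then show ?thesis by metis
  qed
  then obtain \<phi> where \<phi>: "\<And>f c. f \<in> elems X \<Longrightarrow> (c * \<phi> f) \<bullet> 1 = \<theta> (\<lambda>x. c * f x)"
    by metis
  have uniq: "d = e" if "\<And>c. (c * d) \<bullet> 1 = (c * e) \<bullet> (1::'k)" for d e :: 'k
    using nondeg[of "d - e"] that by (simp add: right_diff_distrib inner_diff_left)
  have bound: "norm (\<phi> f) \<le> C * nrm X f" if f: "f \<in> elems X" for f
  proof (cases "\<phi> f = 0")
    case True
    then have "\<theta> f = 0" using \<phi>[OF f, of 1] by simp
    then show ?thesis using le[OF f] True by simp
  next
    case False
    \<comment> \<open>The unimodular scalar that rotates \<open>\<phi> f\<close> onto its modulus,
      so that the real bound applies to the norm.\<close>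
    define c where "c = of_real (norm (\<phi> f)) * inverse (\<phi> f)"
    have c: "norm c = 1" using False by (simp add: c_def norm_mult norm_inverse)
    have "norm (\<phi> f) = (c * \<phi> f) \<bullet> 1" using False one by (simp add: c_def mult.assoc scaleR_conv_of_real[symmetric] of_real_def)
    also have "\<dots> = \<theta> (\<lambda>x. c * f x)" by (rule \<phi>[OF f])
    also have "\<dots> \<le> C * nrm X f" using le[OF scale_mem[OF f], of c] by (simp add: nrm_scale[OF f] c)
    finally show ?thesis .
  qed
  have "\<phi> \<in> dual_space X"
    unfolding dual_space_def
  proof (intro CollectI conjI ballI allI)
    fix f g assume f: "f \<in> elems X" and g: "g \<in> elems X"
    show "\<phi> (\<lambda>x. f x + g x) = \<phi> f + \<phi> g"
    proof (rule uniq)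
      fix c
      have "(c * \<phi> (\<lambda>x. f x + g x)) \<bullet> 1 = \<theta> (\<lambda>x. c * f x + c * g x)"
        using \<phi>[OF add_mem[OF f g]] by (simp add: distrib_left)
      then show "(c * \<phi> (\<lambda>x. f x + g x)) \<bullet> 1 = (c * (\<phi> f + \<phi> g)) \<bullet> 1"
        using add[OF scale_mem[OF f] scale_mem[OF g]] \<phi>[OF f] \<phi>[OF g]
        by (simp add: distrib_left inner_add_left)
    qed
  next
    fix a f assume f: "f \<in> elems X"
    show "\<phi> (\<lambda>x. a * f x) = a * \<phi> f"
    proof (rule uniq)
      fix c
      show "(c * \<phi> (\<lambda>x. a * f x)) \<bullet> 1 = (c * (a * \<phi> f)) \<bullet> 1"
        using \<phi>[OF scale_mem[OF f], of c a] \<phi>[OF f, of "c * a"] by (simp add: mult.assoc)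
    qed
  qed (use bound in blast)
  then show ?thesis using that bound \<phi>[of _ 1] by simp
qed

text \<open>The sublinear functional is chosen such that \<open>\<theta> \<le> p\<close> forces both \<open>\<theta> f \<le> \<parallel>f\<parallel> / c\<close> and
  \<open>\<theta> (- u k) \<le> - 1\<close>.\<close>

lemma hahn_banach_l1:
  assumes u: "\<And>k. u k \<in> elems X" and c: "0 < c"
    and lower: "\<And>N a. (\<And>k. 0 \<le> a k) \<Longrightarrow> c * (\<Sum>k<N. a k) \<le> nrm X (\<lambda>x. \<Sum>k<N. of_real (a k) * u k x)"
  obtains \<phi> where "\<phi> \<in> dual_space X" "\<And>f. f \<in> elems X \<Longrightarrow> norm (\<phi> f) \<le> nrm X f / c"
    "\<And>k::nat. 1 \<le> \<phi> (u k) \<bullet> 1"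
proof -
  \<comment> \<open>Coefficients vanish from \<open>N\<close> on, so that two sequences can be
    padded to a common length and added.\<close>
  define I where "I = {(N::nat, a::nat \<Rightarrow> real). (\<forall>k. 0 \<le> a k) \<and> (\<forall>k\<ge>N. a k = 0)}"
  define U where "U N a x = (\<Sum>k<N. of_real (a k) * u k x)" for N a x
  define Q where "Q y = (\<lambda>(N, a). nrm X (\<lambda>x. y x + U N a x) / c - (\<Sum>k<N. a k))" for y
  define p where "p y = (INF i\<in>I. Q y i)" for y
  have UX: "U N a \<in> elems X" for N a
    unfolding U_def by (intro sum_mem scale_mem u)
  \<comment> \<open>The lower l1-estimate is what keeps the infimum \<open>p\<close> finite.\<close>
  have lowerQ: "- (nrm X y / c) \<le> Q y i" if y: "y \<in> elems X" and i: "i \<in> I" for y i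
  proof -
    obtain N a where ia: "i = (N, a)" "\<And>k. 0 \<le> a k" using i by (auto simp: I_def)
    have "c * (\<Sum>k<N. a k) \<le> nrm X (U N a)" using lower[OF ia(2)] by (simp add: U_def[abs_def])
    also have "\<dots> = nrm X (\<lambda>x. (y x + U N a x) - y x)" by simp
    also have "\<dots> \<le> nrm X (\<lambda>x. y x + U N a x) + nrm X y" by (intro nrm_diff add_mem y UX)
    finally show ?thesis using c by (simp add: Q_def ia field_simps)
  qed
  have bdd: "bdd_below (Q y ` I)" if "y \<in> elems X" for y
    using lowerQ[OF that] by (intro bdd_belowI2)
  have zI: "(0, \<lambda>k. 0) \<in> I" by (simp add: I_def)
  have p_le: "p y \<le> Q y i" if "y \<in> elems X" "i \<in> I" for y i
    unfolding p_def using that by (intro cINF_lower bdd)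
  have p_greatest: "b \<le> p y" if "\<And>i. i \<in> I \<Longrightarrow> b \<le> Q y i" for b y
    unfolding p_def using that zI by (intro cINF_greatest) auto
  have p_nrm: "p y \<le> nrm X y / c" if "y \<in> elems X" for y
    using p_le[OF that zI] by (simp add: Q_def U_def)
  have "sublinear p"
  proof (rule sublinearI)
    fix f g assume f: "f \<in> elems X" and g: "g \<in> elems X"
    have "p (\<lambda>x. f x + g x) \<le> Q f i + Q g j" if i: "i \<in> I" and j: "j \<in> I" for i j
    proof -
      obtain N a where ia: "i = (N, a)" "\<And>k. 0 \<le> a k" "\<And>k. k \<ge> N \<Longrightarrow> a k = 0" using i by (auto simp: I_def)
      obtain N' b where jb: "j = (N', b)" "\<And>k. 0 \<le> b k" "\<And>k. k \<ge> N' \<Longrightarrow> b k = 0" using j by (auto simp: I_def)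
      define K where "K = max N N'"
      have Ua: "U K a = U N a" unfolding U_def K_def
        by (intro ext sum.mono_neutral_right) (auto simp: ia(3) not_less)
      have Ub: "U K b = U N' b" unfolding U_def K_def
        by (intro ext sum.mono_neutral_right) (auto simp: jb(3) not_less)
      have Sa: "(\<Sum>k<K. a k) = (\<Sum>k<N. a k)" unfolding K_def
        by (intro sum.mono_neutral_right) (auto simp: ia(3) not_less)
      have Sb: "(\<Sum>k<K. b k) = (\<Sum>k<N'. b k)" unfolding K_def
        by (intro sum.mono_neutral_right) (auto simp: jb(3) not_less)
      have KI: "(K, \<lambda>k. a k + b k) \<in> I" using ia jb by (simp add: I_def K_def)
      have "p (\<lambda>x. f x + g x) \<le> Q (\<lambda>x. f x + g x) (K, \<lambda>k. a k + b k)"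
        by (intro p_le add_mem f g KI)
      also have "\<dots> = nrm X (\<lambda>x. (f x + U K a x) + (g x + U K b x)) / c - ((\<Sum>k<K. a k) + (\<Sum>k<K. b k))"
        by (simp add: Q_def U_def sum.distrib distrib_right add_ac)
      also have "\<dots> \<le> (nrm X (\<lambda>x. f x + U K a x) + nrm X (\<lambda>x. g x + U K b x)) / c - ((\<Sum>k<K. a k) + (\<Sum>k<K. b k))"
        using c by (intro diff_right_mono divide_right_mono nrm_add add_mem f g UX) simp
      also have "\<dots> = Q f i + Q g j" by (simp add: Q_def ia(1) jb(1) Ua Ub Sa Sb add_divide_distrib)
      finally show ?thesis .
    qed
    then have "p (\<lambda>x. f x + g x) - Q f i \<le> p g" if "i \<in> I" for i
      using that by (intro p_greatest) (simp add: algebra_simps)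
    then have "p (\<lambda>x. f x + g x) - p g \<le> p f"
      by (intro p_greatest) (simp add: algebra_simps)
    then show "p (\<lambda>x. f x + g x) \<le> p f + p g" by simp
  next
    have "p (\<lambda>x. 0) \<le> 0" using p_nrm[OF zero_mem] by (simp add: nrm_zero)
    moreover have "0 \<le> p (\<lambda>x. 0)" using lowerQ[OF zero_mem] by (intro p_greatest) (simp add: nrm_zero)
    ultimately show "p (\<lambda>x. 0) = 0" by simp
  next
    fix f :: "real \<Rightarrow> 'k" and t :: real assume f: "f \<in> elems X" and t: "0 < t"
    show "t * p f \<le> p (\<lambda>x. of_real t * f x)"
    proof (rule p_greatest)
      fix i assume i: "i \<in> I"
      then obtain N a where ia: "i = (N, a)" "\<And>k. 0 \<le> a k" "\<And>k. k \<ge> N \<Longrightarrow> a k = 0" by (auto simp: I_def)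
      have I': "(N, \<lambda>k. a k / t) \<in> I" using ia t by (simp add: I_def)
      have "(\<lambda>x. of_real t * f x + U N a x) = (\<lambda>x. of_real t * (f x + U N (\<lambda>k. a k / t) x))"
        using t by (simp add: U_def distrib_left sum_distrib_left)
      then have "Q (\<lambda>x. of_real t * f x) i = t * Q f (N, \<lambda>k. a k / t)"
        using t nrm_scale[OF add_mem[OF f UX], of "of_real t" N "\<lambda>k. a k / t"]
        by (simp add: Q_def ia right_diff_distrib sum_distrib_left)
      then show "t * p f \<le> Q (\<lambda>x. of_real t * f x) i"
        using p_le[OF f I'] t by simp
    qed
  qed
  then obtain \<theta> where \<theta>: "\<And>f g. f \<in> elems X \<Longrightarrow> g \<in> elems X \<Longrightarrow> \<theta> (\<lambda>x. f x + g x) = \<theta> f + \<theta> g"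
    "\<And>f t. f \<in> elems X \<Longrightarrow> \<theta> (\<lambda>x. of_real t * f x) = t * \<theta> f"
    "\<And>f. f \<in> elems X \<Longrightarrow> \<theta> f \<le> p f"
    using hahn_banach_real by blast
  have \<theta>u: "1 \<le> \<theta> (u k)" for k
  proof -
    \<comment> \<open>The single coefficient 1 at \<open>k\<close> cancels \<open>- u k\<close> and
      leaves the value -1.\<close>
    have i: "(Suc k, \<lambda>j. if j = k then 1 else 0) \<in> I" by (simp add: I_def)
    have "U (Suc k) (\<lambda>j. if j = k then 1 else 0) = u k"
      by (auto simp: U_def if_distrib[of of_real] cong: if_cong)
    then have "p (\<lambda>x. - u k x) \<le> - 1"
      using p_le[OF uminus_mem[OF u[of k]] i] by (simp add: Q_def nrm_zero)
    moreover have "\<theta> (\<lambda>x. - u k x) = - \<theta> (u k)" using \<theta>(2)[OF u, of "-1" k] by simp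
    ultimately show ?thesis using \<theta>(3)[OF uminus_mem[OF u[of k]]] by simp
  qed
  have \<theta>le: "\<theta> f \<le> (1 / c) * nrm X f" if "f \<in> elems X" for f
    using \<theta>(3)[OF that] p_nrm[OF that] by simp
  obtain \<phi> where "\<phi> \<in> dual_space X" "\<And>f. f \<in> elems X \<Longrightarrow> norm (\<phi> f) \<le> (1 / c) * nrm X f"
    "\<And>f. f \<in> elems X \<Longrightarrow> \<phi> f \<bullet> 1 = \<theta> f"
    using exists_dual_of_real_functional[OF \<theta>(1,2) \<theta>le] by blast
  then show ?thesis using that \<theta>u u by simp
qed

text \<open>\<open>hahn_banach_l1\<close> for the constant sequence of the normalised
  \<open>v\<close>: with non-negative coefficients, repeating one unit vector satisfies the
  l1-estimate with constant 1.\<close>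

lemma norming_functional:
  assumes v: "v \<in> elems X"
  obtains \<phi> where "\<phi> \<in> dual_space X" "\<And>f. f \<in> elems X \<Longrightarrow> norm (\<phi> f) \<le> nrm X f" "nrm X v \<le> norm (\<phi> v)"
proof (cases "nrm X v = 0")
  case True
  have "(\<lambda>f. 0) \<in> dual_space X" by (auto simp: dual_space_def intro!: exI[of _ 0])
  then show ?thesis using that[of "\<lambda>f. 0"] True nrm_nonneg by simp
next
  case False
  then have pos: "0 < nrm X v" using nrm_nonneg[OF v] by simp
  define w where "w x = of_real (1 / nrm X v) * v x" for x
  have w: "w \<in> elems X" unfolding w_def by (intro scale_mem v)
  have nw: "nrm X w = 1" unfolding w_def nrm_scale[OF v] using pos by (simp add: norm_divide)
  have "1 * (\<Sum>k<N. a k) \<le> nrm X (\<lambda>x. \<Sum>k<N. of_real (a k) * w x)" if "\<And>k. 0 \<le> a k" for N and a :: "nat \<Rightarrow> real"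
  proof -
    have "(\<lambda>x. \<Sum>k<N. of_real (a k) * w x) = (\<lambda>x. of_real (\<Sum>k<N. a k) * w x)"
      by (simp add: sum_distrib_right)
    then have "nrm X (\<lambda>x. \<Sum>k<N. of_real (a k) * w x) = \<bar>\<Sum>k<N. a k\<bar> * nrm X w"
      using nrm_scale[OF w, of "of_real (\<Sum>k<N. a k)"] by (simp only: norm_of_real)
    then show ?thesis using nw by simp
  qed
  then obtain \<phi> where \<phi>: "\<phi> \<in> dual_space X" "\<And>f. f \<in> elems X \<Longrightarrow> norm (\<phi> f) \<le> nrm X f / 1"
    "\<And>k::nat. 1 \<le> \<phi> w \<bullet> 1"
    using hahn_banach_l1[of "\<lambda>k. w" 1] w by (metis zero_less_one)
  have "1 \<le> norm (\<phi> w)"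
    using \<phi>(3) Cauchy_Schwarz_ineq2[of "\<phi> w" 1] by simp
  moreover have "\<phi> w = of_real (1 / nrm X v) * \<phi> v"
    using \<phi>(1) v unfolding w_def dual_space_def by blast
  ultimately have "nrm X v \<le> norm (\<phi> v)" using pos by (simp add: norm_mult norm_divide field_simps)
  then show ?thesis using that \<phi> by simp
qed

end

section \<open>Disjoint parts of weakly compact sets\<close>

text \<open>Otherwise every point of \<open>K\<close> has an open neighbourhood that the sequence
  eventually leaves for good. Finitely many of these cover \<open>K\<close>, and a late enough term
  lies in none of them.\<close>

lemma compactin_cluster_point:
  fixes h :: "nat \<Rightarrow> 'a"
  assumes K: "compactin T K" and h: "\<And>n. h n \<in> K"
  obtains g where "g \<in> K" "\<And>U m. openin T U \<Longrightarrow> g \<in> U \<Longrightarrow> \<exists>n\<ge>m. h n \<in> U"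
proof -
  have "\<exists>g\<in>K. \<forall>U m. openin T U \<longrightarrow> g \<in> U \<longrightarrow> (\<exists>n\<ge>m. h n \<in> U)"
  proof (rule ccontr)
    assume not: "\<not> ?thesis"
    define \<U> where "\<U> = {U. openin T U \<and> (\<exists>m. \<forall>n\<ge>m. h n \<notin> U)}"
    have "K \<subseteq> \<Union>\<U>"
    proof
      fix g assume "g \<in> K"
      then obtain U m where "openin T U" "g \<in> U" "\<forall>n\<ge>m. h n \<notin> U" using not by meson
      then show "g \<in> \<Union>\<U>" by (auto simp: \<U>_def)
    qed
    moreover have "openin T U" if "U \<in> \<U>" for U using that by (simp add: \<U>_def)
    ultimately have "\<exists>\<F>. finite \<F> \<and> \<F> \<subseteq> \<U> \<and> K \<subseteq> \<Union>\<F>"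
      by (intro compactinD[OF K])
    then obtain \<F> where \<F>: "finite \<F>" "\<F> \<subseteq> \<U>" "K \<subseteq> \<Union>\<F>" by blast
    then have "\<forall>U\<in>\<F>. \<exists>m. \<forall>n\<ge>m. h n \<notin> U" by (auto simp: \<U>_def)
    then obtain m where m: "\<And>U n. U \<in> \<F> \<Longrightarrow> n \<ge> m U \<Longrightarrow> h n \<notin> U" by metis
    define M where "M = (\<Sum>U\<in>\<F>. m U)"
    have "m U \<le> M" if "U \<in> \<F>" for U unfolding M_def using that \<F>(1) by (intro member_le_sum) auto
    then have "h M \<notin> \<Union>\<F>" using m by blast
    then show False using h \<F>(3) by blast
  qed
  then show ?thesis using that by blast
qed

text \<open>Each row has a small entry in any sufficiently large finite set of columns, so by the pigeonhole
  principle infinitely many rows share a column.\<close>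

lemma exists_sparse_column:
  fixes t :: "nat \<Rightarrow> nat \<Rightarrow> real"
  assumes nonneg: "\<And>n k. 0 \<le> t n k" and bound: "\<And>n N. (\<Sum>k<N. t n k) \<le> C"
    and "0 < \<eta>" and R: "infinite R"
  shows "\<exists>k\<in>R. \<exists>R'\<subseteq>R. infinite R' \<and> (\<forall>n\<in>R'. k < n \<and> t n k \<le> \<eta>) \<and> (\<forall>N. (\<Sum>r\<in>R' \<inter> {..<N}. t k r) \<le> \<eta>)"
proof -
  \<comment> \<open>In each row, \<open>q\<close> columns with entries above \<eta> would already
    exceed the bound \<open>C\<close> of the row sum.\<close>
  obtain q :: nat where q: "C / \<eta> < real q" using reals_Archimedean2 by blast
  obtain F where F: "F \<subseteq> R" "finite F" "card F = q" using infinite_arbitrarily_large[OF R] by blast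
  have "\<exists>k\<in>F. t n k \<le> \<eta>" for n
  proof (rule ccontr)
    assume "\<not> ?thesis"
    then have "(\<Sum>k\<in>F. \<eta>) \<le> (\<Sum>k\<in>F. t n k)" by (intro sum_mono) auto
    also have "\<dots> \<le> (\<Sum>k<Suc (Max F). t n k)"
      using F nonneg by (intro sum_mono2) (auto simp: less_Suc_eq_le)
    also have "\<dots> \<le> C" by (rule bound)
    finally show False using q F(3) \<open>0 < \<eta>\<close> by (simp add: field_simps)
  qed
  then have "(\<Union>k\<in>F. {n\<in>R. t n k \<le> \<eta>}) = R" by blast
  then obtain k where k: "k \<in> F" "infinite {n\<in>R. t n k \<le> \<eta>}"
    using R finite_UN_I[OF F(2), of "\<lambda>k. {n\<in>R. t n k \<le> \<eta>}"] by auto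
  have "summable (t k)" by (rule summableI_nonneg_bounded[OF nonneg bound])
  then obtain m where m: "\<And>j n. m \<le> j \<Longrightarrow> norm (sum (t k) {j..<n}) < \<eta>"
    using \<open>0 < \<eta>\<close> unfolding summable_Cauchy by blast
  \<comment> \<open>Deleting an initial segment makes the new indices exceed \<open>k\<close> and
    leaves of row \<open>k\<close> only a tail with sum below \<eta>.\<close>
  define R' where "R' = {n\<in>R. t n k \<le> \<eta>} - {..max k m}"
  have "(\<Sum>r\<in>R' \<inter> {..<N}. t k r) \<le> \<eta>" for N
  proof -
    have "(\<Sum>r\<in>R' \<inter> {..<N}. t k r) \<le> (\<Sum>r\<in>{m..<N}. t k r)"
      using nonneg by (intro sum_mono2) (auto simp: R'_def)
    then show ?thesis using m[of m N] by simp
  qed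
  moreover have "infinite R'" unfolding R'_def using k(2) by (intro Diff_infinite_finite) auto
  moreover have "R' \<subseteq> R" "\<forall>n\<in>R'. k < n \<and> t n k \<le> \<eta>" by (auto simp: R'_def)
  ultimately show ?thesis using k(1) F(1) by blast
qed

text \<open>Sparse columns are chosen successively, each from the index set left by the previous
  choice. In row \<open>s j\<close> the entries before the diagonal are small because earlier
  columns were sparse, and those after it form part of a small row tail.\<close>

lemma rosenthal_subsequence:
  fixes t :: "nat \<Rightarrow> nat \<Rightarrow> real"
  assumes nonneg: "\<And>n k. 0 \<le> t n k" and bound: "\<And>n N. (\<Sum>k<N. t n k) \<le> C" and "0 < \<epsilon>"
  shows "\<exists>s::nat \<Rightarrow> nat. strict_mono s \<and> (\<forall>j N. (\<Sum>i\<in>{..<N} - {j}. t (s j) (s i)) \<le> \<epsilon>)"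
proof -
  \<comment> \<open>The entries before the diagonal sum to less than \<epsilon> / 2, and the tail
    after it adds at most \<epsilon> / 4.\<close>
  define \<eta> where "\<eta> i = \<epsilon> / 2^(i + 2)" for i
  have \<eta>0: "0 < \<eta> i" for i using \<open>0 < \<epsilon>\<close> by (simp add: \<eta>_def)
  define P where "P i = (\<lambda>(k, R). infinite R \<and> (\<forall>n\<in>R. k < n \<and> t n k \<le> \<eta> i) \<and> (\<forall>N. (\<Sum>r\<in>R \<inter> {..<N}. t k r) \<le> \<eta> i))" for i
  have "\<exists>f. \<forall>n. P n (f n) \<and> fst (f (Suc n)) \<in> snd (f n) \<and> snd (f (Suc n)) \<subseteq> snd (f n)"
  proof (rule dependent_nat_choice)
    show "\<exists>x. P 0 x" using exists_sparse_column[where t = t, OF nonneg bound \<eta>0 infinite_UNIV_nat] unfolding P_def by auto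
    fix x n assume "P n x"
    then have "infinite (snd x)" by (auto simp: P_def)
    from exists_sparse_column[where t = t, OF nonneg bound \<eta>0[of "Suc n"] this]
    obtain k R' where "k \<in> snd x" "R' \<subseteq> snd x" "P (Suc n) (k, R')" unfolding P_def by auto
    then show "\<exists>y. P (Suc n) y \<and> fst y \<in> snd x \<and> snd y \<subseteq> snd x"
      by (intro exI[of _ "(k, R')"]) auto
  qed
  then obtain f where f: "\<And>n. P n (f n)" "\<And>n. fst (f (Suc n)) \<in> snd (f n)" "\<And>n. snd (f (Suc n)) \<subseteq> snd (f n)" by blast
  define s where "s i = fst (f i)" for i
  define R where "R i = snd (f i)" for i
  have R1: "\<And>i n. n \<in> R i \<Longrightarrow> s i < n \<and> t n (s i) \<le> \<eta> i"
    and R2: "\<And>i N. (\<Sum>r\<in>R i \<inter> {..<N}. t (s i) r) \<le> \<eta> i"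
    using f(1) unfolding P_def s_def R_def by (auto simp: case_prod_beta)
  have sR: "s i \<in> R j" if ji: "j < i" for i j
  proof -
    obtain k where i: "i = Suc k" "j \<le> k" using ji by (cases i) auto
    have "decseq R" using f(3) by (intro decseq_SucI) (simp add: R_def)
    then have "R k \<subseteq> R j" using i(2) by (simp add: decseq_def)
    then show ?thesis using f(2)[of k] by (auto simp: i s_def R_def)
  qed
  have mono: "strict_mono s" using R1[OF sR] by (auto simp: strict_mono_def)
  show ?thesis
  proof (intro exI[of _ s] conjI allI mono)
    fix j N
    have "(\<Sum>i\<in>{..<N} - {j}. t (s j) (s i)) \<le> (\<Sum>i\<in>{..<j} \<union> ({j<..} \<inter> {..<N}). t (s j) (s i))"
      using nonneg by (intro sum_mono2) auto
    also have "\<dots> = (\<Sum>i<j. t (s j) (s i)) + (\<Sum>i\<in>{j<..} \<inter> {..<N}. t (s j) (s i))"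
      by (intro sum.union_disjoint) auto
    also have "(\<Sum>i<j. t (s j) (s i)) \<le> (\<Sum>i<j. \<eta> i)"
      using R1[OF sR] by (intro sum_mono) auto
    also have "(\<Sum>i<j. \<eta> i) = \<epsilon> / 2 - \<epsilon> / 2^(j + 1)"
      by (induction j) (auto simp: \<eta>_def field_simps)
    also have "(\<Sum>i\<in>{j<..} \<inter> {..<N}. t (s j) (s i)) \<le> \<eta> j"
    proof -
      have "(\<Sum>i\<in>{j<..} \<inter> {..<N}. t (s j) (s i)) = (\<Sum>r\<in>s ` ({j<..} \<inter> {..<N}). t (s j) r)"
        using mono by (subst sum.reindex) (auto intro!: inj_onI simp: strict_mono_eq)
      also have "\<dots> \<le> (\<Sum>r\<in>R j \<inter> {..<s N}. t (s j) r)"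
        using nonneg sR mono by (intro sum_mono2) (auto simp: strict_mono_less)
      also have "\<dots> \<le> \<eta> j" by (rule R2)
      finally show ?thesis .
    qed
    finally have "(\<Sum>i\<in>{..<N} - {j}. t (s j) (s i)) \<le> \<epsilon> / 2 - \<epsilon> / 2^(j + 1) + \<eta> j" by simp
    also have "\<dots> \<le> \<epsilon>" using \<open>0 < \<epsilon>\<close> by (simp add: \<eta>_def field_simps)
    finally show "(\<Sum>i\<in>{..<N} - {j}. t (s j) (s i)) \<le> \<epsilon>" .
  qed
qed

lemma norm_suminf_diff_term_le:
  fixes f :: "nat \<Rightarrow> 'a::banach"
  assumes "summable f" and le: "\<And>N. (\<Sum>k\<in>{..<N} - {j}. norm (f k)) \<le> e"
  shows "norm (suminf f - f j) \<le> e"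
proof (rule LIMSEQ_le_const2)
  show "(\<lambda>N. norm ((\<Sum>k<N. f k) - f j)) \<longlonglongrightarrow> norm (suminf f - f j)"
    using summable_LIMSEQ[OF assms(1)] by (intro tendsto_intros)
  have "norm ((\<Sum>k<N. f k) - f j) \<le> e" if "Suc j \<le> N" for N
  proof -
    have "(\<Sum>k<N. f k) - f j = (\<Sum>k\<in>{..<N} - {j}. f k)"
      using that by (subst sum_diff1) auto
    also have "norm \<dots> \<le> (\<Sum>k\<in>{..<N} - {j}. norm (f k))" by (rule norm_sum)
    finally show ?thesis using le[of N] by simp
  qed
  then show "\<exists>N. \<forall>n\<ge>N. norm ((\<Sum>k<n. f k) - f j) \<le> e" by blast
qed

section \<open>Dual functionals on disjoint pieces and cluster points in the weak topology\<close>

context koethe begin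

lemma dual_add: "\<phi> \<in> dual_space X \<Longrightarrow> f \<in> elems X \<Longrightarrow> g \<in> elems X \<Longrightarrow> \<phi> (\<lambda>x. f x + g x) = \<phi> f + \<phi> g"
  by (simp add: dual_space_def)

lemma dual_scale: "\<phi> \<in> dual_space X \<Longrightarrow> f \<in> elems X \<Longrightarrow> \<phi> (\<lambda>x. c * f x) = c * \<phi> f"
  by (simp add: dual_space_def)

lemma dual_zero: "\<phi> \<in> dual_space X \<Longrightarrow> \<phi> (\<lambda>x. 0) = 0"
  using dual_scale[OF _ zero_mem, of \<phi> 0] by simp

lemma dual_sum:
  "\<phi> \<in> dual_space X \<Longrightarrow> (\<And>i. i \<in> I \<Longrightarrow> f i \<in> elems X) \<Longrightarrow> \<phi> (\<lambda>x. \<Sum>i\<in>I. f i x) = (\<Sum>i\<in>I. \<phi> (f i))"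
proof (induction I rule: infinite_finite_induct)
  case (insert i I)
  have "\<phi> (\<lambda>x. f i x + (\<Sum>i\<in>I. f i x)) = \<phi> (f i) + \<phi> (\<lambda>x. \<Sum>i\<in>I. f i x)"
    using insert.prems by (intro dual_add sum_mem) auto
  then show ?case using insert by simp
qed (simp_all add: dual_zero)

lemma dual_bound:
  assumes "\<phi> \<in> dual_space X"
  obtains C where "0 \<le> C" "\<And>f. f \<in> elems X \<Longrightarrow> norm (\<phi> f) \<le> C * nrm X f"
proof -
  obtain C where C: "\<And>f. f \<in> elems X \<Longrightarrow> norm (\<phi> f) \<le> C * nrm X f"
    using assms unfolding dual_space_def by blast
  have "norm (\<phi> f) \<le> \<bar>C\<bar> * nrm X f" if "f \<in> elems X" for f
    using C[OF that] mult_right_mono[OF abs_ge_self nrm_nonneg[OF that], of C] by linarith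
  then show ?thesis using that[of "\<bar>C\<bar>"] by simp
qed

lemma topspace_weak: "topspace (weak_topology X) = elems X"
proof -
  have "(\<lambda>f. 0) \<in> dual_space X" by (auto simp: dual_space_def intro!: exI[of _ 0])
  then have "elems X \<in> {{f \<in> elems X. \<phi> f \<in> U} | \<phi> U. \<phi> \<in> dual_space X \<and> open U}"
    by (intro CollectI exI[of _ "\<lambda>f. 0"] exI[of _ UNIV]) auto
  then show ?thesis unfolding weak_topology_def topology_generated_by_topspace by blast
qed

lemma openin_weak: "\<phi> \<in> dual_space X \<Longrightarrow> open U \<Longrightarrow> openin (weak_topology X) {f \<in> elems X. \<phi> f \<in> U}"
  unfolding weak_topology_def by (intro topology_generated_by_Basis) blast

text \<open>Multiplying the pieces by scalars of modulus at most 1 turns all values of \<phi> into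
  their moduli. The recombined function is still dominated by |f| because the pieces are disjoint.
  Thus restricting to the \<open>B k\<close> and applying \<phi> is a bounded map into l1.\<close>

lemma sum_dual_disjoint_le:
  assumes \<phi>: "\<phi> \<in> dual_space X" and C: "\<And>f. f \<in> elems X \<Longrightarrow> norm (\<phi> f) \<le> C * nrm X f" "0 \<le> C"
    and B: "\<And>k. B k \<in> sets L" "disjoint_family B" and f: "f \<in> elems X"
  shows "(\<Sum>k<N::nat. norm (\<phi> (\<lambda>x. f x * indicator (B k) x))) \<le> C * nrm X f"
proof -
  define v where "v k = \<phi> (\<lambda>x. f x * indicator (B k) x)" for k
  define c where "c k = (if v k = 0 then 0 else of_real (norm (v k)) * inverse (v k))" for k
  have cn: "norm (c k) \<le> 1" for k by (simp add: c_def norm_mult norm_inverse)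
  have cv: "c k * v k = of_real (norm (v k))" for k by (simp add: c_def)
  have mem: "(\<lambda>x. c k * (f x * indicator (B k) x)) \<in> elems X" for k
    by (intro scale_mem restrict_mem f B)
  have "\<phi> (\<lambda>x. \<Sum>k<N. c k * (f x * indicator (B k) x)) = (\<Sum>k<N. c k * v k)"
    using mem by (simp add: dual_sum[OF \<phi>] dual_scale[OF \<phi> restrict_mem[OF f B(1)]] v_def)
  also have "\<dots> = of_real (\<Sum>k<N. norm (v k))" by (simp add: cv)
  finally have "(\<Sum>k<N. norm (v k)) = norm (\<phi> (\<lambda>x. \<Sum>k<N. c k * (f x * indicator (B k) x)))"
    by (simp del: of_real_sum add: sum_nonneg)
  also have "\<dots> \<le> C * nrm X (\<lambda>x. \<Sum>k<N. c k * (f x * indicator (B k) x))"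
    by (intro C sum_mem mem)
  also have "nrm X (\<lambda>x. \<Sum>k<N. c k * (f x * indicator (B k) x)) \<le> nrm X f"
  proof (rule ideal_le[OF meas[OF sum_mem[OF mem]] f], intro AE_I2)
    fix x
    show "norm (\<Sum>k<N. c k * (f x * indicator (B k) x)) \<le> norm (f x)"
    proof (cases "\<exists>k<N. x \<in> B k")
      case True
      then obtain k where k: "k < N" "x \<in> B k" by blast
      have dis: "disjoint_family_on B {..<N}" using B(2) by (auto simp: disjoint_family_on_def)
      have "(\<Sum>k<N. c k * (f x * indicator (B k) x)) = (\<Sum>k<N. c k * f x * indicator (B k) x)"
        by (simp add: mult.assoc)
      also have "\<dots> = c k * f x"
        using sum_indicator_disjoint[OF _ dis, of k x "\<lambda>k. c k * f x"] k by simp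
      finally show ?thesis using mult_right_mono[OF cn[of k] norm_ge_zero[of "f x"]] by (simp add: norm_mult)
    next
      case False
      then have "(\<Sum>k<N. c k * (f x * indicator (B k) x)) = 0" by (intro sum.neutral) auto
      then show ?thesis by simp
    qed
  qed
  finally show ?thesis using C(2) by (simp add: v_def mult_left_mono)
qed

text \<open>The map \<open>y \<mapsto> (\<phi> (y restricted to B k))\<close> into l1 has diagonal
  entries at least \<delta> on a subsequence of \<open>h\<close>. After sparsification the tail sums
  of the images stay near these entries, whereas at a weak cluster point the tail sums tend to 0.
  Each tail sum is itself a dual functional, so the weak topology sees the contradiction.\<close>

lemma disjoint_parts_of_weakly_compact:
  assumes DH: "one_DH \<Omega> X" and K: "compactin (weak_topology X) K" and h: "\<And>n::nat. h n \<in> K"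
    and B: "\<And>n. B n \<in> sets L" "disjoint_family B" and "0 < \<delta>"
    and big: "\<And>n. \<delta> \<le> nrm X (\<lambda>x. h n x * indicator (B n) x)" and H: "\<And>n. nrm X (h n) \<le> H"
  shows False
proof -
  have hX: "h n \<in> elems X" for n
    using compactin_subset_topspace[OF K] h topspace_weak by blast
  define \<nu> where "\<nu> n = nrm X (\<lambda>x. h n x * indicator (B n) x)" for n
  have \<nu>: "0 < \<nu> n" "\<delta> \<le> \<nu> n" for n using big[of n] \<open>0 < \<delta>\<close> by (auto simp: \<nu>_def)
  define u where "u n x = of_real (1 / \<nu> n) * (h n x * indicator (B n) x)" for n x
  have hB: "(\<lambda>x. h n x * indicator (B k) x) \<in> elems X" for n k by (intro restrict_mem hX B)
  have u: "u n \<in> elems X" for n unfolding u_def by (intro scale_mem hB)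
  have un: "nrm X (u n) = 1" for n unfolding u_def nrm_scale[OF hB] using \<nu>(1)[of n] by (simp add: norm_divide \<nu>_def)
  have "AE x in L. u m x = 0 \<or> u n x = 0" if "m \<noteq> n" for m n
    using B(2) that by (intro AE_I2) (auto simp: u_def indicator_def disjoint_family_on_def)
  then obtain r where r: "strict_mono r" "equivalent_to_l1_basis X (\<lambda>k. u (r k))"
    using DH u un unfolding one_DH_def by blast
  then obtain c where c: "0 < c" "\<And>N a. c * (\<Sum>k<N. norm (a k)) \<le> nrm X (\<lambda>x. \<Sum>k<N. a k * u (r k) x)"
    unfolding equivalent_to_l1_basis_def by blast
  have lower: "c * (\<Sum>k<N. a k) \<le> nrm X (\<lambda>x. \<Sum>k<N. of_real (a k) * u (r k) x)" if "\<And>k. 0 \<le> a k" for N a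
    using c(2)[of "\<lambda>k. of_real (a k)" N] that by simp
  obtain \<phi> where \<phi>: "\<phi> \<in> dual_space X" and \<phi>C: "\<And>f. f \<in> elems X \<Longrightarrow> norm (\<phi> f) \<le> nrm X f / c"
    and \<phi>u: "\<And>k. 1 \<le> \<phi> (u (r k)) \<bullet> 1"
    using hahn_banach_l1[OF u[of "r _"] c(1) lower] by blast
  have \<phi>C': "norm (\<phi> f) \<le> (1 / c) * nrm X f" if "f \<in> elems X" for f using \<phi>C[OF that] by simp
  have diag: "\<delta> \<le> norm (\<phi> (\<lambda>x. h (r k) x * indicator (B (r k)) x))" for k
  proof -
    have "1 \<le> norm (\<phi> (u (r k)))" using \<phi>u[of k] Cauchy_Schwarz_ineq2[of "\<phi> (u (r k))" 1] by simp
    moreover have "\<phi> (u (r k)) = of_real (1 / \<nu> (r k)) * \<phi> (\<lambda>x. h (r k) x * indicator (B (r k)) x)"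
      unfolding u_def by (rule dual_scale[OF \<phi> hB])
    ultimately have "\<nu> (r k) \<le> norm (\<phi> (\<lambda>x. h (r k) x * indicator (B (r k)) x))"
      using \<nu>(1)[of "r k"] by (simp add: norm_mult norm_divide field_simps)
    then show ?thesis using \<nu>(2) order_trans by blast
  qed
  define t where "t j i = norm (\<phi> (\<lambda>x. h (r j) x * indicator (B (r i)) x))" for j i
  have disj_r: "disjoint_family (\<lambda>k. B (q k))" if "strict_mono q" for q :: "nat \<Rightarrow> nat"
    using B(2) strict_mono_eq[OF that] by (auto simp: disjoint_family_on_def)
  have t_bound: "(\<Sum>i<N. t j i) \<le> (1 / c) * H" for j N
  proof -
    have "(\<Sum>i<N. t j i) \<le> (1 / c) * nrm X (h (r j))"
      unfolding t_def using c(1) B by (intro sum_dual_disjoint_le[OF \<phi>] \<phi>C' hX disj_r r) auto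
    also have "\<dots> \<le> (1 / c) * H" using c(1) H by (intro mult_left_mono) auto
    finally show ?thesis .
  qed
  \<comment> \<open>Three errors of \<delta> / 4 are to be absorbed by the diagonal entry: the
    off-diagonal sum, the tail at the cluster point, and the weak distance between the two.\<close>
  have "0 < \<delta> / 4" using \<open>0 < \<delta>\<close> by simp
  have t_nonneg: "0 \<le> t j i" for j i by (simp add: t_def)
  obtain s :: "nat \<Rightarrow> nat" where s: "strict_mono s" and "\<forall>j N. (\<Sum>i\<in>{..<N} - {j}. t (s j) (s i)) \<le> \<delta> / 4"
    using rosenthal_subsequence[of t, OF t_nonneg t_bound \<open>0 < \<delta> / 4\<close>] by (elim exE conjE)
  then have sparse: "(\<Sum>i\<in>{..<N} - {j}. t (s j) (s i)) \<le> \<delta> / 4" for j N by blast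
  define q where "q = r \<circ> s"
  have q: "strict_mono q" unfolding q_def by (intro strict_mono_o r s)
  obtain g where g: "g \<in> K" and cluster: "\<And>U m. openin (weak_topology X) U \<Longrightarrow> g \<in> U \<Longrightarrow> \<exists>n\<ge>m. h (q n) \<in> U"
    using compactin_cluster_point[OF K, of "\<lambda>n. h (q n)"] h by blast
  have gX: "g \<in> elems X" using compactin_subset_topspace[OF K] g topspace_weak by blast
  \<comment> \<open>The entries of the image of \<open>y\<close> from position \<open>m\<close> on;
    the sum of \<open>\<psi> m y\<close> is the tail functional.\<close>
  define \<psi> where "\<psi> m y k = \<phi> (\<lambda>x. y x * indicator (B (q (k + m))) x)" for m y k
  have disj_m: "disjoint_family (\<lambda>k. B (q (k + m)))" for m
    using disj_r[of "\<lambda>k. q (k + m)"] q by (auto simp: strict_mono_def)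
  have \<psi>_sum: "(\<Sum>k<N. norm (\<psi> m y k)) \<le> (1 / c) * nrm X y" if "y \<in> elems X" for m y N
    unfolding \<psi>_def using c(1) B by (intro sum_dual_disjoint_le[OF \<phi>] \<phi>C' that disj_m) auto
  have \<psi>_abs: "summable (\<lambda>k. norm (\<psi> m y k))" if "y \<in> elems X" for m y
    by (rule summableI_nonneg_bounded[OF norm_ge_zero \<psi>_sum[OF that]])
  have \<psi>_summable: "summable (\<psi> m y)" if "y \<in> elems X" for m y
    using summable_norm_cancel[OF \<psi>_abs[OF that]] .
  have \<psi>_dual: "(\<lambda>y. suminf (\<psi> m y)) \<in> dual_space X" for m
    unfolding dual_space_def
  proof (intro CollectI conjI ballI allI exI[of _ "1 / c"])
    fix y z assume y: "y \<in> elems X" and z: "z \<in> elems X"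
    have "\<psi> m (\<lambda>x. y x + z x) = (\<lambda>k. \<psi> m y k + \<psi> m z k)"
      using dual_add[OF \<phi> restrict_mem[OF y B(1)] restrict_mem[OF z B(1)]]
      by (simp add: \<psi>_def distrib_right fun_eq_iff)
    then show "suminf (\<psi> m (\<lambda>x. y x + z x)) = suminf (\<psi> m y) + suminf (\<psi> m z)"
      using suminf_add[OF \<psi>_summable[OF y] \<psi>_summable[OF z]] by simp
  next
    fix a y assume y: "y \<in> elems X"
    have "\<psi> m (\<lambda>x. a * y x) = (\<lambda>k. a * \<psi> m y k)"
      using dual_scale[OF \<phi> restrict_mem[OF y B(1)], of a]
      by (simp add: \<psi>_def mult.assoc fun_eq_iff)
    then show "suminf (\<psi> m (\<lambda>x. a * y x)) = a * suminf (\<psi> m y)"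
      using suminf_mult[OF \<psi>_summable[OF y]] by simp
  next
    fix y assume y: "y \<in> elems X"
    have "norm (suminf (\<psi> m y)) \<le> (\<Sum>k. norm (\<psi> m y k))" by (rule summable_norm[OF \<psi>_abs[OF y]])
    also have "\<dots> \<le> (1 / c) * nrm X y" by (rule suminf_le_const[OF \<psi>_abs[OF y] \<psi>_sum[OF y]])
    finally show "norm (suminf (\<psi> m y)) \<le> (1 / c) * nrm X y" .
  qed
  \<comment> \<open>\<open>m\<close> is fixed by the cluster point before an index n \<ge> m of the
    sequence is chosen, so the diagonal entry of \<open>h (q n)\<close> still lies in the
    tail.\<close>
  have "(\<lambda>m. suminf (\<psi> m g)) \<longlonglongrightarrow> 0"
  proof -
    have shift: "\<psi> m g = (\<lambda>k. \<psi> 0 g (k + m))" for m by (simp add: \<psi>_def fun_eq_iff)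
    have "(\<lambda>m. suminf (\<psi> m g)) = (\<lambda>m. \<Sum>k. \<psi> 0 g (k + m))"
      by (rule ext) (rule arg_cong[where f = suminf, OF shift])
    then show ?thesis using suminf_exist_split2[OF \<psi>_summable[OF gX, of 0]] by (simp only:)
  qed
  then have "\<forall>\<^sub>F m in sequentially. norm (suminf (\<psi> m g)) < \<delta> / 4"
    using \<open>0 < \<delta> / 4\<close> by (auto dest!: tendstoD[where e = "\<delta> / 4"] simp: dist_norm)
  then obtain m where m: "norm (suminf (\<psi> m g)) < \<delta> / 4" by (auto simp: eventually_sequentially)
  have "\<exists>n\<ge>m. h (q n) \<in> {y \<in> elems X. suminf (\<psi> m y) \<in> ball (suminf (\<psi> m g)) (\<delta> / 4)}"
    using gX \<open>0 < \<delta> / 4\<close> by (intro cluster openin_weak \<psi>_dual) auto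
  then obtain n where n: "m \<le> n" "norm (suminf (\<psi> m (h (q n))) - suminf (\<psi> m g)) < \<delta> / 4"
    by (auto simp: dist_norm norm_minus_commute)
  have "norm (suminf (\<psi> m (h (q n))) - \<psi> m (h (q n)) (n - m)) \<le> \<delta> / 4"
  proof (rule norm_suminf_diff_term_le[OF \<psi>_summable[OF hX]])
    fix N
    have "(\<Sum>k\<in>{..<N} - {n - m}. norm (\<psi> m (h (q n)) k)) = (\<Sum>k\<in>{..<N} - {n - m}. t (s n) (s (k + m)))"
      by (simp add: \<psi>_def t_def q_def)
    also have "\<dots> = (\<Sum>i\<in>(\<lambda>k. k + m) ` ({..<N} - {n - m}). t (s n) (s i))"
      by (subst sum.reindex) (auto simp: inj_on_def)
    also have "\<dots> \<le> (\<Sum>i\<in>{..<N + m} - {n}. t (s n) (s i))"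
      using n(1) by (intro sum_mono2) (auto simp: t_def)
    also have "\<dots> \<le> \<delta> / 4" by (rule sparse)
    finally show "(\<Sum>k\<in>{..<N} - {n - m}. norm (\<psi> m (h (q n)) k)) \<le> \<delta> / 4" .
  qed
  moreover have "\<delta> \<le> norm (\<psi> m (h (q n)) (n - m))"
    using diag[of "s n"] n(1) by (simp add: \<psi>_def q_def)
  ultimately show False
    using m n(2) \<open>0 < \<delta>\<close>
      norm_triangle_ineq2[of "\<psi> m (h (q n)) (n - m)" "suminf (\<psi> m (h (q n)))"]
      norm_triangle_ineq2[of "suminf (\<psi> m (h (q n)))" "suminf (\<psi> m g)"]
    by (simp add: norm_minus_commute)
qed

end

section \<open>Truncation sets and the lower bound\<close>

context multipliers begin

definition truncation_set :: "(real \<Rightarrow> 'k) \<Rightarrow> real set \<Rightarrow> bool" where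
  "truncation_set l A \<longleftrightarrow> A \<in> sets L \<and> emeasure L A < \<infinity> \<and> (\<exists>B. \<forall>x\<in>A. norm (l x) \<le> B)"

lemma truncation_set_Un:
  assumes "truncation_set l A" "truncation_set l B"
  shows "truncation_set l (A \<union> B)"
proof -
  obtain a b where ab: "\<And>x. x \<in> A \<Longrightarrow> norm (l x) \<le> a" "\<And>x. x \<in> B \<Longrightarrow> norm (l x) \<le> b"
    using assms unfolding truncation_set_def by blast
  have "\<forall>x\<in>A \<union> B. norm (l x) \<le> max a b" using ab by (auto simp: le_max_iff_disj)
  moreover have "emeasure L (A \<union> B) \<le> emeasure L A + emeasure L B"
    using assms by (intro emeasure_subadditive) (auto simp: truncation_set_def)
  moreover have "emeasure L A + emeasure L B < \<infinity>"
    using assms by (simp add: truncation_set_def)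
  ultimately show ?thesis
    using assms unfolding truncation_set_def by (metis sets.Un order.strict_trans1)
qed

lemma restrict_mem_M:
  assumes "l \<in> elems M" "A \<in> sets L"
  shows "(\<lambda>x. l x * indicator A x) \<in> elems M"
  by (rule ideal_mem_M[OF _ assms(1)])
    (use meas_M[OF assms(1)] assms(2) in \<open>auto simp: norm_mult indicator_def\<close>)

text \<open>A nearly optimal \<open>f\<close> for \<open>l\<close> outside \<open>G\<close> is cut
  to bounded windows on which \<open>l\<close> is bounded. By the Fatou property some cut keeps the
  norm above \<open>r\<close>. Its support is again a truncation set, so the choice can be repeated
  with a larger \<open>G\<close>.\<close>

lemma exists_almost_norming_truncated:
  assumes l: "l \<in> elems M" and G: "truncation_set l G"
    and r: "r < nrm M (\<lambda>x. l x * indicator (\<Omega> - G) x)"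
  shows "\<exists>f F. f \<in> unit_ball X \<and> truncation_set l F \<and> F \<inter> G = {}
    \<and> (\<forall>x. x \<notin> F \<longrightarrow> f x = 0) \<and> r < nrm Y (\<lambda>x. l x * f x)"
proof -
  have Gm: "G \<in> sets L" using G by (simp add: truncation_set_def)
  have Gc: "\<Omega> - G \<in> sets L" using sets.compl_sets[OF Gm] by simp
  have lG: "(\<lambda>x. l x * indicator (\<Omega> - G) x) \<in> elems M" by (rule restrict_mem_M[OF l Gc])
  have "unit_ball X \<noteq> {}" using zero_unit_ball by blast
  with r obtain f where f: "f \<in> unit_ball X" "r < nrm Y (\<lambda>x. f x * (l x * indicator (\<Omega> - G) x))"
    unfolding nrm_M by (subst (asm) less_cSUP_iff[OF _ bdd_above_M[OF lG]]) auto
  then have fX: "f \<in> elems X" "nrm X f \<le> 1" by (auto simp: unit_ball_def)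
  define F where "F k = {x\<in>\<Omega>. norm (l x) \<le> real k \<and> x \<in> {- real k..real k}} - G" for k
  have Fm: "F k \<in> sets L" for k
  proof -
    have [measurable]: "(\<lambda>x. x) \<in> borel_measurable L"
      by (intro measurable_restrict_space1 measurable_completion) simp
    have [measurable]: "l \<in> borel_measurable L" by (rule meas_M[OF l])
    have "{x\<in>space L. norm (l x) \<le> real k \<and> x \<in> {- real k..real k}} \<in> sets L"
      by measurable
    moreover have "space L = \<Omega>" by simp
    ultimately have "{x\<in>\<Omega>. norm (l x) \<le> real k \<and> x \<in> {- real k..real k}} \<in> sets L"
      by (simp only:)
    then show ?thesis unfolding F_def by (rule sets.Diff[OF _ Gm])
  qed
  have FA: "truncation_set l (F k)" for k
  proof -
    have "F k \<subseteq> \<Omega>" by (auto simp: F_def)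
    then have "emeasure L (F k) = emeasure lebesgue (F k)"
      using \<Omega> by (intro emeasure_restrict_space) auto
    also have "\<dots> \<le> emeasure lebesgue {- real k..real k}"
      by (intro emeasure_mono) (auto simp: F_def)
    also have "\<dots> < \<infinity>" by simp
    finally have "emeasure L (F k) < \<infinity>" .
    then show ?thesis unfolding truncation_set_def using Fm by (auto simp: F_def)
  qed
  have gY: "(\<lambda>x. f x * (l x * indicator (\<Omega> - G) x)) \<in> elems Y" by (rule mult_mem[OF lG fX(1)])
  have "\<exists>k. r < nrm Y (\<lambda>x. f x * (l x * indicator (\<Omega> - G) x) * indicator (F k) x)"
  proof (rule ccontr)
    assume "\<not> ?thesis"
    then have le: "nrm Y (\<lambda>x. f x * (l x * indicator (\<Omega> - G) x) * indicator (F k) x) \<le> r" for k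
      by (meson not_le)
    have lim: "AE x in L. (\<lambda>k. f x * (l x * indicator (\<Omega> - G) x) * indicator (F k) x)
        \<longlonglongrightarrow> f x * (l x * indicator (\<Omega> - G) x)"
    proof (rule AE_I2)
      fix x assume x: "x \<in> space L"
      obtain N where "max (norm (l x)) \<bar>x\<bar> \<le> real N" using real_arch_simple by blast
      then have N: "norm (l x) \<le> real N" "\<bar>x\<bar> \<le> real N" by auto
      have "f x * (l x * indicator (\<Omega> - G) x) * indicator (F k) x = f x * (l x * indicator (\<Omega> - G) x)"
        if "k \<ge> N" for k
      proof -
        have "real N \<le> real k" using that by simp
        then have "norm (l x) \<le> real k" "\<bar>x\<bar> \<le> real k" using N by linarith+
        then show ?thesis using x by (auto simp: F_def indicator_def abs_le_iff)
      qed
      then show "(\<lambda>k. f x * (l x * indicator (\<Omega> - G) x) * indicator (F k) x)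
        \<longlonglongrightarrow> f x * (l x * indicator (\<Omega> - G) x)"
        by (intro tendsto_eventually) (auto simp: eventually_sequentially)
    qed
    from Y.fatou_limit_le[OF Y.restrict_mem[OF gY Fm] le Y.meas[OF gY] lim] f(2)
    show False by simp
  qed
  then obtain k where k: "r < nrm Y (\<lambda>x. f x * (l x * indicator (\<Omega> - G) x) * indicator (F k) x)" by blast
  have eq: "(\<lambda>x. f x * (l x * indicator (\<Omega> - G) x) * indicator (F k) x) = (\<lambda>x. l x * (f x * indicator (F k) x))"
    by (auto simp: F_def indicator_def)
  show ?thesis
  proof (intro exI[of _ "\<lambda>x. f x * indicator (F k) x"] exI[of _ "F k"] conjI)
    show "(\<lambda>x. f x * indicator (F k) x) \<in> unit_ball X"
      using X.restrict_mem[OF fX(1) Fm] X.restrict_le[OF fX(1) Fm, of k] fX(2) by (simp add: unit_ball_def)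
    show "r < nrm Y (\<lambda>x. l x * (f x * indicator (F k) x))" using k unfolding eq .
    show "F k \<inter> G = {}" by (auto simp: F_def)
  qed (use FA in auto)
qed

text \<open>Makes the real supremum \<open>op_norm\<close> an upper bound for the individual
  norms.\<close>

lemma op_norm_bdd:
  assumes l: "l \<in> elems M" and W: "bounded_operator \<Omega> X Y W"
  shows "bdd_above ((\<lambda>f. nrm Y (\<lambda>x. mult_op l f x - W f x)) ` unit_ball X)"
proof -
  obtain C where C: "\<And>f. f \<in> elems X \<Longrightarrow> nrm Y (W f) \<le> C * nrm X f"
    using W unfolding bounded_operator_def by blast
  have "nrm Y (\<lambda>x. mult_op l f x - W f x) \<le> nrm M l + \<bar>C\<bar>" if f: "f \<in> unit_ball X" for f
  proof -
    have fX: "f \<in> elems X" "nrm X f \<le> 1" using f by (auto simp: unit_ball_def)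
    have "nrm Y (\<lambda>x. mult_op l f x - W f x) \<le> nrm Y (mult_op l f) + nrm Y (W f)"
      using W fX mult_mem[OF l fX(1)]
      by (intro Y.nrm_diff) (auto simp: bounded_operator_def mult_op_def mult.commute)
    moreover have "nrm Y (mult_op l f) \<le> nrm M l"
      using nrm_mult_unit_ball[OF l f] by (simp add: mult_op_def mult.commute)
    moreover have "nrm Y (W f) \<le> \<bar>C\<bar>"
    proof -
      have "C * nrm X f \<le> \<bar>C\<bar> * 1"
        using fX X.nrm_nonneg[OF fX(1)] by (intro mult_mono) auto
      then show ?thesis using C[OF fX(1)] by simp
    qed
    ultimately show ?thesis by simp
  qed
  then show ?thesis by (intro bdd_aboveI2)
qed

text \<open>If the perturbed norm \<rho> were below \<open>r\<close>, then on disjoint sets the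
  images under multiplication would have norm above some r' > \<rho>, while the perturbed operator
  accounts for at most \<rho>. The gap must come from \<open>W\<close>, against
  \<open>disjoint_parts_of_weakly_compact\<close>.\<close>

theorem op_norm_weakly_compact_perturbation:
  assumes DH: "one_DH \<Omega> Y" and l: "l \<in> elems M" and W: "weakly_compact_operator \<Omega> X Y W"
    and r: "\<And>A. truncation_set l A \<Longrightarrow> r \<le> nrm M (\<lambda>x. l x * indicator (\<Omega> - A) x)"
  shows "r \<le> op_norm X Y (\<lambda>f x. mult_op l f x - W f x)"
proof (rule ccontr)
  define \<rho> where "\<rho> = op_norm X Y (\<lambda>f x. mult_op l f x - W f x)"
  assume "\<not> ?thesis"
  then have "\<rho> < r" by (simp add: \<rho>_def)
  then obtain r' where r': "\<rho> < r'" "r' < r" using dense by blast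
  have Wb: "bounded_operator \<Omega> X Y W" using W by (simp add: weakly_compact_operator_def)
  have WY: "W f \<in> elems Y" if "f \<in> elems X" for f using Wb that by (simp add: bounded_operator_def)
  have lY: "(\<lambda>x. l x * f x) \<in> elems Y" if "f \<in> elems X" for f
    using mult_mem[OF l that] by (simp add: mult.commute)
  define P where "P G p \<longleftrightarrow> fst p \<in> unit_ball X \<and> truncation_set l (snd p) \<and> snd p \<inter> G = {}
      \<and> (\<forall>x. x \<notin> snd p \<longrightarrow> fst p x = 0) \<and> r' < nrm Y (\<lambda>x. l x * fst p x)" for G p
  define ff where "ff G = fst (SOME p. P G p)" for G
  define FF where "FF G = snd (SOME p. P G p)" for G
  have "P G (SOME p. P G p)" if G: "truncation_set l G" for G
  proof -
    have "r' < nrm M (\<lambda>x. l x * indicator (\<Omega> - G) x)" using r[OF G] r'(2) by simp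
    then have "\<exists>f F. P G (f, F)"
      unfolding P_def fst_conv snd_conv by (rule exists_almost_norming_truncated[OF l G])
    then show ?thesis by (elim exE) (rule someI)
  qed
  then have ff: "ff G \<in> unit_ball X" "truncation_set l (FF G)" "FF G \<inter> G = {}"
    "\<And>x. x \<notin> FF G \<Longrightarrow> ff G x = 0" "r' < nrm Y (\<lambda>x. l x * ff G x)" if "truncation_set l G" for G
    using that unfolding P_def ff_def FF_def by blast+
  \<comment> \<open>\<open>G n\<close> is the union of the supports used so far. It remains a
    truncation set, so the hypothesis on \<open>r\<close> applies at every stage and the next
    support avoids the earlier ones.\<close>
  define G where "G = rec_nat {} (\<lambda>n G. G \<union> FF G)"
  have G_simps: "G 0 = {}" "G (Suc n) = G n \<union> FF (G n)" for n by (simp_all add: G_def)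
  have GA: "truncation_set l (G n)" for n
  proof (induction n)
    case 0
    then show ?case by (simp add: G_simps truncation_set_def)
  next
    case (Suc n)
    then show ?case unfolding G_simps by (intro truncation_set_Un ff(2))
  qed
  define f where "f n = ff (G n)" for n
  define B where "B n = FF (G n)" for n
  have Bm: "B n \<in> sets L" for n
    using ff(2)[OF GA] by (simp add: B_def truncation_set_def)
  have incG: "incseq G" by (intro incseq_SucI) (auto simp: G_simps)
  have "B m \<inter> B n = {}" if "m < n" for m n
  proof -
    have "B m \<subseteq> G (Suc m)" by (simp add: G_simps B_def)
    also have "\<dots> \<subseteq> G n" by (rule incseqD[OF incG]) (use that in simp)
    finally show ?thesis using ff(3)[OF GA, of n] by (auto simp: B_def)
  qed
  then have disj: "disjoint_family B"
    unfolding disjoint_family_on_def by (auto simp: neq_iff)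
  have fb: "f n \<in> unit_ball X" for n using ff(1)[OF GA] by (simp add: f_def)
  have fX: "f n \<in> elems X" "nrm X (f n) \<le> 1" for n using fb by (auto simp: unit_ball_def)
  define K where "K = weak_topology Y closure_of (W ` unit_ball X)"
  have K: "compactin (weak_topology Y) K" using W by (simp add: weakly_compact_operator_def K_def)
  have WK: "W (f n) \<in> K" for n
  proof -
    have "W ` unit_ball X \<subseteq> topspace (weak_topology Y)"
      using WY by (auto simp: Y.topspace_weak unit_ball_def)
    then show ?thesis unfolding K_def using closure_of_subset fb by blast
  qed
  obtain C where C: "\<And>f. f \<in> elems X \<Longrightarrow> nrm Y (W f) \<le> C * nrm X f"
    using Wb unfolding bounded_operator_def by blast
  have H: "nrm Y (W (f n)) \<le> \<bar>C\<bar>" for n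
  proof -
    have "C * nrm X (f n) \<le> \<bar>C\<bar> * 1"
      using fX X.nrm_nonneg[OF fX(1)] by (intro mult_mono) auto
    then show ?thesis using C[OF fX(1), of n] by simp
  qed
  \<comment> \<open>On the support \<open>B n\<close> of \<open>f n\<close>, \<open>l f n\<close> is
    the sum of \<open>g\<close> and \<open>W (f n)\<close>; the first part has norm at most \<rho>
    and the whole exceeds \<open>r'\<close>.\<close>
  have big: "r' - \<rho> \<le> nrm Y (\<lambda>x. W (f n) x * indicator (B n) x)" for n
  proof -
    define g where "g x = l x * f n x - W (f n) x" for x
    have g: "g \<in> elems Y" unfolding g_def by (intro Y.diff_mem lY WY fX)
    have "nrm Y g \<le> \<rho>"
      using cSUP_upper[OF fb op_norm_bdd[OF l Wb], of n] by (simp add: \<rho>_def op_norm_def g_def[abs_def] mult_op_def)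
    then have g\<rho>: "nrm Y (\<lambda>x. g x * indicator (B n) x) \<le> \<rho>"
      using Y.restrict_le[OF g Bm] order_trans by blast
    have eq: "(\<lambda>x. l x * f n x) = (\<lambda>x. g x * indicator (B n) x + W (f n) x * indicator (B n) x)"
      using ff(4)[OF GA, of _ n] by (auto simp: g_def indicator_def f_def B_def)
    have "r' < nrm Y (\<lambda>x. l x * f n x)" using ff(5)[OF GA, of n] by (simp add: f_def)
    also have "\<dots> \<le> nrm Y (\<lambda>x. g x * indicator (B n) x) + nrm Y (\<lambda>x. W (f n) x * indicator (B n) x)"
      unfolding eq by (intro Y.nrm_add Y.restrict_mem g WY fX Bm)
    finally show ?thesis using g\<rho> by simp
  qed
  show False
    by (rule Y.disjoint_parts_of_weakly_compact[OF DH K WK Bm disj _ big H]) (use r' in simp)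
qed

end

section \<open>Weak compactness of equi-integrable sets\<close>

text \<open>Absolute continuity gives continuity at the empty set, which upgrades finite to
  countable additivity; the density is then the Radon-Nikodym derivative.\<close>

lemma positive_additive_density:
  fixes \<psi> :: "'a set \<Rightarrow> real"
  assumes "finite_measure N"
    and nonneg: "\<And>E. E \<in> sets N \<Longrightarrow> 0 \<le> \<psi> E"
    and add: "\<And>E F. E \<in> sets N \<Longrightarrow> F \<in> sets N \<Longrightarrow> E \<inter> F = {} \<Longrightarrow> \<psi> (E \<union> F) = \<psi> E + \<psi> F"
    and ac: "\<And>\<epsilon>. 0 < \<epsilon> \<Longrightarrow> \<exists>\<delta>>0. \<forall>E\<in>sets N. measure N E \<le> \<delta> \<longrightarrow> \<psi> E \<le> \<epsilon>"
  shows "\<exists>w. integrable N w \<and> (\<forall>E\<in>sets N. \<psi> E = (LINT x:E|N. w x))"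
proof -
  interpret finite_measure N by fact
  have empty: "\<psi> {} = 0" using add[of "{}" "{}"] by simp
  have pos: "positive (sets N) (\<lambda>E. ennreal (\<psi> E))" by (simp add: positive_def empty)
  have addN: "additive (sets N) (\<lambda>E. ennreal (\<psi> E))"
    by (auto simp: additive_def add nonneg)
  have ca: "countably_additive (sets N) (\<lambda>E. ennreal (\<psi> E))"
  proof (rule sets.empty_continuous_imp_countably_additive[OF pos addN])
    fix A :: "nat \<Rightarrow> 'a set" assume A: "range A \<subseteq> sets N" "decseq A" "(\<Inter>i. A i) = {}"
    have "(\<lambda>i. measure N (A i)) \<longlonglongrightarrow> measure N (\<Inter>i. A i)"
      by (rule finite_Lim_measure_decseq[OF A(1,2)])
    then have lim: "(\<lambda>i. measure N (A i)) \<longlonglongrightarrow> 0" using A(3) by simp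
    have "(\<lambda>i. \<psi> (A i)) \<longlonglongrightarrow> 0"
    proof (rule tendstoI)
      fix e :: real assume "0 < e"
      then obtain \<delta> where \<delta>: "0 < \<delta>" "\<And>E. E \<in> sets N \<Longrightarrow> measure N E \<le> \<delta> \<Longrightarrow> \<psi> E \<le> e / 2"
        using ac[of "e / 2"] by auto
      have "\<forall>\<^sub>F i in sequentially. measure N (A i) < \<delta>"
        using lim \<delta>(1) by (rule order_tendstoD)
      then show "\<forall>\<^sub>F i in sequentially. dist (\<psi> (A i)) 0 < e"
      proof eventually_elim
        case (elim i)
        have "A i \<in> sets N" using A(1) by auto
        then show ?case using \<delta>(2)[of "A i"] elim nonneg[of "A i"] \<open>0 < e\<close> by simp
      qed
    qed
    then show "(\<lambda>i. ennreal (\<psi> (A i))) \<longlonglongrightarrow> 0"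
      using tendsto_ennrealI[of "\<lambda>i. \<psi> (A i)" 0] by simp
  qed simp
  define \<nu> where "\<nu> = measure_of (space N) (sets N) (\<lambda>E. ennreal (\<psi> E))"
  have sets\<nu>: "sets \<nu> = sets N" by (simp add: \<nu>_def)
  have space\<nu>: "space \<nu> = space N" using sets\<nu> by (rule sets_eq_imp_space_eq)
  have em: "emeasure \<nu> E = ennreal (\<psi> E)" if "E \<in> sets N" for E
    unfolding \<nu>_def using that sets.space_closed by (intro emeasure_measure_of_sigma[OF _ pos ca]) (simp_all add: sets.sigma_algebra_axioms)
  have ac\<nu>: "absolutely_continuous N \<nu>"
    unfolding absolutely_continuous_def
  proof
    fix E assume E: "E \<in> null_sets N"
    then have EN: "E \<in> sets N" "measure N E = 0" by (auto simp: measure_def)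
    have "\<psi> E \<le> 0"
    proof (rule field_le_epsilon)
      show "\<psi> E \<le> 0 + \<epsilon>" if "0 < \<epsilon>" for \<epsilon>
        using ac[OF that] EN by auto
    qed
    then have "\<psi> E = 0" using nonneg[OF EN(1)] by simp
    then show "E \<in> null_sets \<nu>" using EN(1) by (auto simp: null_sets_def sets\<nu> em)
  qed
  have "finite_measure \<nu>" by (rule finite_measureI) (simp add: space\<nu> em)
  then obtain w where w: "w \<in> borel_measurable N" "AE x in N. RN_deriv N \<nu> x = ennreal (w x)" "\<And>x. 0 \<le> w x"
    using real_RN_deriv[OF _ ac\<nu> sets\<nu>] by metis
  have nn: "(\<integral>\<^sup>+x. ennreal (indicator E x * w x) \<partial>N) = ennreal (\<psi> E)" if E: "E \<in> sets N" for E
  proof -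
    have "ennreal (\<psi> E) = emeasure (density N (RN_deriv N \<nu>)) E"
      using density_RN_deriv[OF ac\<nu> sets\<nu>] em[OF E] by simp
    also have "\<dots> = (\<integral>\<^sup>+x. RN_deriv N \<nu> x * indicator E x \<partial>N)"
      using E by (intro emeasure_density) auto
    also have "\<dots> = (\<integral>\<^sup>+x. ennreal (indicator E x * w x) \<partial>N)"
      using w(2) by (intro nn_integral_cong_AE) (auto simp: indicator_def)
    finally show ?thesis by simp
  qed
  have int: "integrable N (\<lambda>x. indicator E x * w x)" if "E \<in> sets N" for E
    by (rule integrableI_nn_integral_finite[OF _ _ nn[OF that]]) (use w that nonneg in auto)
  have "\<psi> E = (LINT x:E|N. w x)" if E: "E \<in> sets N" for E
  proof -
    have "ennreal (LINT x|N. indicator E x * w x) = ennreal (\<psi> E)"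
      using nn_integral_eq_integral[OF int[OF E]] w(3) nn[OF E] by simp
    moreover have "0 \<le> (LINT x|N. indicator E x * w x)" using w(3) by (intro Bochner_Integration.integral_nonneg) auto
    ultimately show ?thesis using nonneg[OF E] by (simp add: set_lebesgue_integral_def)
  qed
  moreover have "integrable N w"
    using int[of "space N"] by (rule Bochner_Integration.integrable_cong[THEN iffD1, rotated -1]) auto
  ultimately show ?thesis by blast
qed

text \<open>Jordan decomposition: the positive variation \<open>\<pi>\<close> and the difference
  \<open>\<pi> - \<psi>\<close> are both non-negative, additive and absolutely continuous.\<close>

lemma signed_additive_density:
  fixes \<psi> :: "'a set \<Rightarrow> real"
  assumes fin: "finite_measure N"
    and add: "\<And>E F. E \<in> sets N \<Longrightarrow> F \<in> sets N \<Longrightarrow> E \<inter> F = {} \<Longrightarrow> \<psi> (E \<union> F) = \<psi> E + \<psi> F"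
    and bound: "\<And>E. E \<in> sets N \<Longrightarrow> \<bar>\<psi> E\<bar> \<le> K"
    and ac: "\<And>\<epsilon>. 0 < \<epsilon> \<Longrightarrow> \<exists>\<delta>>0. \<forall>E\<in>sets N. measure N E \<le> \<delta> \<longrightarrow> \<bar>\<psi> E\<bar> \<le> \<epsilon>"
  shows "\<exists>w. integrable N w \<and> (\<forall>E\<in>sets N. \<psi> E = (LINT x:E|N. w x))"
proof -
  interpret finite_measure N by fact
  define \<pi> where "\<pi> E = (SUP F\<in>{F\<in>sets N. F \<subseteq> E}. \<psi> F)" for E
  have empty: "\<psi> {} = 0" using add[of "{}" "{}"] by simp
  have bdd: "bdd_above (\<psi> ` {F\<in>sets N. F \<subseteq> E})" for E
    using bound by (intro bdd_aboveI2[of _ _ K]) (auto simp: abs_le_iff)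
  have le_\<pi>: "\<psi> F \<le> \<pi> E" if "F \<in> sets N" "F \<subseteq> E" for E F
    unfolding \<pi>_def using that by (intro cSUP_upper bdd) auto
  have \<pi>_least: "\<pi> E \<le> c" if "\<And>F. F \<in> sets N \<Longrightarrow> F \<subseteq> E \<Longrightarrow> \<psi> F \<le> c" for E c
    unfolding \<pi>_def using that by (intro cSUP_least) auto
  have \<pi>_nonneg: "0 \<le> \<pi> E" for E using le_\<pi>[of "{}" E] empty by simp
  have \<pi>_add: "\<pi> (E \<union> F) = \<pi> E + \<pi> F" if EF: "E \<in> sets N" "F \<in> sets N" "E \<inter> F = {}" for E F
  proof (rule antisym)
    show "\<pi> (E \<union> F) \<le> \<pi> E + \<pi> F"
    proof (rule \<pi>_least)
      fix G assume G: "G \<in> sets N" "G \<subseteq> E \<union> F"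
      have "G = (G \<inter> E) \<union> (G \<inter> F)" using G(2) by blast
      then have "\<psi> G = \<psi> (G \<inter> E) + \<psi> (G \<inter> F)"
        using add[of "G \<inter> E" "G \<inter> F"] EF G(1) by (metis Int_assoc Int_commute Int_empty_right sets.Int)
      then show "\<psi> G \<le> \<pi> E + \<pi> F"
        using le_\<pi>[of "G \<inter> E" E] le_\<pi>[of "G \<inter> F" F] EF G(1) by (simp add: sets.Int)
    qed
    have "\<pi> E \<le> \<pi> (E \<union> F) - \<psi> G" if G: "G \<in> sets N" "G \<subseteq> F" for G
    proof (rule \<pi>_least)
      fix H assume H: "H \<in> sets N" "H \<subseteq> E"
      have "\<psi> (H \<union> G) = \<psi> H + \<psi> G" using G H EF(3) by (intro add) auto
      moreover have "\<psi> (H \<union> G) \<le> \<pi> (E \<union> F)" using G H by (intro le_\<pi>) auto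
      ultimately show "\<psi> H \<le> \<pi> (E \<union> F) - \<psi> G" by simp
    qed
    then have "\<pi> F \<le> \<pi> (E \<union> F) - \<pi> E" by (intro \<pi>_least) (simp add: algebra_simps)
    then show "\<pi> E + \<pi> F \<le> \<pi> (E \<union> F)" by simp
  qed
  have \<pi>_ac: "\<exists>\<delta>>0. \<forall>E\<in>sets N. measure N E \<le> \<delta> \<longrightarrow> \<pi> E \<le> \<epsilon> \<and> \<pi> E - \<psi> E \<le> 2 * \<epsilon>" if \<epsilon>: "0 < \<epsilon>" for \<epsilon>
  proof -
    obtain \<delta> where \<delta>: "0 < \<delta>" "\<And>E. E \<in> sets N \<Longrightarrow> measure N E \<le> \<delta> \<Longrightarrow> \<bar>\<psi> E\<bar> \<le> \<epsilon>"
      using ac[OF \<epsilon>] by blast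
    have "\<pi> E \<le> \<epsilon> \<and> \<pi> E - \<psi> E \<le> 2 * \<epsilon>" if E: "E \<in> sets N" "measure N E \<le> \<delta>" for E
    proof -
      have "\<pi> E \<le> \<epsilon>"
      proof (rule \<pi>_least)
        fix F assume F: "F \<in> sets N" "F \<subseteq> E"
        then have "measure N F \<le> \<delta>" using finite_measure_mono[OF F(2) E(1)] E(2) by simp
        then show "\<psi> F \<le> \<epsilon>" using \<delta>(2)[OF F(1)] by simp
      qed
      then show ?thesis using \<delta>(2)[OF E] by simp
    qed
    then show ?thesis using \<delta>(1) by blast
  qed
  have "\<exists>w. integrable N w \<and> (\<forall>E\<in>sets N. \<pi> E = (LINT x:E|N. w x))"
  proof (intro positive_additive_density fin \<pi>_nonneg \<pi>_add)
    show "\<exists>\<delta>>0. \<forall>E\<in>sets N. measure N E \<le> \<delta> \<longrightarrow> \<pi> E \<le> \<epsilon>" if "0 < \<epsilon>" for \<epsilon>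
      using \<pi>_ac[OF that] by blast
  qed
  then obtain w1 where w1: "integrable N w1" "\<And>E. E \<in> sets N \<Longrightarrow> \<pi> E = (LINT x:E|N. w1 x)" by blast
  have "\<exists>w. integrable N w \<and> (\<forall>E\<in>sets N. \<pi> E - \<psi> E = (LINT x:E|N. w x))"
  proof (intro positive_additive_density fin)
    show "0 \<le> \<pi> E - \<psi> E" if "E \<in> sets N" for E using le_\<pi>[OF that, of E] by simp
    show "\<pi> (E \<union> F) - \<psi> (E \<union> F) = \<pi> E - \<psi> E + (\<pi> F - \<psi> F)"
      if "E \<in> sets N" "F \<in> sets N" "E \<inter> F = {}" for E F using \<pi>_add[OF that] add[OF that] by simp
    show "\<exists>\<delta>>0. \<forall>E\<in>sets N. measure N E \<le> \<delta> \<longrightarrow> \<pi> E - \<psi> E \<le> \<epsilon>" if "0 < \<epsilon>" for \<epsilon>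
      using \<pi>_ac[of "\<epsilon> / 2"] that by auto
  qed
  then obtain w2 where w2: "integrable N w2" "\<And>E. E \<in> sets N \<Longrightarrow> \<pi> E - \<psi> E = (LINT x:E|N. w2 x)" by blast
  have "\<psi> E = (LINT x:E|N. w1 x - w2 x)" if E: "E \<in> sets N" for E
  proof -
    have "set_integrable N E w" if "integrable N w" for w :: "'a \<Rightarrow> real"
      unfolding set_integrable_def by (rule integrable_mult_indicator[OF E that])
    then have "(LINT x:E|N. w1 x - w2 x) = (LINT x:E|N. w1 x) - (LINT x:E|N. w2 x)"
      using w1(1) w2(1) by (intro set_integral_diff)
    then show ?thesis using w1(2)[OF E] w2(2)[OF E] by simp
  qed
  then show ?thesis using w1(1) w2(1) by (intro exI[of _ "\<lambda>x. w1 x - w2 x"]) auto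
qed

lemma vector_additive_density:
  fixes \<psi> :: "'a set \<Rightarrow> 'k::{real_normed_field, euclidean_space}"
  assumes fin: "finite_measure N"
    and add: "\<And>E F. E \<in> sets N \<Longrightarrow> F \<in> sets N \<Longrightarrow> E \<inter> F = {} \<Longrightarrow> \<psi> (E \<union> F) = \<psi> E + \<psi> F"
    and bound: "\<And>E. E \<in> sets N \<Longrightarrow> norm (\<psi> E) \<le> K"
    and ac: "\<And>\<epsilon>. 0 < \<epsilon> \<Longrightarrow> \<exists>\<delta>>0. \<forall>E\<in>sets N. measure N E \<le> \<delta> \<longrightarrow> norm (\<psi> E) \<le> \<epsilon>"
  shows "\<exists>w. integrable N w \<and> (\<forall>E\<in>sets N. \<psi> E = (LINT x:E|N. w x))"
proof -
  have "\<exists>w. integrable N w \<and> (\<forall>E\<in>sets N. \<psi> E \<bullet> b = (LINT x:E|N. w x))" if b: "b \<in> Basis" for b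
  proof (rule signed_additive_density[OF fin])
    have le: "\<bar>\<psi> E \<bullet> b\<bar> \<le> norm (\<psi> E)" for E using b by (rule Basis_le_norm)
    show "\<psi> (E \<union> F) \<bullet> b = \<psi> E \<bullet> b + \<psi> F \<bullet> b" if "E \<in> sets N" "F \<in> sets N" "E \<inter> F = {}" for E F
      using add[OF that] by (simp add: inner_add_left)
    show "\<bar>\<psi> E \<bullet> b\<bar> \<le> K" if "E \<in> sets N" for E using le[of E] bound[OF that] by simp
    show "\<exists>\<delta>>0. \<forall>E\<in>sets N. measure N E \<le> \<delta> \<longrightarrow> \<bar>\<psi> E \<bullet> b\<bar> \<le> \<epsilon>" if "0 < \<epsilon>" for \<epsilon>
      using ac[OF that] le order_trans by meson
  qed
  then obtain w where w: "\<And>b. b \<in> Basis \<Longrightarrow> integrable N (w b)"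
    "\<And>b E. b \<in> Basis \<Longrightarrow> E \<in> sets N \<Longrightarrow> \<psi> E \<bullet> b = (LINT x:E|N. w b x)"
    by metis
  define W where "W x = (\<Sum>b\<in>Basis. w b x *\<^sub>R b)" for x
  have "\<psi> E = (LINT x:E|N. W x)" if E: "E \<in> sets N" for E
  proof -
    have i: "integrable N (\<lambda>x. indicator E x *\<^sub>R w b x)" if "b \<in> Basis" for b
      using w(1)[OF that] E by (intro integrable_mult_indicator)
    have "(LINT x:E|N. W x) = (LINT x|N. (\<Sum>b\<in>Basis. (indicator E x *\<^sub>R w b x) *\<^sub>R b))"
      by (simp add: set_lebesgue_integral_def W_def scaleR_sum_right)
    also have "\<dots> = (\<Sum>b\<in>Basis. (LINT x|N. (indicator E x *\<^sub>R w b x) *\<^sub>R b))"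
      using i by (intro Bochner_Integration.integral_sum integrable_scaleR_left) auto
    also have "\<dots> = (\<Sum>b\<in>Basis. (\<psi> E \<bullet> b) *\<^sub>R b)"
      using i w(2)[OF _ E] by (intro sum.cong) (simp_all add: set_lebesgue_integral_def)
    also have "\<dots> = \<psi> E" by (rule euclidean_representation)
    finally show ?thesis by simp
  qed
  moreover have "integrable N W" unfolding W_def using w(1) by (intro Bochner_Integration.integrable_sum integrable_scaleR_left) auto
  ultimately show ?thesis by blast
qed

text \<open>Bounded measurable functions are uniform limits of finite-valued ones.\<close>

lemma bounded_functional_eq_0:
  fixes \<Lambda> :: "('a \<Rightarrow> 'k) \<Rightarrow> 'k::{real_normed_field, euclidean_space}"
  assumes add: "\<And>v w b. v \<in> borel_measurable N \<Longrightarrow> w \<in> borel_measurable N \<Longrightarrow>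
      (\<And>x. norm (v x) \<le> b) \<Longrightarrow> (\<And>x. norm (w x) \<le> b) \<Longrightarrow> \<Lambda> (\<lambda>x. v x + w x) = \<Lambda> v + \<Lambda> w"
    and scale: "\<And>c v b. v \<in> borel_measurable N \<Longrightarrow> (\<And>x. norm (v x) \<le> b) \<Longrightarrow> \<Lambda> (\<lambda>x. c * v x) = c * \<Lambda> v"
    and bound: "\<And>v b b'. v \<in> borel_measurable N \<Longrightarrow> 0 \<le> b \<Longrightarrow> (\<And>x. norm (v x) \<le> b') \<Longrightarrow>
      (\<And>x. x \<in> space N \<Longrightarrow> norm (v x) \<le> b) \<Longrightarrow> norm (\<Lambda> v) \<le> C * b"
    and ind: "\<And>E. E \<in> sets N \<Longrightarrow> \<Lambda> (\<lambda>x. indicator E x) = 0"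
    and v: "v \<in> borel_measurable N" "\<And>x. norm (v x) \<le> B" and C: "0 \<le> C"
  shows "\<Lambda> v = 0"
proof -
  have B0: "0 \<le> B" using v(2) norm_ge_zero order_trans by blast
  have zero: "\<Lambda> (\<lambda>x. 0) = 0" using ind[of "{}"] by simp
  have le: "norm (\<Lambda> v) \<le> C * (real DIM('k) * \<delta>)" if \<delta>: "0 < \<delta>" for \<delta>
  proof -
    \<comment> \<open>Each coordinate is rounded down to a multiple of \<delta>. Since
      \<open>v\<close> is bounded, only finitely many rounded values occur.\<close>
    define \<rho> where "\<rho> y = (\<Sum>b\<in>Basis. (\<delta> * real_of_int \<lfloor>(y \<bullet> b) / \<delta>\<rfloor>) *\<^sub>R b)" for y :: 'k
    have \<rho>m: "\<rho> \<in> borel_measurable borel" unfolding \<rho>_def by measurable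
    have near: "norm (y - \<rho> y) \<le> real DIM('k) * \<delta>" for y
    proof -
      have "y - \<rho> y = (\<Sum>b\<in>Basis. (y \<bullet> b - \<delta> * real_of_int \<lfloor>(y \<bullet> b) / \<delta>\<rfloor>) *\<^sub>R b)"
        unfolding \<rho>_def scaleR_left_diff_distrib sum_subtractf euclidean_representation ..
      also have "norm \<dots> \<le> (\<Sum>b\<in>(Basis::'k set). \<delta>)"
      proof (rule sum_norm_le)
        fix b :: 'k assume b: "b \<in> Basis"
        have "real_of_int \<lfloor>(y \<bullet> b) / \<delta>\<rfloor> * \<delta> \<le> y \<bullet> b"
          using of_int_floor_le[of "(y \<bullet> b) / \<delta>"] \<delta> by (subst (asm) pos_le_divide_eq)
        moreover have "(y \<bullet> b) / \<delta> < real_of_int \<lfloor>(y \<bullet> b) / \<delta>\<rfloor> + 1" by linarith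
        then have "y \<bullet> b < (real_of_int \<lfloor>(y \<bullet> b) / \<delta>\<rfloor> + 1) * \<delta>"
          using \<delta> by (subst (asm) pos_divide_less_eq)
        ultimately have "\<delta> * real_of_int \<lfloor>(y \<bullet> b) / \<delta>\<rfloor> \<le> y \<bullet> b" "y \<bullet> b < \<delta> * real_of_int \<lfloor>(y \<bullet> b) / \<delta>\<rfloor> + \<delta>"
          by (simp_all add: algebra_simps)
        then show "norm ((y \<bullet> b - \<delta> * real_of_int \<lfloor>(y \<bullet> b) / \<delta>\<rfloor>) *\<^sub>R b) \<le> \<delta>" using b by simp
      qed
      finally show ?thesis by simp
    qed
    define R where "R = (\<lambda>x. \<rho> (v x)) ` space N"
    define M where "M = \<lceil>B / \<delta>\<rceil>"
    have "finite R"
    proof (rule finite_subset)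
      show "R \<subseteq> (\<lambda>g. \<Sum>b\<in>Basis. (\<delta> * real_of_int (g b)) *\<^sub>R b) ` (PiE Basis (\<lambda>_. {-M - 1..M}))"
      proof
        fix y assume "y \<in> R"
        then obtain x where x: "y = \<rho> (v x)" by (auto simp: R_def)
        have "\<lfloor>(v x \<bullet> b) / \<delta>\<rfloor> \<in> {-M - 1..M}" if b: "b \<in> Basis" for b
        proof -
          have "\<bar>v x \<bullet> b\<bar> \<le> B" using Basis_le_norm[OF b, of "v x"] v(2)[of x] by simp
          then have "\<bar>(v x \<bullet> b) / \<delta>\<bar> \<le> B / \<delta>" using \<delta> by (simp add: divide_right_mono)
          also have "B / \<delta> \<le> real_of_int M" by (simp add: M_def)
          finally have "\<lfloor>(v x \<bullet> b) / \<delta>\<rfloor> \<le> M" "- M - 1 \<le> \<lfloor>(v x \<bullet> b) / \<delta>\<rfloor>" by linarith+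
          then show ?thesis by simp
        qed
        then have "restrict (\<lambda>b. \<lfloor>(v x \<bullet> b) / \<delta>\<rfloor>) Basis \<in> PiE Basis (\<lambda>_. {-M - 1..M})" by auto
        moreover have "y = (\<Sum>b\<in>Basis. (\<delta> * real_of_int (restrict (\<lambda>b. \<lfloor>(v x \<bullet> b) / \<delta>\<rfloor>) Basis b)) *\<^sub>R b)"
          by (simp add: x \<rho>_def)
        ultimately show "y \<in> (\<lambda>g. \<Sum>b\<in>Basis. (\<delta> * real_of_int (g b)) *\<^sub>R b) ` (PiE Basis (\<lambda>_. {-M - 1..M}))" by blast
      qed
    qed (intro finite_imageI finite_PiE, auto)
    define E where "E c = {x\<in>space N. \<rho> (v x) = c}" for c
    have Em: "E c \<in> sets N" for c
    proof -
      have "(\<lambda>x. \<rho> (v x)) \<in> borel_measurable N" using v(1) \<rho>m by (rule measurable_compose)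
      then show ?thesis unfolding E_def by measurable
    qed
    have bs: "(\<lambda>x. \<Sum>c\<in>Q. c * indicator (E c) x) \<in> borel_measurable N \<and>
        (\<forall>x. norm (\<Sum>c\<in>Q. c * indicator (E c) x) \<le> (\<Sum>c\<in>Q. norm c))" for Q
    proof (intro conjI allI)
      show "norm (\<Sum>c\<in>Q. c * indicator (E c) x) \<le> (\<Sum>c\<in>Q. norm c)" for x
        by (intro sum_norm_le) (auto simp: indicator_def)
      show "(\<lambda>x. \<Sum>c\<in>Q. c * indicator (E c) x) \<in> borel_measurable N"
        by (intro borel_measurable_sum borel_measurable_times borel_measurable_const borel_measurable_indicator Em)
    qed
    have step0: "\<Lambda> (\<lambda>x. \<Sum>c\<in>Q. c * indicator (E c) x) = 0" if "finite Q" for Q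
      using that
    proof (induction Q rule: finite_induct)
      case (insert c Q)
      have 1: "(\<lambda>x. c * indicator (E c) x) \<in> borel_measurable N" using Em by auto
      have "\<Lambda> (\<lambda>x. c * indicator (E c) x + (\<Sum>c\<in>Q. c * indicator (E c) x))
          = \<Lambda> (\<lambda>x. c * indicator (E c) x) + \<Lambda> (\<lambda>x. \<Sum>c\<in>Q. c * indicator (E c) x)"
      proof (rule add[OF 1, where b = "norm c + (\<Sum>c\<in>Q. norm c)"])
        show "norm (c * indicator (E c) x) \<le> norm c + (\<Sum>c\<in>Q. norm c)" for x
          by (auto simp: indicator_def sum_nonneg)
        show "norm (\<Sum>c\<in>Q. c * indicator (E c) x) \<le> norm c + (\<Sum>c\<in>Q. norm c)" for x
          using bs[of Q] by (simp add: add_increasing)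
      qed (use bs in blast)
      also have "\<Lambda> (\<lambda>x. c * indicator (E c) x) = c * \<Lambda> (\<lambda>x. indicator (E c) x)"
        using Em by (intro scale[where b = 1]) (auto simp: indicator_def)
      also have "\<Lambda> (\<lambda>x. indicator (E c) x) = 0" by (rule ind[OF Em])
      also have "\<Lambda> (\<lambda>x. \<Sum>c\<in>Q. c * indicator (E c) x) = 0" by (rule insert.IH)
      finally have "\<Lambda> (\<lambda>x. c * indicator (E c) x + (\<Sum>c\<in>Q. c * indicator (E c) x)) = 0" by simp
      then show ?case unfolding sum.insert[OF insert.hyps] .
    qed (simp add: zero)
    define u where "u x = (\<Sum>c\<in>R. c * indicator (E c) x)" for x
    have um: "u \<in> borel_measurable N" and ub: "\<And>x. norm (u x) \<le> (\<Sum>c\<in>R. norm c)"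
      using bs[of R] unfolding u_def by blast+
    have u\<rho>: "u x = \<rho> (v x)" if x: "x \<in> space N" for x
    proof -
      have "disjoint_family_on E R" by (auto simp: disjoint_family_on_def E_def)
      then show ?thesis unfolding u_def
        using sum_indicator_disjoint[OF \<open>finite R\<close>, of E "\<rho> (v x)" x "\<lambda>c. c"] x by (auto simp: R_def E_def)
    qed
    have "\<Lambda> (\<lambda>x. v x + (- 1) * u x) = \<Lambda> v + \<Lambda> (\<lambda>x. (- 1) * u x)"
    proof (rule add[OF v(1), where b = "B + (\<Sum>c\<in>R. norm c)"])
      show "(\<lambda>x. (- 1) * u x) \<in> borel_measurable N" using um by simp
      show "norm (v x) \<le> B + (\<Sum>c\<in>R. norm c)" for x using v(2)[of x] by (simp add: add_increasing2 sum_nonneg)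
      show "norm ((- 1) * u x) \<le> B + (\<Sum>c\<in>R. norm c)" for x using ub[of x] B0 by simp
    qed
    also have "\<Lambda> (\<lambda>x. (- 1) * u x) = (- 1) * \<Lambda> u" by (rule scale[OF um ub])
    also have "\<Lambda> u = 0" unfolding u_def by (rule step0[OF \<open>finite R\<close>])
    finally have "\<Lambda> v = \<Lambda> (\<lambda>x. v x - u x)" by simp
    \<comment> \<open>\<open>u\<close> is the rounding of \<open>v\<close> on \<open>space N\<close>
      only; elsewhere the difference is merely bounded. This is why the hypothesis
      \<open>bound\<close> separates a global bound from one on \<open>space N\<close>.\<close>
    also have "norm \<dots> \<le> C * (real DIM('k) * \<delta>)"
    proof (rule bound)
      show "(\<lambda>x. v x - u x) \<in> borel_measurable N" using v(1) um by simp
      show "0 \<le> real DIM('k) * \<delta>" using \<delta> by simp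
      show "norm (v x - u x) \<le> B + (\<Sum>c\<in>R. norm c)" for x
        using norm_triangle_ineq4[of "v x" "u x"] v(2)[of x] ub[of x] by linarith
      show "norm (v x - u x) \<le> real DIM('k) * \<delta>" if "x \<in> space N" for x using u\<rho>[OF that] near by simp
    qed
    finally show ?thesis .
  qed
  have "norm (\<Lambda> v) \<le> 0"
  proof (rule field_le_epsilon)
    fix e :: real assume e: "0 < e"
    \<comment> \<open>Adding 1 to \<open>C\<close> avoids division by zero when
      \<open>C = 0\<close>.\<close>
    define \<delta> where "\<delta> = e / ((C + 1) * real DIM('k))"
    have "0 < \<delta>" using e C by (simp add: \<delta>_def DIM_positive)
    moreover have "C * (real DIM('k) * \<delta>) = C / (C + 1) * e"
      by (simp add: \<delta>_def DIM_positive)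
    moreover have "C / (C + 1) * e \<le> 1 * e" using C e by (intro mult_right_mono) auto
    ultimately show "norm (\<Lambda> v) \<le> 0 + e" using le[of \<delta>] by simp
  qed
  then show ?thesis by simp
qed

section \<open>The weak topology inside a product of scalar fields\<close>

context koethe begin

text \<open>Evaluation places the space in the product of the scalars over its dual, where
  Tychonoff's theorem is available. It suffices to check the generating sets, since pullbacks of
  open sets form a topology.\<close>

lemma openin_weak_pullback:
  assumes "openin (weak_topology X) U"
  shows "\<exists>V. openin (product_topology (\<lambda>_. euclidean) (dual_space X)) V \<and>
    U = (\<lambda>f. restrict (\<lambda>\<phi>. \<phi> f) (dual_space X)) -` V \<inter> elems X"
proof -
  define T where "T = product_topology (\<lambda>_. euclidean :: 'k topology) (dual_space X)"
  define e where "e f = restrict (\<lambda>\<phi>. \<phi> f) (dual_space X)" for f :: "real \<Rightarrow> 'k"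
  have "openin (pullback_topology (elems X) e T) U"
  proof -
    have gen: "generate_topology_on {{f \<in> elems X. \<phi> f \<in> U} | \<phi> U. \<phi> \<in> dual_space X \<and> open U} U"
      using assms unfolding weak_topology_def openin_topology_generated_by_iff .
    have basis: "\<forall>s\<in>{{f \<in> elems X. \<phi> f \<in> U} | \<phi> U. \<phi> \<in> dual_space X \<and> open U}. openin (pullback_topology (elems X) e T) s"
    proof
      fix s assume "s \<in> {{f \<in> elems X. \<phi> f \<in> U} | \<phi> U. \<phi> \<in> dual_space X \<and> open U}"
      then obtain \<phi> U where s: "s = {f \<in> elems X. \<phi> f \<in> U}" and \<phi>: "\<phi> \<in> dual_space X" and U: "open U" by blast
      have "continuous_map T euclidean (\<lambda>z. z \<phi>)"
        unfolding T_def using \<phi> by (rule continuous_map_product_projection)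
      then have "openin T {z \<in> topspace T. z \<phi> \<in> U}"
        using U by (auto intro: openin_continuous_map_preimage)
      moreover have "{f \<in> elems X. \<phi> f \<in> U} = e -` {z \<in> topspace T. z \<phi> \<in> U} \<inter> elems X"
        using \<phi> by (auto simp: e_def T_def)
      ultimately show "openin (pullback_topology (elems X) e T) s"
        unfolding openin_pullback_topology s by blast
    qed
    show ?thesis by (rule generate_topology_on_coarsest[OF istopology_openin bspec[OF basis] gen])
  qed
  then show ?thesis unfolding openin_pullback_topology T_def e_def .
qed

text \<open>The evaluations of \<open>S\<close> lie in a product of balls, so their closure
  \<open>C\<close> is compact, and \<open>limits\<close> says that every point of \<open>C\<close>
  is the evaluation at an element. Evaluation identifies functions that agree almost everywhere, so
  compactness is pulled back by transferring covers and not by a homeomorphism.\<close>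

lemma compactin_weak_closure:
  assumes S: "S \<subseteq> elems X" and bounded: "\<And>f. f \<in> S \<Longrightarrow> nrm X f \<le> H"
    and limits: "\<And>z. (\<And>\<Phi> \<epsilon>. finite \<Phi> \<Longrightarrow> \<Phi> \<subseteq> dual_space X \<Longrightarrow> 0 < \<epsilon> \<Longrightarrow> \<exists>u\<in>S. \<forall>\<phi>\<in>\<Phi>. norm (z \<phi> - \<phi> u) < \<epsilon>)
      \<Longrightarrow> \<exists>h\<in>elems X. \<forall>\<phi>\<in>dual_space X. z \<phi> = \<phi> h"
  shows "compactin (weak_topology X) (weak_topology X closure_of S)"
proof -
  define T where "T = product_topology (\<lambda>_. euclidean :: 'k topology) (dual_space X)"
  define e where "e f = restrict (\<lambda>\<phi>. \<phi> f) (dual_space X)" for f :: "real \<Rightarrow> 'k"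
  define C where "C = T closure_of (e ` S)"
  have topT: "topspace T = PiE (dual_space X) (\<lambda>_. UNIV)" by (simp add: T_def)
  have "\<exists>c. \<forall>u\<in>S. norm (\<phi> u) \<le> c" if \<phi>: "\<phi> \<in> dual_space X" for \<phi>
  proof -
    obtain D where D: "0 \<le> D" "\<And>f. f \<in> elems X \<Longrightarrow> norm (\<phi> f) \<le> D * nrm X f" using dual_bound[OF \<phi>] by blast
    have "norm (\<phi> u) \<le> D * H" if "u \<in> S" for u
      using D(2)[of u] mult_left_mono[OF bounded[OF that] D(1)] S that by force
    then show ?thesis by blast
  qed
  then obtain c where c: "\<And>\<phi> u. \<phi> \<in> dual_space X \<Longrightarrow> u \<in> S \<Longrightarrow> norm (\<phi> u) \<le> c \<phi>" by metis
  define Q where "Q = PiE (dual_space X) (\<lambda>\<phi>. cball (0::'k) (c \<phi>))"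
  have "compactin T Q" unfolding T_def Q_def by (subst compactin_PiE) auto
  moreover have "closedin T Q" unfolding T_def Q_def by (subst closedin_product_topology) auto
  moreover have "e ` S \<subseteq> Q" using c by (auto simp: Q_def e_def)
  ultimately have C: "compactin T C"
    unfolding C_def by (meson closed_compactin closedin_closure_of closure_of_minimal)
  have lift: "\<exists>h\<in>elems X. z = e h" if z: "z \<in> C" for z
  proof -
    have zT: "z \<in> topspace T" and near: "\<And>V. z \<in> V \<Longrightarrow> openin T V \<Longrightarrow> \<exists>y\<in>e ` S. y \<in> V"
      using z unfolding C_def in_closure_of by blast+
    have "\<exists>h\<in>elems X. \<forall>\<phi>\<in>dual_space X. z \<phi> = \<phi> h"
    proof (rule limits)
      fix \<Phi> and \<epsilon> :: real assume \<Phi>: "finite \<Phi>" "\<Phi> \<subseteq> dual_space X" and \<epsilon>: "0 < \<epsilon>"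
      \<comment> \<open>A basic open box restricts finitely many coordinates; hence the finite sets
        \<Phi> in \<open>limits\<close>.\<close>
      define V where "V = PiE (dual_space X) (\<lambda>\<phi>. if \<phi> \<in> \<Phi> then ball (z \<phi>) \<epsilon> else UNIV)"
      have "{\<phi> \<in> dual_space X. (if \<phi> \<in> \<Phi> then ball (z \<phi>) \<epsilon> else UNIV) \<noteq> (UNIV :: 'k set)} \<subseteq> \<Phi>" by auto
      then have "finite {\<phi> \<in> dual_space X. (if \<phi> \<in> \<Phi> then ball (z \<phi>) \<epsilon> else UNIV) \<noteq> (UNIV :: 'k set)}"
        using \<Phi>(1) finite_subset by blast
      then have "openin T V" unfolding V_def T_def openin_PiE_gen by auto
      moreover have "z \<in> V" using zT \<epsilon> by (auto simp: V_def topT PiE_def)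
      ultimately obtain u where u: "u \<in> S" "e u \<in> V" using near by blast
      have "norm (z \<phi> - \<phi> u) < \<epsilon>" if "\<phi> \<in> \<Phi>" for \<phi>
      proof -
        have "\<phi> \<in> dual_space X" using that \<Phi>(2) by blast
        then have "e u \<phi> \<in> ball (z \<phi>) \<epsilon>" using u(2) that unfolding V_def by (auto dest!: PiE_mem[of _ _ _ \<phi>])
        then show ?thesis using \<open>\<phi> \<in> dual_space X\<close> by (simp add: e_def dist_norm)
      qed
      then show "\<exists>u\<in>S. \<forall>\<phi>\<in>\<Phi>. norm (z \<phi> - \<phi> u) < \<epsilon>" using u(1) by blast
    qed
    then obtain h where h: "h \<in> elems X" "\<And>\<phi>. \<phi> \<in> dual_space X \<Longrightarrow> z \<phi> = \<phi> h" by blast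
    have "z = e h"
    proof
      fix \<phi> show "z \<phi> = e h \<phi>"
        using h(2)[of \<phi>] zT by (cases "\<phi> \<in> dual_space X") (auto simp: e_def topT PiE_def extensional_def)
    qed
    then show ?thesis using h(1) by blast
  qed
  have cont: "continuous_map (weak_topology X) T e"
    unfolding T_def continuous_map_componentwise
  proof (intro conjI ballI)
    show "e ` topspace (weak_topology X) \<subseteq> extensional (dual_space X)" by (auto simp: e_def)
    fix \<phi> assume \<phi>: "\<phi> \<in> dual_space X"
    show "continuous_map (weak_topology X) euclidean (\<lambda>f. e f \<phi>)"
      unfolding continuous_map_def
      using openin_weak[OF \<phi>] \<phi> by (auto simp: topspace_weak e_def)
  qed
  show ?thesis
    unfolding compactin_def
  proof (intro conjI allI impI)
    show "weak_topology X closure_of S \<subseteq> topspace (weak_topology X)" by (rule closure_of_subset_topspace)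
    fix \<U> assume \<U>: "Ball \<U> (openin (weak_topology X)) \<and> weak_topology X closure_of S \<subseteq> \<Union>\<U>"
    have "\<exists>V. openin T V \<and> U = e -` V \<inter> elems X" if "U \<in> \<U>" for U
      using openin_weak_pullback[of U] that \<U> unfolding T_def e_def[abs_def] by blast
    then obtain V where V: "\<And>U. U \<in> \<U> \<Longrightarrow> openin T (V U)" "\<And>U. U \<in> \<U> \<Longrightarrow> U = e -` V U \<inter> elems X" by metis
    \<comment> \<open>A preimage \<open>h\<close> of a point of \<open>C\<close> lies in the weak
      closure of \<open>S\<close>, because weakly open sets are pullbacks. So a cover of the closure
      lifts to a cover of \<open>C\<close>.\<close>
    have "C \<subseteq> \<Union>(V ` \<U>)"
    proof
      fix z assume z: "z \<in> C"
      obtain h where h: "h \<in> elems X" "z = e h" using lift[OF z] by blast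
      have "h \<in> weak_topology X closure_of S"
        unfolding in_closure_of topspace_weak
      proof (intro conjI allI impI h(1))
        fix U assume U: "h \<in> U \<and> openin (weak_topology X) U"
        then obtain V' where V': "openin T V'" "U = e -` V' \<inter> elems X"
          using openin_weak_pullback[of U] unfolding T_def e_def[abs_def] by blast
        then have "z \<in> V'" using U h(2) by blast
        then obtain y where "y \<in> e ` S" "y \<in> V'" using z V'(1) unfolding C_def in_closure_of by blast
        then show "\<exists>y. y \<in> S \<and> y \<in> U" using V'(2) S by blast
      qed
      then obtain U where "U \<in> \<U>" "h \<in> U" using \<U> by blast
      then show "z \<in> \<Union>(V ` \<U>)" using V(2) h(2) by blast
    qed
    then obtain \<F>' where \<F>': "finite \<F>'" "\<F>' \<subseteq> V ` \<U>" "C \<subseteq> \<Union>\<F>'"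
      using compactinD[OF C, of "V ` \<U>"] V(1) by blast
    then obtain \<F> where \<F>: "finite \<F>" "\<F> \<subseteq> \<U>" "\<F>' = V ` \<F>" using finite_subset_image by meson
    have "weak_topology X closure_of S \<subseteq> \<Union>\<F>"
    proof
      fix h assume h: "h \<in> weak_topology X closure_of S"
      then have "e h \<in> C"
        using continuous_map_image_closure_subset[OF cont, of S] unfolding C_def by blast
      then obtain U where U: "U \<in> \<F>" "e h \<in> V U" using \<F>' \<F> by blast
      have "h \<in> elems X" using h closure_of_subset_topspace[of "weak_topology X" S] by (auto simp: topspace_weak)
      then have "h \<in> U" using U V(2) \<F>(2) by blast
      then show "h \<in> \<Union>\<F>" using U by blast
    qed
    then show "\<exists>\<F>. finite \<F> \<and> \<F> \<subseteq> \<U> \<and> weak_topology X closure_of S \<subseteq> \<Union>\<F>" using \<F> by blast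
  qed
qed

end

lemma integrable_mult_bounded:
  fixes f v :: "'a \<Rightarrow> 'k::{real_normed_field, euclidean_space}"
  assumes f: "integrable N f" and v: "v \<in> borel_measurable N" "\<And>x. x \<in> space N \<Longrightarrow> norm (v x) \<le> B"
  shows "integrable N (\<lambda>x. f x * v x)" and "norm (LINT x|N. f x * v x) \<le> B * (LINT x|N. norm (f x))"
proof -
  have le: "norm (f x * v x) \<le> B * norm (f x)" if "x \<in> space N" for x
    using mult_left_mono[OF v(2)[OF that] norm_ge_zero[of "f x"]] by (simp add: norm_mult mult.commute)
  have fB: "integrable N (\<lambda>x. B * norm (f x))" using f by simp
  show i: "integrable N (\<lambda>x. f x * v x)"
  proof (rule Bochner_Integration.integrable_bound[OF fB])
    show "(\<lambda>x. f x * v x) \<in> borel_measurable N"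
      using borel_measurable_integrable[OF f] v(1) by (rule borel_measurable_times)
    show "AE x in N. norm (f x * v x) \<le> norm (B * norm (f x))"
    proof (rule AE_I2)
      show "norm (f x * v x) \<le> norm (B * norm (f x))" if "x \<in> space N" for x
        using le[OF that] by (metis abs_ge_self order_trans real_norm_def)
    qed
  qed
  have "norm (LINT x|N. f x * v x) \<le> (LINT x|N. norm (f x * v x))"
    by (rule integral_norm_bound)
  also have "\<dots> \<le> (LINT x|N. B * norm (f x))"
    using i le by (intro integral_mono fB) auto
  also have "\<dots> = B * (LINT x|N. norm (f x))" by simp
  finally show "norm (LINT x|N. f x * v x) \<le> B * (LINT x|N. norm (f x))" .
qed

text \<open>The superlevel sets decrease to the empty set, and finite measure of \<open>A\<close>
  gives continuity from above. Later cuts of functions and densities at a level leave a negligible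
  set for this reason.\<close>

lemma exists_small_superlevel:
  fixes g :: "'a \<Rightarrow> 'k::{real_normed_field, euclidean_space}"
  assumes g: "g \<in> borel_measurable N" and A: "A \<in> sets N" "emeasure N A < \<infinity>" and "0 < \<delta>"
  shows "\<exists>n::nat. emeasure N {x\<in>A. real n < norm (g x)} \<le> ennreal \<delta>"
proof -
  define E where "E n = A \<inter> {x\<in>space N. real n < norm (g x)}" for n
  have Em: "E n \<in> sets N" for n
  proof -
    note g [measurable]
    have "{x\<in>space N. real n < norm (g x)} \<in> sets N" by measurable
    then show ?thesis unfolding E_def using A(1) by (rule sets.Int[rotated])
  qed
  have "(\<lambda>n. emeasure N (E n)) \<longlonglongrightarrow> emeasure N (\<Inter>n. E n)"
  proof (rule Lim_emeasure_decseq)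
    show "decseq E" by (auto simp: decseq_def E_def)
    have "emeasure N (E n) \<le> emeasure N A" for n by (intro emeasure_mono A) (auto simp: E_def)
    then show "emeasure N (E n) \<noteq> \<infinity>" for n using A(2) by (metis less_irrefl order.strict_trans1)
  qed (use Em in auto)
  moreover have "(\<Inter>n. E n) = {}"
  proof -
    have "\<exists>n. \<not> real n < norm (g x)" for x
      using real_arch_simple[of "norm (g x)"] by (auto simp: not_less)
    then show ?thesis by (auto simp: E_def)
  qed
  ultimately have "(\<lambda>n. emeasure N (E n)) \<longlonglongrightarrow> 0" by simp
  then have "\<forall>\<^sub>F n in sequentially. emeasure N (E n) < ennreal \<delta>"
    by (rule order_tendstoD) (use \<open>0 < \<delta>\<close> in simp)
  then obtain n where "emeasure N (E n) < ennreal \<delta>" by (auto simp: eventually_sequentially)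
  moreover have "E n = {x\<in>A. real n < norm (g x)}"
    using sets.sets_into_space[OF A(1)] by (auto simp: E_def)
  ultimately show ?thesis by (metis less_imp_le)
qed

lemma superlevel_sets:
  fixes g :: "'a \<Rightarrow> 'k::{real_normed_field, euclidean_space}"
  assumes g: "g \<in> borel_measurable N" and A: "A \<in> sets N"
  shows "{x\<in>A. s < norm (g x)} \<in> sets N"
proof -
  note g [measurable]
  have "{x\<in>space N. s < norm (g x)} \<in> sets N" by measurable
  then have "A \<inter> {x\<in>space N. s < norm (g x)} \<in> sets N" using A by (rule sets.Int[rotated])
  also have "A \<inter> {x\<in>space N. s < norm (g x)} = {x\<in>A. s < norm (g x)}"
    using sets.sets_into_space[OF A] by blast
  finally show ?thesis .
qed

text \<open>The two smallness conditions have different roles. \<open>ei\<close>, uniform absolute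
  continuity of the norms on \<open>S\<close>, produces the weak limit; \<open>oc\<close>, for
  indicators inside \<open>A\<close>, produces densities for the functionals that test it.\<close>

locale equi_integrable = fatou_koethe \<Omega> X
  for \<Omega> and X :: "'k::{real_normed_field, euclidean_space} fun_space" +
  fixes A :: "real set" and S :: "(real \<Rightarrow> 'k) set" and H :: real
  assumes A: "A \<in> sets (lebesgue_on \<Omega>)" and A_fin: "emeasure (lebesgue_on \<Omega>) A < \<infinity>"
    and S: "S \<subseteq> elems X" and S_off: "\<And>u x. u \<in> S \<Longrightarrow> x \<notin> A \<Longrightarrow> u x = 0"
    and S_bound: "\<And>u. u \<in> S \<Longrightarrow> nrm X u \<le> H" and H: "0 \<le> H"
    and ei: "\<And>\<epsilon>. 0 < \<epsilon> \<Longrightarrow> \<exists>\<delta>>0. \<forall>E\<in>sets (lebesgue_on \<Omega>). emeasure (lebesgue_on \<Omega>) E \<le> ennreal \<delta> \<longrightarrow>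
        (\<forall>u\<in>S. nrm X (\<lambda>x. u x * indicator E x) \<le> \<epsilon>)"
    and oc: "\<And>\<epsilon>. 0 < \<epsilon> \<Longrightarrow> \<exists>\<delta>>0. \<forall>E\<in>sets (lebesgue_on \<Omega>). E \<subseteq> A \<longrightarrow>
        emeasure (lebesgue_on \<Omega>) E \<le> ennreal \<delta> \<longrightarrow> nrm X (\<lambda>x. indicator E x) \<le> \<epsilon>"
begin

text \<open>Lebesgue measure restricted to \<open>A\<close> is the finite measure that the density
  lemmas require; the density is extended by 0.\<close>

lemma exists_density_on_A:
  fixes \<psi> :: "real set \<Rightarrow> 'k"
  assumes add: "\<And>E F. E \<in> sets L \<Longrightarrow> F \<in> sets L \<Longrightarrow> E \<subseteq> A \<Longrightarrow> F \<subseteq> A \<Longrightarrow>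
      E \<inter> F = {} \<Longrightarrow> \<psi> (E \<union> F) = \<psi> E + \<psi> F"
    and bound: "\<And>E. E \<in> sets L \<Longrightarrow> E \<subseteq> A \<Longrightarrow> norm (\<psi> E) \<le> K"
    and ac: "\<And>\<epsilon>. 0 < \<epsilon> \<Longrightarrow> \<exists>\<delta>>0. \<forall>E\<in>sets L. E \<subseteq> A \<longrightarrow>
        emeasure L E \<le> ennreal \<delta> \<longrightarrow> norm (\<psi> E) \<le> \<epsilon>"
  shows "\<exists>w. integrable L w \<and> (\<forall>x. x \<notin> A \<longrightarrow> w x = 0) \<and>
    (\<forall>E\<in>sets L. E \<subseteq> A \<longrightarrow> \<psi> E = (LINT x|L. indicator E x * w x))"
proof -
  define N where "N = restrict_space L A"
  have AA: "A \<inter> space L = A" using sets.sets_into_space[OF A] by blast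
  have A': "A \<inter> space L \<in> sets L" unfolding AA by (rule A)
  have setsN: "E \<in> sets N \<longleftrightarrow> E \<in> sets L \<and> E \<subseteq> A" for E
    unfolding N_def using sets_restrict_space_iff[OF A'] by blast
  have eN: "emeasure N E = emeasure L E" if "E \<subseteq> A" for E
    unfolding N_def by (rule emeasure_restrict_space[OF A' that])
  have spN: "space N = A" unfolding N_def using AA by (subst space_restrict_space)
  have fin: "finite_measure N" by (rule finite_measureI) (use A_fin in \<open>simp add: spN eN\<close>)
  interpret N: finite_measure N by (rule fin)
  have "\<exists>w. integrable N w \<and> (\<forall>E\<in>sets N. \<psi> E = (LINT x:E|N. w x))"
  proof (rule vector_additive_density[OF fin])
    show "\<exists>\<delta>>0. \<forall>E\<in>sets N. measure N E \<le> \<delta> \<longrightarrow> norm (\<psi> E) \<le> \<epsilon>" if \<epsilon>: "0 < \<epsilon>" for \<epsilon>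
    proof -
      obtain \<delta> where \<delta>: "0 < \<delta>" "\<And>E. E \<in> sets L \<Longrightarrow> E \<subseteq> A \<Longrightarrow>
        emeasure L E \<le> ennreal \<delta> \<Longrightarrow> norm (\<psi> E) \<le> \<epsilon>" using ac[OF \<epsilon>] by blast
      have "norm (\<psi> E) \<le> \<epsilon>" if E: "E \<in> sets N" "measure N E \<le> \<delta>" for E
      proof -
        have "emeasure N E \<le> ennreal \<delta>" using E(2) by (simp add: N.emeasure_eq_measure ennreal_leI)
        then show ?thesis using E(1) setsN eN \<delta>(2) by metis
      qed
      then show ?thesis using \<delta>(1) by blast
    qed
  qed (use add bound setsN in auto)
  then obtain w0 where w0: "integrable N w0" "\<And>E. E \<in> sets N \<Longrightarrow> \<psi> E = (LINT x:E|N. w0 x)" by blast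
  define w where "w x = indicator A x *\<^sub>R w0 x" for x
  have "integrable L w"
    using w0(1) unfolding N_def w_def integrable_restrict_space[OF A'] .
  moreover have "\<psi> E = (LINT x|L. indicator E x * w x)"
    if E: "E \<in> sets L" "E \<subseteq> A" for E
  proof -
    have "\<psi> E = (LINT x|N. indicator E x *\<^sub>R w0 x)"
      using w0(2)[of E] E by (simp add: setsN set_lebesgue_integral_def)
    also have "\<dots> = (LINT x|L. indicator A x *\<^sub>R (indicator E x *\<^sub>R w0 x))"
      unfolding N_def by (rule integral_restrict_space[OF A'])
    also have "(\<lambda>x. indicator A x *\<^sub>R (indicator E x *\<^sub>R w0 x)) = (\<lambda>x. indicator E x * w x)"
      by (auto simp: w_def indicator_def)
    finally show ?thesis .
  qed
  ultimately show ?thesis by (intro exI[of _ w]) (auto simp: w_def)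
qed

lemma bounded_mem:
  assumes v: "v \<in> borel_measurable L" "\<And>x. x \<in> \<Omega> \<Longrightarrow> norm (v x) \<le> b" and E: "E \<in> sets L" "E \<subseteq> A"
    and b: "0 \<le> b"
  shows "(\<lambda>x. v x * indicator E x) \<in> elems X" and "nrm X (\<lambda>x. v x * indicator E x) \<le> b * nrm X (\<lambda>x. indicator E x)"
proof -
  have "emeasure L E \<le> emeasure L A" by (intro emeasure_mono E A)
  then have iE: "(\<lambda>x. indicator E x) \<in> elems X" using A_fin by (intro indicator_mem E) simp
  have vm: "(\<lambda>x. v x * indicator E x) \<in> borel_measurable L" using v(1) E(1) by auto
  have ae: "AE x in L. norm (v x * indicator E x) \<le> norm (of_real b * indicator E x :: 'k)"
    using v(2) b by (intro AE_I2) (auto simp: indicator_def)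
  show "(\<lambda>x. v x * indicator E x) \<in> elems X" by (rule ideal_mem[OF vm scale_mem[OF iE] ae])
  have "nrm X (\<lambda>x. v x * indicator E x) \<le> nrm X (\<lambda>x. of_real b * indicator E x)"
    by (rule ideal_le[OF vm scale_mem[OF iE] ae])
  then show "nrm X (\<lambda>x. v x * indicator E x) \<le> b * nrm X (\<lambda>x. indicator E x)"
    using nrm_scale[OF iE, of "of_real b"] b by simp
qed

lemma indicator_mem_A: "E \<in> sets L \<Longrightarrow> E \<subseteq> A \<Longrightarrow> (\<lambda>x. indicator E x) \<in> elems X"
  using bounded_mem(1)[of "\<lambda>x. 1" 1 E] by simp

text \<open>By \<open>oc\<close> the set function \<open>E \<mapsto> \<phi> (indicator of E)\<close>
  is absolutely continuous on subsets of \<open>A\<close>. Its density represents \<phi> on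
  indicators, and uniform approximation extends this to bounded functions. Unbounded elements are
  treated later by cutting at levels.\<close>

lemma dual_representation:
  assumes \<phi>: "\<phi> \<in> dual_space X"
  obtains w where "integrable L w"
    "\<And>v b. v \<in> borel_measurable L \<Longrightarrow> (\<And>x. norm (v x) \<le> b) \<Longrightarrow>
      \<phi> (\<lambda>x. v x * indicator A x) = (LINT x|L. v x * w x)"
proof -
  obtain C where C: "0 \<le> C" "\<And>f. f \<in> elems X \<Longrightarrow> norm (\<phi> f) \<le> C * nrm X f" using dual_bound[OF \<phi>] by blast
  have "\<exists>w. integrable L w \<and> (\<forall>x. x \<notin> A \<longrightarrow> w x = 0) \<and>
    (\<forall>E\<in>sets L. E \<subseteq> A \<longrightarrow> \<phi> (\<lambda>x. indicator E x) = (LINT x|L. indicator E x * w x))"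
  proof (rule exists_density_on_A)
    fix E F assume EF: "E \<in> sets L" "F \<in> sets L" "E \<subseteq> A" "F \<subseteq> A" "E \<inter> F = {}"
    have "(\<lambda>x. indicator (E \<union> F) x) = (\<lambda>x. indicator E x + indicator F x :: 'k)"
      by (rule ext) (use EF(5) in \<open>auto simp: indicator_def\<close>)
    then show "\<phi> (\<lambda>x. indicator (E \<union> F) x) = \<phi> (\<lambda>x. indicator E x) + \<phi> (\<lambda>x. indicator F x)"
      using dual_add[OF \<phi> indicator_mem_A[OF EF(1,3)] indicator_mem_A[OF EF(2,4)]] by simp
  next
    fix E assume E: "E \<in> sets L" "E \<subseteq> A"
    have "nrm X (\<lambda>x. indicator E x) \<le> nrm X (\<lambda>x. indicator A x)"
      using E by (intro ideal_le indicator_mem_A A) (auto simp: indicator_def)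
    then show "norm (\<phi> (\<lambda>x. indicator E x)) \<le> C * nrm X (\<lambda>x. indicator A x)"
      using C(2)[OF indicator_mem_A[OF E]] mult_left_mono[OF _ C(1)] order_trans by blast
  next
    fix \<epsilon> :: real assume \<epsilon>: "0 < \<epsilon>"
    obtain \<delta> where \<delta>: "0 < \<delta>" "\<And>E. E \<in> sets L \<Longrightarrow> E \<subseteq> A \<Longrightarrow>
        emeasure L E \<le> ennreal \<delta> \<Longrightarrow> nrm X (\<lambda>x. indicator E x) \<le> \<epsilon> / (C + 1)"
      using oc[of "\<epsilon> / (C + 1)"] \<epsilon> C(1) by auto
    have "norm (\<phi> (\<lambda>x. indicator E x)) \<le> \<epsilon>"
      if E: "E \<in> sets L" "E \<subseteq> A" "emeasure L E \<le> ennreal \<delta>" for E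
    proof -
      have "norm (\<phi> (\<lambda>x. indicator E x)) \<le> C * nrm X (\<lambda>x. indicator E x)" by (rule C(2)[OF indicator_mem_A[OF E(1,2)]])
      also have "\<dots> \<le> C * (\<epsilon> / (C + 1))" by (rule mult_left_mono[OF \<delta>(2)[OF E] C(1)])
      also have "\<dots> \<le> \<epsilon>" using C(1) \<epsilon> by (simp add: field_simps)
      finally show ?thesis .
    qed
    then show "\<exists>\<delta>>0. \<forall>E\<in>sets L. E \<subseteq> A \<longrightarrow>
        emeasure L E \<le> ennreal \<delta> \<longrightarrow> norm (\<phi> (\<lambda>x. indicator E x)) \<le> \<epsilon>" using \<delta>(1) by blast
  qed
  then obtain w where w: "integrable L w" "\<And>x. x \<notin> A \<Longrightarrow> w x = 0"
    "\<And>E. E \<in> sets L \<Longrightarrow> E \<subseteq> A \<Longrightarrow> \<phi> (\<lambda>x. indicator E x) = (LINT x|L. indicator E x * w x)"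
    by blast
  have comm: "(LINT x|L. v x * w x) = (LINT x|L. w x * v x)" for v :: "real \<Rightarrow> 'k"
    by (simp add: mult.commute)
  show ?thesis
  proof (rule that[OF w(1)])
    fix v :: "real \<Rightarrow> 'k" and b assume v: "v \<in> borel_measurable L" "\<And>x. norm (v x) \<le> b"
    define \<Lambda> where "\<Lambda> v = \<phi> (\<lambda>x. v x * indicator A x) - (LINT x|L. v x * w x)" for v :: "real \<Rightarrow> 'k"
    have "\<Lambda> v = 0"
    proof (rule bounded_functional_eq_0[where \<Lambda> = \<Lambda> and v = v and N = L and B = b
          and C = "C * nrm X (\<lambda>x. indicator A x) + (LINT x|L. norm (w x))"])
      fix v u :: "real \<Rightarrow> 'k" and b assume vu: "v \<in> borel_measurable L" "u \<in> borel_measurable L"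
        "\<And>x. norm (v x) \<le> b" "\<And>x. norm (u x) \<le> b"
      have b: "0 \<le> b" using vu(3) norm_ge_zero order_trans by blast
      have "\<phi> (\<lambda>x. v x * indicator A x + u x * indicator A x) = \<phi> (\<lambda>x. v x * indicator A x) + \<phi> (\<lambda>x. u x * indicator A x)"
        using vu b A by (intro dual_add[OF \<phi>] bounded_mem(1)) auto
      moreover have "(LINT x|L. w x * v x + w x * u x) = (LINT x|L. w x * v x) + (LINT x|L. w x * u x)"
        using vu by (intro Bochner_Integration.integral_add integrable_mult_bounded(1)[OF w(1)])
      ultimately show "\<Lambda> (\<lambda>x. v x + u x) = \<Lambda> v + \<Lambda> u"
        unfolding \<Lambda>_def comm by (simp add: distrib_left distrib_right)
    next
      fix c :: 'k and v :: "real \<Rightarrow> 'k" and b assume v: "v \<in> borel_measurable L" "\<And>x. norm (v x) \<le> b"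
      have b: "0 \<le> b" using v(2) norm_ge_zero order_trans by blast
      have "\<phi> (\<lambda>x. c * (v x * indicator A x)) = c * \<phi> (\<lambda>x. v x * indicator A x)"
        using v b A by (intro dual_scale[OF \<phi>] bounded_mem(1)) auto
      then show "\<Lambda> (\<lambda>x. c * v x) = c * \<Lambda> v"
        unfolding \<Lambda>_def by (simp add: mult.assoc right_diff_distrib)
    next
      fix v :: "real \<Rightarrow> 'k" and b b' assume v: "v \<in> borel_measurable L" "0 \<le> b"
        "\<And>x. x \<in> space L \<Longrightarrow> norm (v x) \<le> b"
      have "norm (\<phi> (\<lambda>x. v x * indicator A x)) \<le> C * nrm X (\<lambda>x. v x * indicator A x)"
        using v A by (intro C(2) bounded_mem(1)) auto
      also have "\<dots> \<le> C * (b * nrm X (\<lambda>x. indicator A x))"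
        using v A by (intro mult_left_mono C(1) bounded_mem(2)) auto
      finally have 1: "norm (\<phi> (\<lambda>x. v x * indicator A x)) \<le> C * (b * nrm X (\<lambda>x. indicator A x))" .
      have 2: "norm (LINT x|L. v x * w x) \<le> b * (LINT x|L. norm (w x))"
        unfolding comm by (rule integrable_mult_bounded(2)[OF w(1) v(1,3)])
      have "norm (\<Lambda> v) \<le> C * (b * nrm X (\<lambda>x. indicator A x)) + b * (LINT x|L. norm (w x))"
        unfolding \<Lambda>_def using 1 2 by (rule order_trans[OF norm_triangle_ineq4 add_mono])
      then show "norm (\<Lambda> v) \<le> (C * nrm X (\<lambda>x. indicator A x) + (LINT x|L. norm (w x))) * b"
        by (simp add: algebra_simps)
    next
      fix E assume E: "E \<in> sets L"
      have eq: "(\<lambda>x. indicator E x * indicator A x) = (\<lambda>x. indicator (E \<inter> A) x :: 'k)" by (auto simp: indicator_def)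
      have "(\<lambda>x. indicator (E \<inter> A) x * w x) = (\<lambda>x. indicator E x * w x)"
        by (rule ext) (use w(2) in \<open>auto simp: indicator_def\<close>)
      then show "\<Lambda> (\<lambda>x. indicator E x) = 0"
        unfolding \<Lambda>_def eq using w(3)[of "E \<inter> A"] E A by simp
    next
      show "0 \<le> C * nrm X (\<lambda>x. indicator A x) + (LINT x|L. norm (w x))"
        using C(1) nrm_nonneg[OF indicator_mem_A[OF A order_refl]] by simp
    qed (use v in auto)
    then show "\<phi> (\<lambda>x. v x * indicator A x) = (LINT x|L. v x * w x)" by (simp add: \<Lambda>_def)
  qed
qed

text \<open>One constant serves for all bounded \<open>v\<close> supported in \<open>A\<close>; it
  comes from the continuous inclusion into L1(A).\<close>

definition pairing_const :: "real \<Rightarrow> bool" where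
  "pairing_const D \<longleftrightarrow> 0 \<le> D \<and> (\<forall>v b y. v \<in> borel_measurable L \<longrightarrow> (\<forall>x. norm (v x) \<le> b) \<longrightarrow>
      (\<forall>x. x \<notin> A \<longrightarrow> v x = 0) \<longrightarrow> y \<in> elems X \<longrightarrow>
      integrable L (\<lambda>x. y x * v x) \<and> norm (LINT x|L. y x * v x) \<le> b * (D * nrm X y))"

lemma pairing_bound: "\<exists>D. pairing_const D"
proof -
  obtain D where D: "0 \<le> D" "\<And>f. f \<in> elems X \<Longrightarrow> (LINT x:A|L. norm (f x)) \<le> D * nrm X f"
    using integral_le_nrm[OF A A_fin] by blast
  have "integrable L (\<lambda>x. y x * v x) \<and> norm (LINT x|L. y x * v x) \<le> b * (D * nrm X y)"
    if v: "v \<in> borel_measurable L" "\<And>x. norm (v x) \<le> b" "\<And>x. x \<notin> A \<Longrightarrow> v x = 0" and y: "y \<in> elems X" for v b y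
  proof -
    have b: "0 \<le> b" using v(2) norm_ge_zero order_trans by blast
    have i: "integrable L (\<lambda>x. indicator A x *\<^sub>R y x)"
      using set_integrable_mem[OF y A A_fin] by (simp add: set_integrable_def)
    have eq: "(\<lambda>x. y x * v x) = (\<lambda>x. (indicator A x *\<^sub>R y x) * v x)"
      using v(3) by (auto simp: indicator_def)
    have "(LINT x|L. norm (indicator A x *\<^sub>R y x)) = (LINT x:A|L. norm (y x))"
      by (simp add: set_lebesgue_integral_def)
    then have le: "b * (LINT x|L. norm (indicator A x *\<^sub>R y x)) \<le> b * (D * nrm X y)"
      using D(2)[OF y] b by (simp add: mult_left_mono)
    show ?thesis
      unfolding eq by (intro conjI integrable_mult_bounded(1)[OF i v(1,2)]
          order_trans[OF integrable_mult_bounded(2)[OF i v(1,2)] le])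
  qed
  then show ?thesis unfolding pairing_const_def using D(1) by (intro exI[of _ D]) auto
qed

lemma pairing_constD:
  assumes "pairing_const D" "v \<in> borel_measurable L" "\<And>x. norm (v x) \<le> b"
    "\<And>x. x \<notin> A \<Longrightarrow> v x = 0" "y \<in> elems X"
  shows "integrable L (\<lambda>x. y x * v x)"
    and "norm (LINT x|L. y x * v x) \<le> b * (D * nrm X y)"
proof -
  have "\<forall>x. norm (v x) \<le> b" "\<forall>x. x \<notin> A \<longrightarrow> v x = 0" using assms(3,4) by auto
  with assms(1,2,5) show "integrable L (\<lambda>x. y x * v x)"
    "norm (LINT x|L. y x * v x) \<le> b * (D * nrm X y)"
    unfolding pairing_const_def by blast+
qed

definition pairing :: "(real \<Rightarrow> 'k) \<Rightarrow> (real \<Rightarrow> 'k) \<Rightarrow> 'k" where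
  "pairing v y = (LINT x|L. y x * v x)"

lemma pairing_dual:
  assumes v: "v \<in> borel_measurable L" "\<And>x. norm (v x) \<le> b" "\<And>x. x \<notin> A \<Longrightarrow> v x = 0"
  shows "pairing v \<in> dual_space X"
proof -
  obtain D where D: "pairing_const D" using pairing_bound by blast
  have i: "integrable L (\<lambda>x. y x * v x)" "norm (pairing v y) \<le> b * D * nrm X y" if "y \<in> elems X" for y
    using pairing_constD[OF D v that] by (auto simp: pairing_def mult.assoc)
  show ?thesis
    unfolding dual_space_def
  proof (intro CollectI conjI ballI allI exI[of _ "b * D"] i(2))
    fix y y' assume y: "y \<in> elems X" "y' \<in> elems X"
    show "pairing v (\<lambda>x. y x + y' x) = pairing v y + pairing v y'"
      using Bochner_Integration.integral_add[OF i(1)[OF y(1)] i(1)[OF y(2)]] by (simp add: pairing_def distrib_right)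
  next
    fix c y assume "y \<in> elems X"
    show "pairing v (\<lambda>x. c * y x) = c * pairing v y" by (simp add: pairing_def mult.assoc)
  qed
qed

lemma restrict_dual:
  assumes \<phi>: "\<phi> \<in> dual_space X" and Q: "Q \<in> sets L"
  shows "(\<lambda>y. \<phi> (\<lambda>x. y x * indicator Q x)) \<in> dual_space X"
proof -
  obtain C where C: "0 \<le> C" "\<And>f. f \<in> elems X \<Longrightarrow> norm (\<phi> f) \<le> C * nrm X f" using dual_bound[OF \<phi>] by blast
  show ?thesis
    unfolding dual_space_def
  proof (intro CollectI conjI ballI allI exI[of _ C])
    fix y y' assume "y \<in> elems X" "y' \<in> elems X"
    then show "\<phi> (\<lambda>x. (y x + y' x) * indicator Q x) = \<phi> (\<lambda>x. y x * indicator Q x) + \<phi> (\<lambda>x. y' x * indicator Q x)"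
      using dual_add[OF \<phi> restrict_mem[OF _ Q] restrict_mem[OF _ Q], of y y'] by (simp add: distrib_right)
  next
    fix c y assume "y \<in> elems X"
    then show "\<phi> (\<lambda>x. c * y x * indicator Q x) = c * \<phi> (\<lambda>x. y x * indicator Q x)"
      using dual_scale[OF \<phi> restrict_mem[OF _ Q], of y c] by (simp add: mult.assoc)
  next
    fix y assume y: "y \<in> elems X"
    have "norm (\<phi> (\<lambda>x. y x * indicator Q x)) \<le> C * nrm X (\<lambda>x. y x * indicator Q x)"
      by (rule C(2)[OF restrict_mem[OF y Q]])
    also have "\<dots> \<le> C * nrm X y" by (rule mult_left_mono[OF restrict_le[OF y Q] C(1)])
    finally show "norm (\<phi> (\<lambda>x. y x * indicator Q x)) \<le> C * nrm X y" .
  qed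
qed

lemma nrm_restrict_mono:
  assumes "f \<in> elems X" "E \<in> sets L" "F \<in> sets L" "E \<subseteq> F"
  shows "nrm X (\<lambda>x. f x * indicator E x) \<le> nrm X (\<lambda>x. f x * indicator F x)"
proof -
  have "(\<lambda>x. f x * indicator E x) = (\<lambda>x. f x * indicator F x * indicator E x)"
    by (rule ext) (use assms(4) in \<open>auto simp: indicator_def\<close>)
  then show ?thesis using restrict_le[OF restrict_mem[OF assms(1,3)] assms(2)] by simp
qed

text \<open>Pairings with indicators of subsets of \<open>A\<close> yield a density \<open>h\<close>
  as candidate. A general functional has its own density \<open>w\<close>, and the two can be
  compared on sets where both \<open>h\<close> and \<open>w\<close> are bounded. What is left lies
  on sets of small measure, where \<open>ei\<close> and \<open>oc\<close> make it negligible. That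
  \<open>h\<close> belongs to the space at all is obtained from the same comparison with norming
  functionals and the Fatou property.\<close>

lemma limit_functional_represented:
  assumes app: "\<And>\<Phi> \<epsilon>. finite \<Phi> \<Longrightarrow> \<Phi> \<subseteq> dual_space X \<Longrightarrow> 0 < \<epsilon> \<Longrightarrow> \<exists>u\<in>S. \<forall>\<phi>\<in>\<Phi>. norm (z \<phi> - \<phi> u) < \<epsilon>"
  shows "\<exists>h\<in>elems X. \<forall>\<phi>\<in>dual_space X. z \<phi> = \<phi> h"
proof -
  have SX: "u \<in> elems X" if "u \<in> S" for u using S that by blast
  have z_le: "norm (z \<phi>) \<le> c" if \<phi>: "\<phi> \<in> dual_space X" and le: "\<And>u. u \<in> S \<Longrightarrow> norm (\<phi> u) \<le> c" for \<phi> c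
  proof (rule field_le_epsilon)
    fix \<epsilon> :: real assume "0 < \<epsilon>"
    then obtain u where u: "u \<in> S" "norm (z \<phi> - \<phi> u) < \<epsilon>" using app[of "{\<phi>}" \<epsilon>] \<phi> by auto
    then show "norm (z \<phi>) \<le> c + \<epsilon>" using le[OF u(1)] norm_triangle_ineq2[of "z \<phi>" "\<phi> u"] by linarith
  qed
  \<comment> \<open>\<open>z\<close> is not assumed linear. An approximate linear relation that
    holds on \<open>S\<close> passes to \<open>z\<close>, because several functionals can be
    approximated by one and the same \<open>u\<close>; an error of 0 gives linearity.\<close>
  have z_close: "norm (z \<phi> - (a * z \<phi>' + z \<phi>'')) \<le> c"
    if \<phi>: "\<phi> \<in> dual_space X" "\<phi>' \<in> dual_space X" "\<phi>'' \<in> dual_space X"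
      and le: "\<And>u. u \<in> S \<Longrightarrow> norm (\<phi> u - (a * \<phi>' u + \<phi>'' u)) \<le> c" for \<phi> \<phi>' \<phi>'' a c
  proof (rule field_le_epsilon)
    fix \<epsilon> :: real assume \<epsilon>: "0 < \<epsilon>"
    \<comment> \<open>One \<eta> each for \<phi> and \<phi>'', and |a| \<eta> for the multiple of
      \<phi>'.\<close>
    define \<eta> where "\<eta> = \<epsilon> / (norm a + 2)"
    have a2: "0 < norm a + 2" using norm_ge_zero[of a] by linarith
    have \<eta>: "0 < \<eta>" using \<epsilon> a2 by (simp add: \<eta>_def)
    obtain u where u: "u \<in> S" "norm (z \<phi> - \<phi> u) < \<eta>" "norm (z \<phi>' - \<phi>' u) < \<eta>" "norm (z \<phi>'' - \<phi>'' u) < \<eta>"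
      using app[of "{\<phi>, \<phi>', \<phi>''}" \<eta>] \<phi> \<eta> by auto
    have tri: "norm (p - q - r + t) \<le> norm p + norm q + norm r + norm t" for p q r t :: 'k
      using norm_triangle_ineq[of "p - q - r" t] norm_triangle_ineq4[of "p - q" r] norm_triangle_ineq4[of p q] by linarith
    have eq: "z \<phi> - (a * z \<phi>' + z \<phi>'') = (z \<phi> - \<phi> u) - a * (z \<phi>' - \<phi>' u) - (z \<phi>'' - \<phi>'' u) + (\<phi> u - (a * \<phi>' u + \<phi>'' u))"
      by (simp add: algebra_simps)
    have "norm (z \<phi> - (a * z \<phi>' + z \<phi>'')) \<le> norm (z \<phi> - \<phi> u) + norm (a * (z \<phi>' - \<phi>' u)) + norm (z \<phi>'' - \<phi>'' u) + norm (\<phi> u - (a * \<phi>' u + \<phi>'' u))"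
      unfolding eq by (rule tri)
    also have "\<dots> \<le> \<eta> + norm a * \<eta> + \<eta> + c"
      using u le[OF u(1)] by (intro add_mono) (auto simp: norm_mult intro: mult_left_mono)
    also have "\<dots> = c + \<eta> * (norm a + 2)" by (simp add: algebra_simps)
    also have "\<eta> * (norm a + 2) = \<epsilon>" using a2 by (simp add: \<eta>_def)
    finally show "norm (z \<phi> - (a * z \<phi>' + z \<phi>'')) \<le> c + \<epsilon>" .
  qed
  have z_lin: "z \<phi> = a * z \<phi>' + z \<phi>''"
    if \<phi>: "\<phi> \<in> dual_space X" "\<phi>' \<in> dual_space X" "\<phi>'' \<in> dual_space X"
      and eq: "\<And>u. u \<in> S \<Longrightarrow> \<phi> u = a * \<phi>' u + \<phi>'' u" for \<phi> \<phi>' \<phi>'' a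
    using z_close[OF \<phi>, of a 0] eq by simp
  have zero_dual: "(\<lambda>y. 0) \<in> dual_space X" by (auto simp: dual_space_def intro!: exI[of _ 0])
  have z_zero: "z (\<lambda>y. 0) = 0" using z_le[OF zero_dual, of 0] by simp
  have z_cong: "z \<phi> = z \<phi>'" if "\<phi> \<in> dual_space X" "\<phi>' \<in> dual_space X" "\<And>u. u \<in> S \<Longrightarrow> \<phi> u = \<phi>' u" for \<phi> \<phi>'
    using z_lin[OF that(1,2) zero_dual, of 1] that(3) z_zero by simp
  obtain D where D': "pairing_const D" using pairing_bound by blast
  then have D: "0 \<le> D" by (simp add: pairing_const_def)
  have pairing_integrable: "integrable L (\<lambda>x. y x * v x)" and pairing_le: "norm (pairing v y) \<le> b * (D * nrm X y)"
    if "v \<in> borel_measurable L" "\<And>x. norm (v x) \<le> b" "\<And>x. x \<notin> A \<Longrightarrow> v x = 0" "y \<in> elems X" for v b y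
    using pairing_constD[OF D' that] by (simp_all add: pairing_def)
  have ind: "(\<lambda>x. indicator E x :: 'k) \<in> borel_measurable L" "norm (indicator E x :: 'k) \<le> 1" "x \<notin> A \<Longrightarrow> indicator E x = (0::'k)"
    if "E \<in> sets L" "E \<subseteq> A" for E x
    using that by (auto simp: indicator_def)
  \<comment> \<open>The set function is absolutely continuous by \<open>ei\<close>, since a pairing
    with the indicator of \<open>E\<close> sees only the part of \<open>u\<close> on
    \<open>E\<close>.\<close>
  have "\<exists>h. integrable L h \<and> (\<forall>x. x \<notin> A \<longrightarrow> h x = 0) \<and>
    (\<forall>E\<in>sets L. E \<subseteq> A \<longrightarrow> z (pairing (\<lambda>x. indicator E x)) = (LINT x|L. indicator E x * h x))"
  proof (rule exists_density_on_A)
    fix E F assume EF: "E \<in> sets L" "F \<in> sets L" "E \<subseteq> A" "F \<subseteq> A" "E \<inter> F = {}"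
    have EuF: "E \<union> F \<in> sets L" "E \<union> F \<subseteq> A" using EF by auto
    have eq: "(\<lambda>x. indicator (E \<union> F) x) = (\<lambda>x. indicator E x + indicator F x :: 'k)"
      by (rule ext) (use EF(5) in \<open>auto simp: indicator_def\<close>)
    have "z (pairing (\<lambda>x. indicator (E \<union> F) x)) = 1 * z (pairing (\<lambda>x. indicator E x)) + z (pairing (\<lambda>x. indicator F x))"
    proof (rule z_lin[OF pairing_dual[OF ind[OF EuF]] pairing_dual[OF ind[OF EF(1,3)]] pairing_dual[OF ind[OF EF(2,4)]]])
      fix u assume "u \<in> S"
      then show "pairing (\<lambda>x. indicator (E \<union> F) x) u = 1 * pairing (\<lambda>x. indicator E x) u + pairing (\<lambda>x. indicator F x) u"
        using Bochner_Integration.integral_add[OF pairing_integrable[OF ind[OF EF(1,3)] SX] pairing_integrable[OF ind[OF EF(2,4)] SX], of u u]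
        unfolding pairing_def eq by (simp add: distrib_left)
    qed
    then show "z (pairing (\<lambda>x. indicator (E \<union> F) x)) = z (pairing (\<lambda>x. indicator E x)) + z (pairing (\<lambda>x. indicator F x))" by simp
  next
    fix E assume E: "E \<in> sets L" "E \<subseteq> A"
    show "norm (z (pairing (\<lambda>x. indicator E x))) \<le> D * H"
    proof (rule z_le[OF pairing_dual[OF ind[OF E]]])
      fix u assume u: "u \<in> S"
      show "norm (pairing (\<lambda>x. indicator E x) u) \<le> D * H"
        using pairing_le[OF ind[OF E] SX[OF u]] mult_left_mono[OF S_bound[OF u] D] by simp
    qed
  next
    fix \<epsilon> :: real assume \<epsilon>: "0 < \<epsilon>"
    have "0 < \<epsilon> / (D + 1)" using \<epsilon> D by simp
    then obtain \<delta> where \<delta>: "0 < \<delta>" "\<And>E u. E \<in> sets L \<Longrightarrow> emeasure L E \<le> ennreal \<delta> \<Longrightarrow>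
        u \<in> S \<Longrightarrow> nrm X (\<lambda>x. u x * indicator E x) \<le> \<epsilon> / (D + 1)"
      using ei by meson
    have "norm (z (pairing (\<lambda>x. indicator E x))) \<le> \<epsilon>"
      if E: "E \<in> sets L" "E \<subseteq> A" "emeasure L E \<le> ennreal \<delta>" for E
    proof (rule z_le[OF pairing_dual[OF ind[OF E(1,2)]]])
      fix u assume u: "u \<in> S"
      have "pairing (\<lambda>x. indicator E x) u = pairing (\<lambda>x. indicator E x) (\<lambda>x. u x * indicator E x)"
        unfolding pairing_def by (intro Bochner_Integration.integral_cong) (auto simp: indicator_def)
      then have "norm (pairing (\<lambda>x. indicator E x) u) \<le> D * nrm X (\<lambda>x. u x * indicator E x)"
        using pairing_le[OF ind[OF E(1,2)] restrict_mem[OF SX[OF u] E(1)]] by simp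
      also have "\<dots> \<le> D * (\<epsilon> / (D + 1))" by (rule mult_left_mono[OF \<delta>(2)[OF E(1,3) u] D])
      also have "\<dots> \<le> \<epsilon>" using D \<epsilon> by (simp add: field_simps)
      finally show "norm (pairing (\<lambda>x. indicator E x) u) \<le> \<epsilon>" .
    qed
    then show "\<exists>\<delta>>0. \<forall>E\<in>sets L. E \<subseteq> A \<longrightarrow>
        emeasure L E \<le> ennreal \<delta> \<longrightarrow> norm (z (pairing (\<lambda>x. indicator E x))) \<le> \<epsilon>" using \<delta>(1) by blast
  qed
  then obtain h where h: "integrable L h" "\<And>x. x \<notin> A \<Longrightarrow> h x = 0"
    "\<And>E. E \<in> sets L \<Longrightarrow> E \<subseteq> A \<Longrightarrow> z (pairing (\<lambda>x. indicator E x)) = (LINT x|L. indicator E x * h x)"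
    by blast
  have hm: "h \<in> borel_measurable L" using h(1) by simp
  have comm: "(LINT x|L. v x * h x) = (LINT x|L. h x * v x)" for v
    by (simp add: mult.commute)
  have vA: "(\<lambda>x. v x * indicator A x) \<in> borel_measurable L" "norm (v x * indicator A x) \<le> b"
    "x \<notin> A \<Longrightarrow> v x * indicator A x = 0"
    if "v \<in> borel_measurable L" "0 \<le> b" "\<And>x. x \<in> \<Omega> \<Longrightarrow> norm (v x) \<le> b" for v :: "real \<Rightarrow> 'k" and b x
    using that A sets.sets_into_space[OF A] by (auto simp: indicator_def)
  \<comment> \<open>Both sides are bounded and linear in \<open>v\<close> and agree on indicators,
    so uniform approximation applies again.\<close>
  have z_pairing: "z (pairing (\<lambda>x. v x * indicator A x)) = (LINT x|L. v x * h x)"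
    if v: "v \<in> borel_measurable L" "\<And>x. norm (v x) \<le> b" for v b
  proof -
    define \<Lambda> where "\<Lambda> v = z (pairing (\<lambda>x. v x * indicator A x)) - (LINT x|L. v x * h x)" for v
    have "\<Lambda> v = 0"
    proof (rule bounded_functional_eq_0[where \<Lambda> = \<Lambda> and v = v and N = L and B = b
          and C = "D * H + (LINT x|L. norm (h x))"])
      fix v w :: "real \<Rightarrow> 'k" and b assume v: "v \<in> borel_measurable L" "\<And>x. norm (v x) \<le> b"
        and w: "w \<in> borel_measurable L" "\<And>x. norm (w x) \<le> b"
      have b: "0 \<le> b" using v(2) norm_ge_zero order_trans by blast
      have vw: "(\<lambda>x. v x + w x) \<in> borel_measurable L" "norm (v x + w x) \<le> b + b" for x
        using v(1) w(1) order_trans[OF norm_triangle_ineq add_mono[OF v(2) w(2)], of x x] by simp_all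
      have bb: "0 \<le> b + b" using b by simp
      have "z (pairing (\<lambda>x. (v x + w x) * indicator A x)) = 1 * z (pairing (\<lambda>x. v x * indicator A x)) + z (pairing (\<lambda>x. w x * indicator A x))"
      proof (rule z_lin[OF pairing_dual[OF vA[OF vw(1) bb vw(2)]] pairing_dual[OF vA[OF v(1) b v(2)]] pairing_dual[OF vA[OF w(1) b w(2)]]])
        fix u assume "u \<in> S"
        then show "pairing (\<lambda>x. (v x + w x) * indicator A x) u = 1 * pairing (\<lambda>x. v x * indicator A x) u + pairing (\<lambda>x. w x * indicator A x) u"
          using Bochner_Integration.integral_add[OF pairing_integrable[OF vA[OF v(1) b v(2)] SX] pairing_integrable[OF vA[OF w(1) b w(2)] SX], of u u]
          unfolding pairing_def by (simp add: distrib_left distrib_right)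
      qed
      moreover have "(LINT x|L. h x * v x + h x * w x) = (LINT x|L. h x * v x) + (LINT x|L. h x * w x)"
        using v w by (intro Bochner_Integration.integral_add integrable_mult_bounded(1)[OF h(1)])
      ultimately show "\<Lambda> (\<lambda>x. v x + w x) = \<Lambda> v + \<Lambda> w"
        unfolding \<Lambda>_def comm by (simp add: distrib_left)
    next
      fix c :: 'k and v :: "real \<Rightarrow> 'k" and b assume v: "v \<in> borel_measurable L" "\<And>x. norm (v x) \<le> b"
      have b: "0 \<le> b" using v(2) norm_ge_zero order_trans by blast
      have cv: "(\<lambda>x. c * v x) \<in> borel_measurable L" "\<And>x. norm (c * v x) \<le> norm c * b"
        using v by (auto simp: norm_mult intro: mult_left_mono)
      have cb: "0 \<le> norm c * b" using b by simp
      have "z (pairing (\<lambda>x. (c * v x) * indicator A x)) = c * z (pairing (\<lambda>x. v x * indicator A x)) + z (\<lambda>y. 0)"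
      proof (rule z_lin[OF pairing_dual[OF vA[OF cv(1) cb cv(2)]] pairing_dual[OF vA[OF v(1) b v(2)]] zero_dual])
        fix u assume "u \<in> S"
        have "(\<lambda>x. u x * (c * v x * indicator A x)) = (\<lambda>x. c * (u x * (v x * indicator A x)))" by (simp add: mult_ac)
        then show "pairing (\<lambda>x. (c * v x) * indicator A x) u = c * pairing (\<lambda>x. v x * indicator A x) u + 0"
          unfolding pairing_def by simp
      qed
      then show "\<Lambda> (\<lambda>x. c * v x) = c * \<Lambda> v"
        unfolding \<Lambda>_def z_zero by (simp add: mult.assoc right_diff_distrib)
    next
      fix v :: "real \<Rightarrow> 'k" and b b' assume v: "v \<in> borel_measurable L" "0 \<le> b"
        "\<And>x. x \<in> space L \<Longrightarrow> norm (v x) \<le> b"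
      have v3: "norm (v x) \<le> b" if "x \<in> \<Omega>" for x using v(3) that by simp
      have 1: "norm (z (pairing (\<lambda>x. v x * indicator A x))) \<le> b * (D * H)"
      proof (rule z_le[OF pairing_dual[OF vA[OF v(1,2) v3]]])
        fix u assume u: "u \<in> S"
        have "norm (pairing (\<lambda>x. v x * indicator A x) u) \<le> b * (D * nrm X u)" by (rule pairing_le[OF vA[OF v(1,2) v3] SX[OF u]])
        also have "\<dots> \<le> b * (D * H)" by (intro mult_left_mono S_bound u D v(2))
        finally show "norm (pairing (\<lambda>x. v x * indicator A x) u) \<le> b * (D * H)" .
      qed
      have 2: "norm (LINT x|L. v x * h x) \<le> b * (LINT x|L. norm (h x))"
        unfolding comm by (rule integrable_mult_bounded(2)[OF h(1) v(1,3)])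
      have "norm (\<Lambda> v) \<le> b * (D * H) + b * (LINT x|L. norm (h x))"
        unfolding \<Lambda>_def using 1 2 by (rule order_trans[OF norm_triangle_ineq4 add_mono])
      then show "norm (\<Lambda> v) \<le> (D * H + (LINT x|L. norm (h x))) * b"
        by (simp add: algebra_simps)
    next
      fix E assume E: "E \<in> sets L"
      have eq: "(\<lambda>x. indicator E x * indicator A x) = (\<lambda>x. indicator (E \<inter> A) x :: 'k)" by (auto simp: indicator_def)
      have "(\<lambda>x. indicator (E \<inter> A) x * h x) = (\<lambda>x. indicator E x * h x)"
        by (rule ext) (use h(2) in \<open>auto simp: indicator_def\<close>)
      then show "\<Lambda> (\<lambda>x. indicator E x) = 0"
        unfolding \<Lambda>_def eq using h(3)[of "E \<inter> A"] E A by simp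
    next
      show "0 \<le> D * H + (LINT x|L. norm (h x))" using D H by simp
    qed (use v in auto)
    then show ?thesis by (simp add: \<Lambda>_def)
  qed
  \<comment> \<open>On \<open>Q\<close> the two representations meet. On \<open>S\<close> the
    functional \<phi> restricted to \<open>Q\<close> coincides with the pairing against
    \<open>w\<close> cut to \<open>Q\<close>; \<open>z\<close> turns this pairing into the integral
    of \<open>w h\<close> over \<open>Q\<close>; since \<open>h\<close> is bounded on
    \<open>Q\<close>, the integral is again a value of \<phi>.\<close>
  have z_restrict: "z (\<lambda>y. \<phi> (\<lambda>x. y x * indicator Q x)) = \<phi> (\<lambda>x. h x * indicator Q x)"
    if \<phi>: "\<phi> \<in> dual_space X"
      and w: "integrable L w" "\<And>v b. v \<in> borel_measurable L \<Longrightarrow> (\<And>x. norm (v x) \<le> b) \<Longrightarrow>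
        \<phi> (\<lambda>x. v x * indicator A x) = (LINT x|L. v x * w x)"
      and Q: "Q \<in> sets L" "Q \<subseteq> A" "\<And>x. x \<in> Q \<Longrightarrow> norm (w x) \<le> m" "\<And>x. x \<in> Q \<Longrightarrow> norm (h x) \<le> n"
      and mn: "0 \<le> m" "0 \<le> n" for \<phi> w Q m n
  proof -
    obtain C where C: "0 \<le> C" "\<And>f. f \<in> elems X \<Longrightarrow> norm (\<phi> f) \<le> C * nrm X f" using dual_bound[OF \<phi>] by blast
    have wm: "w \<in> borel_measurable L" using w(1) by simp
    define wQ where "wQ x = w x * indicator Q x" for x
    have wQ: "wQ \<in> borel_measurable L" "\<And>x. norm (wQ x) \<le> m" "\<And>x. x \<notin> A \<Longrightarrow> wQ x = 0"
      using wm Q mn by (auto simp: wQ_def[abs_def] indicator_def)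
    \<comment> \<open>The representation by \<open>w\<close> covers bounded functions, so
      \<open>u\<close> is cut at a level \<open>k\<close>. The remainder lives on the small set
      \<open>E\<close>, and \<open>ei\<close> makes its contribution to both functionals arbitrarily
      small.\<close>
    have eq: "\<phi> (\<lambda>x. u x * indicator Q x) = pairing wQ u" if u: "u \<in> S" for u
    proof -
      have uX: "u \<in> elems X" by (rule SX[OF u])
      have "norm (\<phi> (\<lambda>x. u x * indicator Q x) - pairing wQ u) \<le> 0"
      proof (rule field_le_epsilon)
        fix e :: real assume e: "0 < e"
        define \<epsilon> where "\<epsilon> = e / (C + m * D + 1)"
        have cmd: "0 < C + m * D + 1" using C(1) mn D by (simp add: add_nonneg_pos)
        have \<epsilon>: "0 < \<epsilon>" using e cmd by (simp add: \<epsilon>_def)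
        obtain \<delta> where \<delta>: "0 < \<delta>" "\<And>E u. E \<in> sets L \<Longrightarrow> emeasure L E \<le> ennreal \<delta> \<Longrightarrow>
            u \<in> S \<Longrightarrow> nrm X (\<lambda>x. u x * indicator E x) \<le> \<epsilon>"
          using ei[OF \<epsilon>] by meson
        obtain k :: nat where k: "emeasure L {x\<in>A. real k < norm (u x)} \<le> ennreal \<delta>"
          using exists_small_superlevel[OF meas[OF uX] A A_fin \<delta>(1)] by blast
        define E where "E = {x\<in>A. real k < norm (u x)}"
        have E: "E \<in> sets L" unfolding E_def by (rule superlevel_sets[OF meas[OF uX] A])
        have uE: "nrm X (\<lambda>x. u x * indicator E x) \<le> \<epsilon>" using \<delta>(2)[OF E _ u] k by (simp add: E_def)
        define v where "v x = u x * indicator (Q - E) x" for x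
        have QE: "Q - E \<in> sets L" "Q \<inter> E \<in> sets L" using Q(1) E by auto
        have v: "v \<in> borel_measurable L" "norm (v x) \<le> real k" for x
        proof -
          show "v \<in> borel_measurable L"
            unfolding v_def[abs_def] by (intro borel_measurable_times meas[OF uX] borel_measurable_indicator QE)
          show "norm (v x) \<le> real k" using Q(2) by (auto simp: v_def E_def indicator_def)
        qed
        have split: "\<phi> (\<lambda>x. u x * indicator Q x) = \<phi> v + \<phi> (\<lambda>x. u x * indicator (Q \<inter> E) x)"
        proof -
          have "(\<lambda>x. u x * indicator Q x) = (\<lambda>x. v x + u x * indicator (Q \<inter> E) x)"
            by (rule ext) (auto simp: v_def indicator_def)
          then show ?thesis
            using dual_add[OF \<phi> restrict_mem[OF uX QE(1)] restrict_mem[OF uX QE(2)]] by (simp add: v_def[abs_def])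
        qed
        have "(\<lambda>x. v x * indicator A x) = v" using Q(2) by (auto simp: v_def indicator_def fun_eq_iff)
        then have \<phi>v: "\<phi> v = (LINT x|L. v x * w x)" using w(2)[OF v] by simp
        have vw: "v x * w x = v x * wQ x" for x by (auto simp: v_def wQ_def indicator_def)
        have uEX: "(\<lambda>x. u x * indicator E x) \<in> elems X" by (rule restrict_mem[OF uX E])
        have vX: "v \<in> elems X" unfolding v_def by (rule restrict_mem[OF uX QE(1)])
        have "pairing wQ u = pairing wQ v + pairing wQ (\<lambda>x. u x * indicator E x)"
        proof -
          have "(\<lambda>x. u x * wQ x) = (\<lambda>x. v x * wQ x + u x * indicator E x * wQ x)"
            by (rule ext) (auto simp: v_def wQ_def indicator_def)
          then show ?thesis
            unfolding pairing_def using Bochner_Integration.integral_add[OF pairing_integrable[OF wQ vX] pairing_integrable[OF wQ uEX]] by simp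
        qed
        then have "\<phi> (\<lambda>x. u x * indicator Q x) - pairing wQ u = \<phi> (\<lambda>x. u x * indicator (Q \<inter> E) x) - pairing wQ (\<lambda>x. u x * indicator E x)"
          unfolding split \<phi>v pairing_def vw by simp
        also have "norm \<dots> \<le> norm (\<phi> (\<lambda>x. u x * indicator (Q \<inter> E) x)) + norm (pairing wQ (\<lambda>x. u x * indicator E x))"
          by (rule norm_triangle_ineq4)
        also have "norm (\<phi> (\<lambda>x. u x * indicator (Q \<inter> E) x)) \<le> C * \<epsilon>"
        proof -
          have "nrm X (\<lambda>x. u x * indicator (Q \<inter> E) x) \<le> \<epsilon>"
            using nrm_restrict_mono[OF uX QE(2) E] uE by simp
          then show ?thesis using C(2)[OF restrict_mem[OF uX QE(2)]] mult_left_mono[OF _ C(1)] order_trans by blast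
        qed
        also have "norm (pairing wQ (\<lambda>x. u x * indicator E x)) \<le> m * (D * \<epsilon>)"
          using pairing_le[OF wQ uEX] mult_left_mono[OF mult_left_mono[OF uE D] mn(1)] by simp
        also have "C * \<epsilon> + m * (D * \<epsilon>) \<le> (C + m * D + 1) * \<epsilon>" using \<epsilon> by (simp add: algebra_simps)
        also have "(C + m * D + 1) * \<epsilon> = e" using cmd by (simp add: \<epsilon>_def)
        finally show "norm (\<phi> (\<lambda>x. u x * indicator Q x) - pairing wQ u) \<le> 0 + e" by simp
      qed
      then show ?thesis by simp
    qed
    have "z (\<lambda>y. \<phi> (\<lambda>x. y x * indicator Q x)) = z (pairing wQ)"
      by (rule z_cong[OF restrict_dual[OF \<phi> Q(1)] pairing_dual[OF wQ] eq])
    also have "pairing wQ = pairing (\<lambda>x. wQ x * indicator A x)"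
      using wQ(3) by (intro arg_cong[where f = pairing]) (auto simp: indicator_def fun_eq_iff)
    also have "z \<dots> = (LINT x|L. wQ x * h x)" by (rule z_pairing[OF wQ(1,2)])
    also have "\<dots> = (LINT x|L. h x * indicator Q x * w x)" by (simp add: wQ_def mult_ac)
    also have "\<dots> = \<phi> (\<lambda>x. h x * indicator Q x * indicator A x)"
      using hm Q mn by (intro w(2)[where b = n, symmetric]) (auto simp: indicator_def)
    also have "(\<lambda>x. h x * indicator Q x * indicator A x) = (\<lambda>x. h x * indicator Q x)"
      using Q(2) by (auto simp: indicator_def fun_eq_iff)
    finally show ?thesis .
  qed
  define G where "G n = {x\<in>A. norm (h x) \<le> real n}" for n
  have G: "G n \<in> sets L" for n
  proof -
    have "G n = A - {x\<in>A. real n < norm (h x)}" by (auto simp: G_def)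
    then show ?thesis using superlevel_sets[OF hm A, of "real n"] A by auto
  qed
  have Gm: "(\<lambda>x. h x * indicator (G n) x) \<in> borel_measurable L" for n
    by (intro borel_measurable_times hm borel_measurable_indicator G)
  have Gb: "norm (h x * indicator (G n) x) \<le> real n" for n x by (auto simp: G_def indicator_def)
  have GX: "(\<lambda>x. h x * indicator (G n \<inter> E) x) \<in> elems X" if E: "E \<in> sets L" for n E
  proof -
    have "(\<lambda>x. h x * indicator (G n) x * indicator (G n \<inter> E) x) \<in> elems X"
      using G[of n] E by (intro bounded_mem(1)[OF Gm Gb]) (auto simp: G_def)
    moreover have "(\<lambda>x. h x * indicator (G n) x * indicator (G n \<inter> E) x) = (\<lambda>x. h x * indicator (G n \<inter> E) x)"
      by (auto simp: indicator_def fun_eq_iff)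
    ultimately show ?thesis by simp
  qed
  \<comment> \<open>The truncated \<open>h\<close> is tested with a functional that norms it. Where
    the density of this functional is at most \<open>m\<close>, \<open>z_restrict\<close> and
    \<open>z_le\<close> give the bound \<open>s\<close> inherited from \<open>S\<close>; the rest is
    at most \<open>n\<close> times an indicator that \<open>oc\<close> makes small.\<close>
  have G_le: "nrm X (\<lambda>x. h x * indicator (G n \<inter> E) x) \<le> s"
    if E: "E \<in> sets L" and s: "\<And>u. u \<in> S \<Longrightarrow> nrm X (\<lambda>x. u x * indicator E x) \<le> s" for n E s
  proof -
    define v where "v x = h x * indicator (G n \<inter> E) x" for x
    have vX: "v \<in> elems X" unfolding v_def by (rule GX[OF E])
    obtain \<phi> where \<phi>: "\<phi> \<in> dual_space X" "\<And>f. f \<in> elems X \<Longrightarrow> norm (\<phi> f) \<le> nrm X f" "nrm X v \<le> norm (\<phi> v)"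
      by (rule norming_functional[OF vX]) blast
    obtain w where w: "integrable L w"
      "\<And>v b. v \<in> borel_measurable L \<Longrightarrow> (\<And>x. norm (v x) \<le> b) \<Longrightarrow>
        \<phi> (\<lambda>x. v x * indicator A x) = (LINT x|L. v x * w x)"
      using dual_representation[OF \<phi>(1)] by blast
    have wm: "w \<in> borel_measurable L" using w(1) by simp
    have "nrm X v \<le> s"
    proof (rule field_le_epsilon)
      fix \<epsilon> :: real assume \<epsilon>: "0 < \<epsilon>"
      have "0 < \<epsilon> / (real n + 1)" using \<epsilon> by simp
      then obtain \<delta> where \<delta>: "0 < \<delta>" "\<And>F. F \<in> sets L \<Longrightarrow> F \<subseteq> A \<Longrightarrow>
          emeasure L F \<le> ennreal \<delta> \<Longrightarrow> nrm X (\<lambda>x. indicator F x) \<le> \<epsilon> / (real n + 1)"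
        using oc by meson
      obtain m :: nat where m: "emeasure L {x\<in>A. real m < norm (w x)} \<le> ennreal \<delta>"
        using exists_small_superlevel[OF wm A A_fin \<delta>(1)] by blast
      define B where "B = {x\<in>A. real m < norm (w x)}"
      have B: "B \<in> sets L" "B \<subseteq> A" unfolding B_def using superlevel_sets[OF wm A] by auto
      define Q where "Q = G n \<inter> E - B"
      have Q: "Q \<in> sets L" "Q \<subseteq> A" unfolding Q_def using G E B by (auto simp: G_def)
      define F where "F = G n \<inter> E \<inter> B"
      have F: "F \<in> sets L" "F \<subseteq> A" unfolding F_def using G E B by auto
      have "emeasure L F \<le> emeasure L B" by (intro emeasure_mono B) (auto simp: F_def)
      then have iF: "nrm X (\<lambda>x. indicator F x) \<le> \<epsilon> / (real n + 1)" using m by (intro \<delta>(2) F) (simp add: B_def)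
      define q where "q x = h x * indicator Q x" for x
      define f where "f x = h x * indicator F x" for x
      have fq: "(\<lambda>x. q x + f x) = v" by (auto simp: q_def f_def v_def Q_def F_def indicator_def fun_eq_iff)
      have qX: "q \<in> elems X"
      proof -
        have "q = (\<lambda>x. v x * indicator Q x)" by (auto simp: q_def v_def Q_def indicator_def fun_eq_iff)
        then show ?thesis using restrict_mem[OF vX Q(1)] by simp
      qed
      have fX: "f \<in> elems X" "nrm X f \<le> real n * nrm X (\<lambda>x. indicator F x)"
      proof -
        have "f = (\<lambda>x. (h x * indicator (G n) x) * indicator F x)" by (auto simp: f_def F_def indicator_def fun_eq_iff)
        then show "f \<in> elems X" "nrm X f \<le> real n * nrm X (\<lambda>x. indicator F x)"
          using bounded_mem[OF Gm Gb F] by auto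
      qed
      have "nrm X v \<le> norm (\<phi> v)" by (rule \<phi>(3))
      also have "\<phi> v = \<phi> q + \<phi> f" using dual_add[OF \<phi>(1) qX fX(1)] by (simp add: fq)
      also have "norm (\<phi> q + \<phi> f) \<le> norm (\<phi> q) + norm (\<phi> f)" by (rule norm_triangle_ineq)
      also have "norm (\<phi> f) \<le> \<epsilon>"
      proof -
        have "norm (\<phi> f) \<le> real n * (\<epsilon> / (real n + 1))"
          using \<phi>(2)[OF fX(1)] fX(2) mult_left_mono[OF iF, of "real n"] by simp
        also have "\<dots> \<le> \<epsilon>" using \<epsilon> by (simp add: field_simps)
        finally show ?thesis .
      qed
      also have "norm (\<phi> q) \<le> s"
      proof -
        have "z (\<lambda>y. \<phi> (\<lambda>x. y x * indicator Q x)) = \<phi> q"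
          unfolding q_def
        proof (rule z_restrict[OF \<phi>(1) w Q])
          show "norm (w x) \<le> real m" if "x \<in> Q" for x using that by (auto simp: Q_def B_def G_def not_less)
          show "norm (h x) \<le> real n" if "x \<in> Q" for x using that by (auto simp: Q_def G_def)
        qed auto
        moreover have "norm (z (\<lambda>y. \<phi> (\<lambda>x. y x * indicator Q x))) \<le> s"
        proof (rule z_le[OF restrict_dual[OF \<phi>(1) Q(1)]])
          fix u assume u: "u \<in> S"
          have "norm (\<phi> (\<lambda>x. u x * indicator Q x)) \<le> nrm X (\<lambda>x. u x * indicator Q x)"
            by (rule \<phi>(2)[OF restrict_mem[OF SX[OF u] Q(1)]])
          also have "\<dots> \<le> nrm X (\<lambda>x. u x * indicator E x)"
            by (rule nrm_restrict_mono[OF SX[OF u] Q(1) E]) (auto simp: Q_def)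
          also have "\<dots> \<le> s" by (rule s[OF u])
          finally show "norm (\<phi> (\<lambda>x. u x * indicator Q x)) \<le> s" .
        qed
        ultimately show ?thesis by simp
      qed
      finally show "nrm X v \<le> s + \<epsilon>" by simp
    qed
    then show ?thesis unfolding v_def .
  qed
  \<comment> \<open>The bound for the truncations does not depend on \<open>n\<close>, so the Fatou
    property removes the cut. With \<open>E = A\<close> this puts \<open>h\<close> into the space;
    for small \<open>E\<close> it shows that \<open>h\<close> inherits the estimate in
    \<open>ei\<close>.\<close>
  have h_restrict: "(\<lambda>x. h x * indicator E x) \<in> elems X" "nrm X (\<lambda>x. h x * indicator E x) \<le> s"
    if E: "E \<in> sets L" and s: "\<And>u. u \<in> S \<Longrightarrow> nrm X (\<lambda>x. u x * indicator E x) \<le> s" for E s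
  proof -
    have m: "(\<lambda>x. h x * indicator E x) \<in> borel_measurable L" using hm E by auto
    have lim: "AE x in L. (\<lambda>n. h x * indicator (G n \<inter> E) x) \<longlonglongrightarrow> h x * indicator E x"
    proof (rule AE_I2)
      fix x
      obtain N where N: "norm (h x) \<le> real N" using real_arch_simple by blast
      have "h x * indicator (G n \<inter> E) x = h x * indicator E x" if "n \<ge> N" for n
      proof (cases "x \<in> A")
        case True
        then have "x \<in> G n" using N that by (simp add: G_def)
        then show ?thesis by (simp add: indicator_def)
      qed (simp add: h(2))
      then show "(\<lambda>n. h x * indicator (G n \<inter> E) x) \<longlonglongrightarrow> h x * indicator E x"
        by (intro tendsto_eventually) (auto simp: eventually_sequentially)
    qed
    show "(\<lambda>x. h x * indicator E x) \<in> elems X" "nrm X (\<lambda>x. h x * indicator E x) \<le> s"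
      using fatou_limit[OF GX[OF E] G_le[OF E s] m lim] by auto
  qed
  have hX: "h \<in> elems X"
  proof -
    have "(\<lambda>x. h x * indicator A x) \<in> elems X"
    proof (rule h_restrict(1)[OF A])
      show "nrm X (\<lambda>x. u x * indicator A x) \<le> H" if "u \<in> S" for u
        using restrict_le[OF SX[OF that] A] S_bound[OF that] by simp
    qed
    moreover have "(\<lambda>x. h x * indicator A x) = h" using h(2) by (auto simp: indicator_def fun_eq_iff)
    ultimately show ?thesis by simp
  qed
  have "z \<phi> = \<phi> h" if \<phi>: "\<phi> \<in> dual_space X" for \<phi>
  proof -
    obtain C where C: "0 \<le> C" "\<And>f. f \<in> elems X \<Longrightarrow> norm (\<phi> f) \<le> C * nrm X f" using dual_bound[OF \<phi>] by blast
    obtain w where w: "integrable L w"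
      "\<And>v b. v \<in> borel_measurable L \<Longrightarrow> (\<And>x. norm (v x) \<le> b) \<Longrightarrow>
        \<phi> (\<lambda>x. v x * indicator A x) = (LINT x|L. v x * w x)"
      using dual_representation[OF \<phi>] by blast
    have wm: "w \<in> borel_measurable L" using w(1) by simp
    have "norm (z \<phi> - \<phi> h) \<le> 0"
    proof (rule field_le_epsilon)
      fix e :: real assume e: "0 < e"
      define \<epsilon> where "\<epsilon> = e / (2 * (C + 1))"
      have \<epsilon>: "0 < \<epsilon>" using e C(1) by (simp add: \<epsilon>_def)
      obtain \<delta> where \<delta>: "0 < \<delta>" "\<And>E u. E \<in> sets L \<Longrightarrow> emeasure L E \<le> ennreal \<delta> \<Longrightarrow>
          u \<in> S \<Longrightarrow> nrm X (\<lambda>x. u x * indicator E x) \<le> \<epsilon>"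
        using ei[OF \<epsilon>] by meson
      have \<delta>2: "0 < \<delta> / 2" using \<delta>(1) by simp
      obtain n :: nat where n: "emeasure L {x\<in>A. real n < norm (h x)} \<le> ennreal (\<delta> / 2)"
        using exists_small_superlevel[OF hm A A_fin \<delta>2] by blast
      obtain m :: nat where m: "emeasure L {x\<in>A. real m < norm (w x)} \<le> ennreal (\<delta> / 2)"
        using exists_small_superlevel[OF wm A A_fin \<delta>2] by blast
      \<comment> \<open>The points where \<open>h\<close> or \<open>w\<close> is too large for
        \<open>z_restrict\<close>. Each part has measure at most \<delta> / 2, so \<open>ei\<close>
        controls the members of \<open>S\<close> on \<open>E\<close>, and \<open>h_restrict\<close>
        controls \<open>h\<close> there.\<close>
      define E where "E = {x\<in>A. real n < norm (h x)} \<union> {x\<in>A. real m < norm (w x)}"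
      have E: "E \<in> sets L" "E \<subseteq> A"
        unfolding E_def using superlevel_sets[OF hm A] superlevel_sets[OF wm A] by auto
      have "emeasure L E \<le> ennreal (\<delta> / 2) + ennreal (\<delta> / 2)"
        unfolding E_def using n m superlevel_sets[OF hm A] superlevel_sets[OF wm A]
        by (intro order_trans[OF emeasure_subadditive add_mono]) auto
      also have "\<dots> = ennreal \<delta>" using \<delta>(1) by (simp flip: ennreal_plus)
      finally have uE: "nrm X (\<lambda>x. u x * indicator E x) \<le> \<epsilon>" if "u \<in> S" for u
        using \<delta>(2)[OF E(1) _ that] by simp
      define Q where "Q = A - E"
      have Q: "Q \<in> sets L" "Q \<subseteq> A" unfolding Q_def using A E by auto
      have split: "\<phi> y = \<phi> (\<lambda>x. y x * indicator Q x) + \<phi> (\<lambda>x. y x * indicator E x)"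
        if y: "y \<in> elems X" "\<And>x. x \<notin> A \<Longrightarrow> y x = 0" for y
      proof -
        have "y = (\<lambda>x. y x * indicator Q x + y x * indicator E x)"
          by (rule ext) (use y(2) E(2) in \<open>auto simp: Q_def indicator_def\<close>)
        then have "\<phi> y = \<phi> (\<lambda>x. y x * indicator Q x + y x * indicator E x)" by simp
        then show ?thesis using dual_add[OF \<phi> restrict_mem[OF y(1) Q(1)] restrict_mem[OF y(1) E(1)]] by simp
      qed
      have zQ: "z (\<lambda>y. \<phi> (\<lambda>x. y x * indicator Q x)) = \<phi> (\<lambda>x. h x * indicator Q x)"
      proof (rule z_restrict[OF \<phi> w Q])
        show "norm (w x) \<le> real m" if "x \<in> Q" for x using that by (auto simp: Q_def E_def not_less)
        show "norm (h x) \<le> real n" if "x \<in> Q" for x using that by (auto simp: Q_def E_def not_less)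
      qed auto
      have 1: "norm (z \<phi> - (1 * z (\<lambda>y. \<phi> (\<lambda>x. y x * indicator Q x)) + z (\<lambda>y. 0))) \<le> C * \<epsilon>"
      proof (rule z_close[OF \<phi> restrict_dual[OF \<phi> Q(1)] zero_dual])
        fix u assume u: "u \<in> S"
        have "\<phi> u - (1 * \<phi> (\<lambda>x. u x * indicator Q x) + 0) = \<phi> (\<lambda>x. u x * indicator E x)"
          using split[OF SX[OF u] S_off[OF u]] by simp
        then show "norm (\<phi> u - (1 * \<phi> (\<lambda>x. u x * indicator Q x) + 0)) \<le> C * \<epsilon>"
          using C(2)[OF restrict_mem[OF SX[OF u] E(1)]] mult_left_mono[OF uE[OF u] C(1)] by simp
      qed
      have 2: "norm (\<phi> (\<lambda>x. h x * indicator E x)) \<le> C * \<epsilon>"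
        using C(2)[OF restrict_mem[OF hX E(1)]] mult_left_mono[OF h_restrict(2)[OF E(1) uE] C(1)] by simp
      have "z \<phi> - \<phi> h = (z \<phi> - \<phi> (\<lambda>x. h x * indicator Q x)) - \<phi> (\<lambda>x. h x * indicator E x)"
        using split[OF hX h(2)] by simp
      then have "norm (z \<phi> - \<phi> h) \<le> norm (z \<phi> - \<phi> (\<lambda>x. h x * indicator Q x)) + norm (\<phi> (\<lambda>x. h x * indicator E x))"
        by (simp only: norm_triangle_ineq4)
      also have "\<dots> \<le> C * \<epsilon> + C * \<epsilon>" using 1 2 by (intro add_mono) (simp_all add: zQ z_zero)
      also have "\<dots> \<le> 2 * (C + 1) * \<epsilon>" using \<epsilon> by (simp add: algebra_simps)
      also have "\<dots> = e" using C(1) by (simp add: \<epsilon>_def)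
      finally show "norm (z \<phi> - \<phi> h) \<le> 0 + e" by simp
    qed
    then show ?thesis by simp
  qed
  then show ?thesis using hX by blast
qed

theorem weakly_compact: "compactin (weak_topology X) (weak_topology X closure_of S)"
  by (rule compactin_weak_closure[OF S S_bound limit_functional_represented])

end

section \<open>The weak essential norm\<close>

context multipliers begin

text \<open>Both smallness conditions come from the norm of indicators in \<open>M\<close>. On
  \<open>A\<close> the multiplier is bounded by \<open>B\<close>, so the image of \<open>f\<close>
  on \<open>E\<close> is dominated by \<open>B\<close> times \<open>f\<close> on \<open>E\<close>.
  For \<open>E \<subseteq> A\<close> the indicator of \<open>E\<close> is its own product with that
  of \<open>A\<close>, which belongs to \<open>X\<close>.\<close>

lemma truncated_multiplication_weakly_compact:
  assumes nontriv: "\<exists>g \<in> oc_part \<Omega> M. \<not> (AE x in L. g x = 0)"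
    and l: "l \<in> elems M" and A: "truncation_set l A"
  shows "weakly_compact_operator \<Omega> X Y (mult_op (\<lambda>x. l x * indicator A x))"
proof -
  have Am: "A \<in> sets L" and A_fin: "emeasure L A < \<infinity>"
    using A by (auto simp: truncation_set_def)
  obtain b where b: "\<And>x. x \<in> A \<Longrightarrow> norm (l x) \<le> b" using A unfolding truncation_set_def by blast
  define B where "B = max b 0"
  have B: "norm (l x) \<le> B" if "x \<in> A" for x using b[OF that] by (simp add: B_def le_max_iff_disj)
  have B0: "0 \<le> B" by (simp add: B_def)
  define lA where "lA x = l x * indicator A x" for x
  have lA: "lA \<in> elems M" unfolding lA_def[abs_def] by (rule restrict_mem_M[OF l Am])
  have mult: "mult_op lA f = (\<lambda>x. f x * lA x)" for f by (auto simp: mult_op_def mult.commute)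
  have bounded: "bounded_operator \<Omega> X Y (mult_op lA)"
    unfolding bounded_operator_def mult
  proof (intro conjI ballI allI impI exI[of _ "nrm M lA"])
    show "(\<lambda>x. f x * lA x) \<in> elems Y" if "f \<in> elems X" for f by (rule mult_mem[OF lA that])
    show "nrm Y (\<lambda>x. f x * lA x) \<le> nrm M lA * nrm X f" if "f \<in> elems X" for f by (rule nrm_mult_le[OF lA that])
  qed (auto simp: distrib_right mult.assoc elim!: eventually_mono)
  define S where "S = mult_op lA ` unit_ball X"
  have S_cases: "\<exists>f\<in>unit_ball X. u = (\<lambda>x. f x * lA x)" if "u \<in> S" for u
    using that by (auto simp: S_def mult)
  have small: "\<exists>\<delta>>0. \<forall>E\<in>sets L. emeasure L E \<le> ennreal \<delta> \<longrightarrow>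
      (\<lambda>x. indicator E x) \<in> elems M \<and> nrm M (\<lambda>x. indicator E x) < \<epsilon>" if "0 < \<epsilon>" for \<epsilon>
    using indicator_small_M[OF nontriv that] by metis
  interpret equi_integrable \<Omega> Y A S "nrm M lA"
  proof
    show "A \<in> sets L" "emeasure L A < \<infinity>" by fact+
    show "S \<subseteq> elems Y" using S_cases mult_mem[OF lA] by (fastforce simp: unit_ball_def)
    show "u x = 0" if "u \<in> S" "x \<notin> A" for u x using S_cases[OF that(1)] that(2) by (auto simp: lA_def)
    show "nrm Y u \<le> nrm M lA" if "u \<in> S" for u using S_cases[OF that] nrm_mult_unit_ball[OF lA] by blast
    show "0 \<le> nrm M lA" by (rule nrm_M_nonneg[OF lA])
  next
    fix \<epsilon> :: real assume \<epsilon>: "0 < \<epsilon>"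
    have "0 < \<epsilon> / (B + 1)" using \<epsilon> B0 by simp
    then obtain \<delta> where \<delta>: "0 < \<delta>" "\<And>E. E \<in> sets L \<Longrightarrow> emeasure L E \<le> ennreal \<delta> \<Longrightarrow>
      (\<lambda>x. indicator E x) \<in> elems M \<and> nrm M (\<lambda>x. indicator E x) < \<epsilon> / (B + 1)" using small by meson
    have "nrm Y (\<lambda>x. u x * indicator E x) \<le> \<epsilon>"
      if E: "E \<in> sets L" "emeasure L E \<le> ennreal \<delta>" and u: "u \<in> S" for E u
    proof -
      obtain f where f: "f \<in> unit_ball X" "u = (\<lambda>x. f x * lA x)" using S_cases[OF u] by blast
      have fX: "f \<in> elems X" using f(1) by (simp add: unit_ball_def)
      have iE: "(\<lambda>x. indicator E x) \<in> elems M" "nrm M (\<lambda>x. indicator E x) \<le> \<epsilon> / (B + 1)"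
        using \<delta>(2)[OF E] by auto
      have BE: "(\<lambda>x. of_real B * indicator E x) \<in> elems M" by (rule scale_mem_M[OF iE(1)])
      have "nrm Y (\<lambda>x. u x * indicator E x) \<le> nrm Y (\<lambda>x. f x * (of_real B * indicator E x))"
      proof (rule Y.ideal_le[OF _ mult_mem[OF BE fX]])
        show "(\<lambda>x. u x * indicator E x) \<in> borel_measurable L"
          using Y.meas[OF mult_mem[OF lA fX]] E(1) unfolding f(2) by auto
        have "norm (u x * indicator E x) \<le> norm (f x * (of_real B * indicator E x))" for x
          using B[of x] B0 by (auto simp: f(2) lA_def indicator_def norm_mult mult_left_mono)
        then show "AE x in L. norm (u x * indicator E x) \<le> norm (f x * (of_real B * indicator E x))" by simp
      qed
      also have "\<dots> \<le> nrm M (\<lambda>x. of_real B * indicator E x)" by (rule nrm_mult_unit_ball[OF BE f(1)])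
      also have "\<dots> \<le> B * nrm M (\<lambda>x. indicator E x)" using nrm_scale_M[OF iE(1), of "of_real B"] B0 by simp
      also have "\<dots> \<le> B * (\<epsilon> / (B + 1))" by (rule mult_left_mono[OF iE(2) B0])
      also have "\<dots> \<le> \<epsilon>" using B0 \<epsilon> by (simp add: field_simps)
      finally show ?thesis .
    qed
    then show "\<exists>\<delta>>0. \<forall>E\<in>sets L. emeasure L E \<le> ennreal \<delta> \<longrightarrow>
        (\<forall>u\<in>S. nrm Y (\<lambda>x. u x * indicator E x) \<le> \<epsilon>)" using \<delta>(1) by blast
  next
    fix \<epsilon> :: real assume \<epsilon>: "0 < \<epsilon>"
    define a where "a = nrm X (\<lambda>x. indicator A x)"
    have iA: "(\<lambda>x. indicator A x) \<in> elems X" by (rule X.indicator_mem[OF Am A_fin])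
    have a0: "0 \<le> a" unfolding a_def by (rule X.nrm_nonneg[OF iA])
    have "0 < \<epsilon> / (a + 1)" using \<epsilon> a0 by simp
    then obtain \<delta> where \<delta>: "0 < \<delta>" "\<And>E. E \<in> sets L \<Longrightarrow> emeasure L E \<le> ennreal \<delta> \<Longrightarrow>
      (\<lambda>x. indicator E x) \<in> elems M \<and> nrm M (\<lambda>x. indicator E x) < \<epsilon> / (a + 1)" using small by meson
    have "nrm Y (\<lambda>x. indicator E x) \<le> \<epsilon>"
      if E: "E \<in> sets L" "E \<subseteq> A" "emeasure L E \<le> ennreal \<delta>" for E
    proof -
      have iE: "(\<lambda>x. indicator E x) \<in> elems M" "nrm M (\<lambda>x. indicator E x) \<le> \<epsilon> / (a + 1)"
        using \<delta>(2)[OF E(1,3)] by auto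
      have eq: "(\<lambda>x. indicator E x :: 'k) = (\<lambda>x. indicator A x * indicator E x)"
        by (rule ext) (use E(2) in \<open>auto simp: indicator_def\<close>)
      have "nrm Y (\<lambda>x. indicator E x) = nrm Y (\<lambda>x. indicator A x * indicator E x)"
        by (rule arg_cong[where f = "nrm Y", OF eq])
      also have "\<dots> \<le> nrm M (\<lambda>x. indicator E x) * a"
        unfolding a_def by (rule nrm_mult_le[OF iE(1) iA])
      also have "\<dots> \<le> \<epsilon> / (a + 1) * a" by (rule mult_right_mono[OF iE(2) a0])
      also have "\<dots> \<le> \<epsilon>" using a0 \<epsilon> by (simp add: field_simps)
      finally show ?thesis .
    qed
    then show "\<exists>\<delta>>0. \<forall>E\<in>sets L. E \<subseteq> A \<longrightarrow>
        emeasure L E \<le> ennreal \<delta> \<longrightarrow> nrm Y (\<lambda>x. indicator E x) \<le> \<epsilon>" using \<delta>(1) by blast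
  qed
  show ?thesis
    unfolding weakly_compact_operator_def using bounded weakly_compact
    unfolding S_def lA_def[abs_def] by blast
qed

lemma op_norm_nonneg:
  assumes l: "l \<in> elems M" and W: "bounded_operator \<Omega> X Y W"
  shows "0 \<le> op_norm X Y (\<lambda>f x. mult_op l f x - W f x)"
proof -
  have "(\<lambda>x. mult_op l (\<lambda>x. 0) x - W (\<lambda>x. 0) x) \<in> elems Y"
    using W X.zero_mem Y.zero_mem by (intro Y.diff_mem) (auto simp: mult_op_def bounded_operator_def)
  then have "0 \<le> nrm Y (\<lambda>x. mult_op l (\<lambda>x. 0) x - W (\<lambda>x. 0) x)" by (rule Y.nrm_nonneg)
  also have "\<dots> \<le> op_norm X Y (\<lambda>f x. mult_op l f x - W f x)"
    unfolding op_norm_def by (rule cSUP_upper[OF zero_unit_ball op_norm_bdd[OF l W]])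
  finally show ?thesis .
qed

text \<open>Subtracting multiplication by \<open>l\<close> on \<open>A\<close> leaves multiplication
  by \<open>l\<close> on the complement.\<close>

lemma weak_ess_norm_le:
  assumes nontriv: "\<exists>g \<in> oc_part \<Omega> M. \<not> (AE x in L. g x = 0)"
    and l: "l \<in> elems M" and A: "truncation_set l A"
  shows "weak_ess_norm \<Omega> X Y (mult_op l) \<le> nrm M (\<lambda>x. l x * indicator (\<Omega> - A) x)"
proof -
  define W where "W = mult_op (\<lambda>x. l x * indicator A x)"
  have W: "weakly_compact_operator \<Omega> X Y W"
    unfolding W_def by (rule truncated_multiplication_weakly_compact[OF nontriv l A])
  have "weak_ess_norm \<Omega> X Y (mult_op l) \<le> op_norm X Y (\<lambda>f x. mult_op l f x - W f x)"
    unfolding weak_ess_norm_def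
  proof (rule cInf_lower)
    show "bdd_below {op_norm X Y (\<lambda>f x. mult_op l f x - W f x) | W. weakly_compact_operator \<Omega> X Y W}"
      using op_norm_nonneg[OF l] by (intro bdd_belowI[of _ 0]) (auto simp: weakly_compact_operator_def)
  qed (use W in blast)
  also have "\<dots> \<le> nrm M (\<lambda>x. l x * indicator (\<Omega> - A) x)"
    unfolding op_norm_def
  proof (rule cSUP_least)
    fix f assume f: "f \<in> unit_ball X"
    then have fX: "f \<in> elems X" by (simp add: unit_ball_def)
    have Ac: "\<Omega> - A \<in> sets L"
      using A sets.compl_sets[of A L] by (simp add: truncation_set_def)
    have lAc: "(\<lambda>x. l x * indicator (\<Omega> - A) x) \<in> elems M" by (rule restrict_mem_M[OF l Ac])
    have Wf: "W f \<in> elems Y" using W fX by (auto simp: weakly_compact_operator_def bounded_operator_def)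
    have lf: "mult_op l f \<in> elems Y" using mult_mem[OF l fX] by (simp add: mult_op_def mult.commute)
    have "nrm Y (\<lambda>x. mult_op l f x - W f x) = nrm Y (\<lambda>x. f x * (l x * indicator (\<Omega> - A) x))"
      by (intro Y.nrm_cong_norm Y.diff_mem lf Wf mult_mem[OF lAc fX] AE_I2)
        (auto simp: mult_op_def W_def indicator_def norm_mult)
    also have "\<dots> \<le> nrm M (\<lambda>x. l x * indicator (\<Omega> - A) x)" by (rule nrm_mult_unit_ball[OF lAc f])
    finally show "nrm Y (\<lambda>x. mult_op l f x - W f x) \<le> nrm M (\<lambda>x. l x * indicator (\<Omega> - A) x)" .
  qed (use zero_unit_ball in blast)
  finally show ?thesis .
qed

text \<open>If all truncations stayed at least \<open>e\<close> above the weak essential norm, the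
  perturbation theorem would push every competitor in the defining infimum up by
  \<open>e\<close>.\<close>

lemma exists_truncation_near_weak_ess_norm:
  assumes nontriv: "\<exists>g \<in> oc_part \<Omega> M. \<not> (AE x in L. g x = 0)"
    and DH: "one_DH \<Omega> Y" and l: "l \<in> elems M" and e: "0 < e"
  shows "\<exists>A. truncation_set l A \<and> nrm M (\<lambda>x. l x * indicator (\<Omega> - A) x) < weak_ess_norm \<Omega> X Y (mult_op l) + e"
proof (rule ccontr)
  assume "\<not> ?thesis"
  then have r: "weak_ess_norm \<Omega> X Y (mult_op l) + e \<le> nrm M (\<lambda>x. l x * indicator (\<Omega> - A) x)"
    if "truncation_set l A" for A using that by (meson not_le)
  \<comment> \<open>The empty truncation set supplies the zero operator, so the infimum is over a
    non-empty set.\<close>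
  have "truncation_set l {}" by (simp add: truncation_set_def)
  then have W0: "weakly_compact_operator \<Omega> X Y (mult_op (\<lambda>x. l x * indicator {} x))"
    by (rule truncated_multiplication_weakly_compact[OF nontriv l])
  have "weak_ess_norm \<Omega> X Y (mult_op l) + e \<le> weak_ess_norm \<Omega> X Y (mult_op l)"
    unfolding weak_ess_norm_def[of \<Omega> X Y "mult_op l", abs_def]
  proof (rule cInf_greatest)
    show "{op_norm X Y (\<lambda>f x. mult_op l f x - W f x) | W. weakly_compact_operator \<Omega> X Y W} \<noteq> {}"
      using W0 by blast
    fix y assume "y \<in> {op_norm X Y (\<lambda>f x. mult_op l f x - W f x) | W. weakly_compact_operator \<Omega> X Y W}"
    then obtain W where "y = op_norm X Y (\<lambda>f x. mult_op l f x - W f x)" "weakly_compact_operator \<Omega> X Y W" by blast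
    then show "Inf {op_norm X Y (\<lambda>f x. mult_op l f x - W f x) | W. weakly_compact_operator \<Omega> X Y W} + e \<le> y"
      using op_norm_weakly_compact_perturbation[OF DH l _ r] by (simp add: weak_ess_norm_def)
  qed
  then show False using e by simp
qed

end

text \<open>The two estimates are not symmetric. Each n \<ge> 2 admits a truncation set adapted to
  \<open>D n\<close>, so the lower estimate holds for all these \<open>n\<close>; for the upper one
  a nearly optimal truncation set is fixed first, and \<open>n\<close> must be large in terms of its
  measure and of the bound for \<open>l\<close> on it.\<close>

theorem corollary4p21:
  fixes \<Omega> :: "real set"
    and X Y :: "'k::{real_normed_field, euclidean_space} fun_space"
    and l :: "real \<Rightarrow> 'k"
  assumes "\<Omega> = {0<..<1} \<or> \<Omega> = {0<..}"
    and "ri_space \<Omega> X" and "fatou_property \<Omega> X"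
    and "ri_space \<Omega> Y" and "fatou_property \<Omega> Y"
    and "one_DH \<Omega> Y"
    and "\<exists>g \<in> oc_part \<Omega> (multiplier_space \<Omega> X Y). \<not> (AE x in lebesgue_on \<Omega>. g x = 0)"
    and "l \<in> elems (multiplier_space \<Omega> X Y)"
  shows "(\<lambda>n::nat. nrm (multiplier_space \<Omega> X Y)
            (\<lambda>x. of_real (decr_rearr \<Omega> l x * indicator ({0<..<1 / real n} \<union> {real n<..}) x)))
         \<longlonglongrightarrow> weak_ess_norm \<Omega> X Y (mult_op l)"
proof -
  interpret multipliers \<Omega> X Y
    by unfold_locales (use assms(1,2,4,5) in \<open>auto simp: ri_space_def\<close>)
  interpret half_line_or_unit_interval \<Omega> l
    by unfold_locales (use assms(1,8) in \<open>auto simp: elems_M\<close>)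
  note nontriv = assms(7) and lM = assms(8)
  define w where "w = weak_ess_norm \<Omega> X Y (mult_op l)"
  have restr: "(\<lambda>x. of_real (ls x * indicator B x)) \<in> elems M" if "B \<in> sets borel" for B
    by (rule dominated_mem[OF lM restricted_rearr_measurable[OF that] distr_restricted_le[OF that]])
  have lower: "w \<le> nrm M (lsD n)" if n: "2 \<le> n" for n
  proof -
    obtain A where A: "A \<in> sets (lebesgue_on \<Omega>)" "emeasure (lebesgue_on \<Omega>) A < \<infinity>" "\<exists>B. \<forall>x\<in>A. norm (l x) \<le> B"
      and le: "\<And>s. 0 \<le> s \<Longrightarrow> distr_fun \<Omega> (\<lambda>x. l x * indicator (\<Omega> - A) x) s \<le> distr_fun \<Omega> (lsD n) s"
      using truncation_exists[OF n] by blast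
    have tA: "truncation_set l A" using A by (simp add: truncation_set_def)
    have Ac: "\<Omega> - A \<in> sets (lebesgue_on \<Omega>)" using sets.compl_sets[OF A(1)] by simp
    have "w \<le> nrm M (\<lambda>x. l x * indicator (\<Omega> - A) x)"
      unfolding w_def by (rule weak_ess_norm_le[OF nontriv lM tA])
    also have "\<dots> \<le> nrm M (lsD n)"
      by (rule dominated_le[OF restr meas_M[OF restrict_mem_M[OF lM Ac]] le]) auto
    finally show ?thesis .
  qed
  have upper: "\<exists>N. \<forall>n\<ge>N. nrm M (lsD n) < w + e" if e: "0 < e" for e
  proof -
    have e2: "0 < e / 2" using e by simp
    obtain A where tA: "truncation_set l A" and An: "nrm M (\<lambda>x. l x * indicator (\<Omega> - A) x) < w + e / 2"
      using exists_truncation_near_weak_ess_norm[OF nontriv assms(6) lM e2] unfolding w_def by blast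
    have A: "A \<in> sets (lebesgue_on \<Omega>)" "emeasure (lebesgue_on \<Omega>) A < \<infinity>"
      using tA by (auto simp: truncation_set_def)
    define \<alpha> where "\<alpha> = measure (lebesgue_on \<Omega>) A"
    have \<alpha>: "emeasure (lebesgue_on \<Omega>) A = ennreal \<alpha>" "0 \<le> \<alpha>"
      using A(2) unfolding \<alpha>_def by (auto intro!: emeasure_eq_ennreal_measure)
    obtain b where b: "\<And>x. x \<in> A \<Longrightarrow> norm (l x) \<le> b" using tA unfolding truncation_set_def by blast
    define B where "B = max b 0"
    have B: "norm (l x) \<le> B" if "x \<in> A" for x using b[OF that] by (simp add: B_def le_max_iff_disj)
    have B0: "0 \<le> B" by (simp add: B_def)
    have Ac: "\<Omega> - A \<in> sets (lebesgue_on \<Omega>)" using sets.compl_sets[OF A(1)] by simp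
    have lAc: "(\<lambda>x. l x * indicator (\<Omega> - A) x) \<in> elems M" by (rule restrict_mem_M[OF lM Ac])
    \<comment> \<open>The margin is chosen so that \<open>B\<close> times the norm of a small
      indicator costs at most the other e / 2, also when \<open>B = 0\<close>.\<close>
    have "0 < e / (2 * (B + 1))" using e B0 by simp
    then obtain \<delta> where \<delta>: "0 < \<delta>" "\<And>E. E \<in> sets (lebesgue_on \<Omega>) \<Longrightarrow> emeasure (lebesgue_on \<Omega>) E \<le> ennreal \<delta> \<Longrightarrow>
      (\<lambda>x. indicator E x) \<in> elems M \<and> nrm M (\<lambda>x. indicator E x) < e / (2 * (B + 1))"
      using indicator_small_M[OF nontriv] by metis
    \<comment> \<open>\<open>1 / \<delta>\<close> makes (0, 1/n) short enough for
      \<open>indicator_small_M\<close>; the other two bounds are those of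
      \<open>rearr_tail_dominated\<close>.\<close>
    obtain N where N: "max (max (1 / \<delta>) (\<alpha> + 1)) 2 \<le> real N" using real_arch_simple by blast
    have "nrm M (lsD n) < w + e" if n: "N \<le> n" for n
    proof -
      have "real N \<le> real n" using n by simp
      then have nn: "1 / \<delta> \<le> real n" "\<alpha> + 1 \<le> real n" "2 \<le> real n" using N by auto
      then have n2: "2 \<le> n" by linarith
      \<comment> \<open>\<open>lsD n\<close> is split: on \<open>C\<close> it is dominated in
        distribution by \<open>l\<close> off \<open>A\<close>, and what is left lies on
        \<open>E\<close> with values at most \<open>B\<close>.\<close>
      define C where "C = {x. ennreal x < d B \<and> x < 1 / real n} \<union> {real n<..}"
      have C: "C \<in> sets borel" unfolding C_def by measurable
      define E where "E = \<Omega> \<inter> {0<..<1 / real n}"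
      have E: "E \<in> sets (lebesgue_on \<Omega>)" using \<Omega>_sets by (auto simp: E_def sets_restrict_space_iff)
      have "emeasure (lebesgue_on \<Omega>) E = emeasure lebesgue E" by (rule emeasure_on) (simp add: E_def)
      also have "\<dots> \<le> emeasure lebesgue {0<..<1 / real n}" by (rule emeasure_mono) (auto simp: E_def)
      also have "\<dots> \<le> ennreal \<delta>" using nn(1) \<delta>(1) n2 by (simp add: field_simps)
      finally have iE: "(\<lambda>x. indicator E x) \<in> elems M" "nrm M (\<lambda>x. indicator E x) \<le> e / (2 * (B + 1))"
        using \<delta>(2)[OF E] by auto
      define tail where "tail x = (of_real (ls x * indicator C x) :: 'k)" for x
      have tail: "tail \<in> elems M" unfolding tail_def[abs_def] by (rule restr[OF C])
      have "nrm M tail \<le> nrm M (\<lambda>x. l x * indicator (\<Omega> - A) x)"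
        using rearr_tail_dominated[OF A(1) \<alpha> B B0 n2 nn(2)]
        unfolding tail_def[abs_def] C_def
        by (intro dominated_le[OF lAc restricted_rearr_measurable]) (auto simp: C_def[symmetric] C)
      moreover have "nrm M (\<lambda>x. of_real B * indicator E x) \<le> B * (e / (2 * (B + 1)))"
        using nrm_scale_M[OF iE(1), of "of_real B"] mult_left_mono[OF iE(2) B0] B0 by simp
      moreover have "B * (e / (2 * (B + 1))) \<le> e / 2" using B0 e by (simp add: field_simps)
      moreover have "nrm M (lsD n) \<le> nrm M (\<lambda>x. tail x + of_real B * indicator E x)"
      proof (rule ideal_le_M[OF restricted_rearr_measurable add_mem_M[OF tail scale_mem_M[OF iE(1)]]])
        show "AE x in lebesgue_on \<Omega>. norm (lsD n x) \<le> norm (tail x + of_real B * indicator E x)"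
        proof (rule AE_I2)
          fix x assume "x \<in> space (lebesgue_on \<Omega>)"
          then have x: "x \<in> \<Omega>" by simp
          have x0: "0 < x" by (rule \<Omega>_pos[OF x])
          have ls0: "0 \<le> ls x" by (rule rearr_nonneg[OF x0])
          \<comment> \<open>A point of (0, 1/n) outside \<open>C\<close> has
            \<open>d B \<le> x\<close>, which means \<open>ls x \<le> B\<close>.\<close>
          have cases: "ls x * indicator (D n) x \<le> ls x * indicator C x + B * indicator E x"
            using less_rearr_iff[OF x0 B0] x ls0 B0 by (auto simp: C_def E_def indicator_def not_less)
          have sum: "tail x + of_real B * indicator E x = of_real (ls x * indicator C x + B * indicator E x)"
            by (simp add: tail_def indicator_def)
          have "0 \<le> ls x * indicator (D n) x" using ls0 by (intro mult_nonneg_nonneg) auto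
          then show "norm (lsD n x) \<le> norm (tail x + of_real B * indicator E x)"
            unfolding sum norm_of_real using cases by linarith
        qed
      qed auto
      moreover have "nrm M (\<lambda>x. tail x + of_real B * indicator E x) \<le> nrm M tail + nrm M (\<lambda>x. of_real B * indicator E x)"
        by (rule nrm_add_M[OF tail scale_mem_M[OF iE(1)]])
      ultimately show ?thesis using An by linarith
    qed
    then show ?thesis by blast
  qed
  have "(\<lambda>n. nrm M (lsD n)) \<longlonglongrightarrow> w"
  proof (rule LIMSEQ_I)
    fix e :: real assume e: "0 < e"
    obtain N where N: "\<And>n. N \<le> n \<Longrightarrow> nrm M (lsD n) < w + e" using upper[OF e] by blast
    have "norm (nrm M (lsD n) - w) < e" if "max N 2 \<le> n" for n
      using N[of n] lower[of n] that by (simp add: abs_less_iff)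
    then show "\<exists>no. \<forall>n\<ge>no. norm (nrm M (lsD n) - w) < e" by blast
  qed
  then show ?thesis unfolding w_def .
qed

end
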